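(* Let $t,s,s_1,s_2\in\mathbb{N}$, $m\in\mathbb{Z}$, $\alpha\in\mathrm{Ext}_{2t+1}(V)$, $\omega\in\mathrm{Ext}^{2t+1}(V)$, $\beta\in\mathrm{Ext}_{2s}(V)$, $\beta_i\in\mathrm{Ext}_{2s_i}(V)$, $\mu\in\mathrm{Ext}^{2s}(V)$, $\mu_i\in\mathrm{Ext}^{2s_i}(V)$ ($i=1,2$). For any hypergraphs $\mathcal{H}_1$ and $\mathcal{H}_2$ with vertices from $V$: (1) There is an induced morphism $$\beta_*:\ \mathbf{MV}_*(\mathcal{H}_1,\mathcal{H}_2,\alpha,m)\to\mathbf{MV}_*(\mathcal{H}_1,\mathcal{H}_2,\alpha,m-2s).$$ Moreover, $(\beta_1\wedge\beta_2)_*=(\beta_1)_*(\beta_2)_*=(\beta_2)_*(\beta_1)_*$ as morphisms $\mathbf{MV}_*(\mathcal{H}_1,\mathcal{H}_2,\alpha,m)\to\mathbf{MV}_*(\mathcal{H}_1,\mathcal{H}_2,\alpha,m-2s_1-2s_2)$; that is, the square with the sides $(\beta_1)_*,(\beta_2)_*$ and the diagonal $(\beta_1\wedge\beta_2)_*$ commutes. Furthermore, this diagram is functorial with respect to morphisms of hypergraphs induced by bijective maps between the vertices. (2) There is an induced morphism $$\mu_*:\ \mathbf{MV}^*(\mathcal{H}_1,\mathcal{H}_2,\omega,m)\to\mathbf{MV}^*(\mathcal{H}_1,\mathcal{H}_2,\omega,m+2s).$$ Moreover, $(\mu_1\wedge\mu_2)_*=(\mu_1)_*(\mu_2)_*=(\mu_2)_*(\mu_1)_*$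 as morphisms $\mathbf{MV}^*(\mathcal{H}_1,\mathcal{H}_2,\omega,m)\to\mathbf{MV}^*(\mathcal{H}_1,\mathcal{H}_2,\omega,m+2s_1+2s_2)$; that is, the square with the sides $(\mu_1)_*,(\mu_2)_*$ and the diagonal $(\mu_1\wedge\mu_2)_*$ commutes. Furthermore, this diagram is functorial with respect to morphisms of hypergraphs induced by bijective maps between the vertices.
   Context: $R$ is a commutative ring without zero divisors, with unit $1$, in which $2$ is invertible. $V$ is a discrete set (of vertices) with a total order $\prec$. Hypergraphs. $\Delta[V]$ is the collection of all non-empty finite subsets of $V$; a hypergraph with vertices from $V$ is any $\mathcal{H}\subseteq\Delta[V]$. It is a simplicial complex if it contains every non-empty subset of each of its elements, and an independence hypergraph if it contains every finite superset (in $V$) of each of its elements. For a hypergraph $\mathcal{H}$: $\Delta\mathcal{H}=\{\tau\in\Delta[V]\mid\tau\subseteq\sigma\text{ for some }\sigma\in\mathcal{H}\}$ and $\delta\mathcal{H}=\{\sigma\in\mathcal{H}\mid\tau\in\mathcal{H}\text{ for all non-empty }\tau\subseteq\sigma\}$ (simplicial complexes); $\bar\Delta\mathcal{H}=\{\tau\in\Delta[V]\mid\tau\supseteq\sigma\text{ for some }\sigma\in\mathcal{H}\}$ and $\bar\delta\mathcal{H}=\{\sigma\in\mathcal{H}\mid\tau\in\mathcal{H}\text{ for all }\tau\in\Delta[V],\ \tau\supseteq\sigma\}$ (independence hypergraphs). Operators. $R_n(\mathcal{H})$ is the free $R$-module on the elements of $\mathcal{H}$ with $n+1$ vertices ($R_n=0$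 for $n<0$). For $v\in V$ and $v_0\prec\cdots\prec v_n$: $\frac{\partial}{\partial v}\{v_0,\ldots,v_n\}=(-1)^i\{v_0,\ldots,\widehat{v_i},\ldots,v_n\}$ if $v=v_i$ and $n\ge1$, and $0$ otherwise; $dv\{v_0,\ldots,v_n\}=0$ if $v\in\{v_0,\ldots,v_n\}$, and otherwise $(-1)^i\{v_0,\ldots,v_n,v\}$ with $i$ the number of $v_j\prec v$. $\mathrm{Ext}_*(V)$ and $\mathrm{Ext}^*(V)$ are the exterior algebras over $R$ generated by the $\frac{\partial}{\partial v}$, resp. the $dv$, $v\in V$; they act on $R_*(\Delta[V])$ with wedge products acting as compositions. The action of $\mathrm{Ext}_*(V)$ restricts to $R_*(\mathcal{K})$ for a simplicial complex $\mathcal{K}$, and that of $\mathrm{Ext}^*(V)$ to $R_*(\mathcal{L})$ for an independence hypergraph $\mathcal{L}$. Constrained (co)homology. Write $m=\lambda(2t+1)+q$ with $\lambda\in\mathbb{Z}$, $0\le q\le 2t$. $R_*(\mathcal{K},\alpha,m)$ is the chain complex with $n$-th term $R_{(n+\lambda)(2t+1)+q}(\mathcal{K})$, $n\ge0$, and boundary map $\alpha$; $R^*(\mathcal{L},\omega,m)$ is the cochain complex with $n$-th term $R_{(n+\lambda)(2t+1)+q}(\mathcal{L})$, $n\ge0$, and coboundary map $\omega$. Their (co)homology groups are $H_n(\mathcal{K},\alpha,m)$ and $H^n(\mathcal{L},\omega,m)$. The actions of $\beta\in\mathrm{Ext}_{2s}(V)$ and $\mu\in\mathrm{Ext}^{2s}(V)$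 give (co)chain maps $R_*(\mathcal{K},\alpha,m)\to R_*(\mathcal{K},\alpha,m-2s)$ and $R^*(\mathcal{L},\omega,m)\to R^*(\mathcal{L},\omega,m+2s)$, inducing $\beta_*$ and $\mu_*$ on (co)homology. Mayer–Vietoris sequences. For simplicial complexes $\mathcal{K}_1,\mathcal{K}_2$, $\mathbf{MV}_*(\mathcal{K}_1,\mathcal{K}_2,\alpha,m)$ is the long exact sequence $$\cdots\to H_n(\mathcal{K}_1\cap\mathcal{K}_2,\alpha,m)\to H_n(\mathcal{K}_1,\alpha,m)\oplus H_n(\mathcal{K}_2,\alpha,m)\to H_n(\mathcal{K}_1\cup\mathcal{K}_2,\alpha,m)\to H_{n-1}(\mathcal{K}_1\cap\mathcal{K}_2,\alpha,m)\to\cdots$$ of the short exact sequence $0\to R_*(\mathcal{K}_1\cap\mathcal{K}_2,\alpha,m)\to R_*(\mathcal{K}_1,\alpha,m)\oplus R_*(\mathcal{K}_2,\alpha,m)\to R_*(\mathcal{K}_1\cup\mathcal{K}_2,\alpha,m)\to0$ with maps $x\mapsto(x,x)$, $(y,z)\mapsto y-z$. For independence hypergraphs $\mathcal{L}_1,\mathcal{L}_2$, $\mathbf{MV}^*(\mathcal{L}_1,\mathcal{L}_2,\omega,m)$ is the long exact sequence $$\cdots\to H^n(\mathcal{L}_1\cap\mathcal{L}_2,\omega,m)\to H^n(\mathcal{L}_1,\omega,m)\oplus H^n(\mathcal{L}_2,\omega,m)\to H^n(\mathcal{L}_1\cup\mathcal{L}_2,\omega,m)\to H^{n+1}(\mathcal{L}_1\cap\mathcal{L}_2,\omega,m)\to\cdots$$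 obtained in the same way. A morphism between such sequences is a family of $R$-module homomorphisms between corresponding terms making the ladder commute. For hypergraphs, $\mathbf{MV}_*(\mathcal{H}_1,\mathcal{H}_2,\alpha,m)$ consists of $\mathbf{MV}_*(\delta\mathcal{H}_1,\delta\mathcal{H}_2,\alpha,m)$ and $\mathbf{MV}_*(\Delta\mathcal{H}_1,\Delta\mathcal{H}_2,\alpha,m)$ together with the morphism from the first to the second induced by the inclusions $\delta\mathcal{H}_i\subseteq\Delta\mathcal{H}_i$. Likewise $\mathbf{MV}^*(\mathcal{H}_1,\mathcal{H}_2,\omega,m)$ consists of $\mathbf{MV}^*(\bar\delta\mathcal{H}_1,\bar\delta\mathcal{H}_2,\omega,m)$ and $\mathbf{MV}^*(\bar\Delta\mathcal{H}_1,\bar\Delta\mathcal{H}_2,\omega,m)$ together with the morphism induced by the inclusions $\bar\delta\mathcal{H}_i\subseteq\bar\Delta\mathcal{H}_i$. A morphism between two such objects is a pair of morphisms (one between the $\delta$-sequences, one between the $\Delta$-sequences; resp. $\bar\delta$, $\bar\Delta$) commuting with the inclusion-induced morphisms. The induced morphisms $\beta_*$, $\mu_*$ are those given on every term by the maps $\beta_*$, $\mu_*$ above. Functoriality. A morphism of hypergraphs $\mathcal{H}\to\mathcal{H}'$ (vertices from $V$, $V'$) is a map $\varphi:V\to V'$ with $\varphi(\sigma)=\{\varphi(v)\mid v\in\sigma\}\in\mathcal{H}'$ for all $\sigma\in\mathcal{H}$. A bijection $\varphi:V\to V'$ of totally ordered vertex sets induces isomorphisms $\mathrm{Ext}_*(\varphi):\frac{\partial}{\partial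 v}\mapsto\frac{\partial}{\partial\varphi(v)}$ and $\mathrm{Ext}^*(\varphi):dv\mapsto d\varphi(v)$ of exterior algebras, and an $R$-linear map $\varphi_\#$ sending $\{v_0,\ldots,v_n\}$ ($v_0\prec\cdots\prec v_n$) to $\epsilon\{\varphi(v_0),\ldots,\varphi(v_n)\}$, where $\epsilon$ is the sign of the permutation sorting $\varphi(v_0),\ldots,\varphi(v_n)$ into increasing order. Functoriality means: if the same bijection $\varphi$ gives morphisms of hypergraphs $\mathcal{H}_i\to\mathcal{H}_i'$, $i=1,2$, then $\varphi_\#$ induces morphisms from the Mayer–Vietoris objects of $(\mathcal{H}_1,\mathcal{H}_2)$ to those of $(\mathcal{H}_1',\mathcal{H}_2')$ with $\alpha,\beta_1,\beta_2$ replaced by their images under $\mathrm{Ext}_*(\varphi)$ (resp. $\omega,\mu_1,\mu_2$ by their images under $\mathrm{Ext}^*(\varphi)$), these commute with all arrows of the diagram, and they respect identities and compositions. *)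

theory Defs
  imports
    "HOL-Algebra.QuotRing"
    "HOL-Algebra.Module"
    "HOL-Library.Poly_Mapping"
    "HOL-Combinatorics.Permutations"
begin

section \<open>Hypergraphs\<close>

text \<open>
  Vertex sets are arbitrary subsets of a linearly ordered type.  This is no restriction:
  a total order on a subset of a type always extends to the whole type.
\<close>

definition simplices :: "'v set \<Rightarrow> 'v set set"
  where "simplices V = {\<sigma>. \<sigma> \<noteq> {} \<and> finite \<sigma> \<and> \<sigma> \<subseteq> V}"

definition simp_closure :: "'v set \<Rightarrow> 'v set set \<Rightarrow> 'v set set"  \<comment> \<open>\<open>\<Delta>H\<close>\<close>
  where "simp_closure V H = {\<tau> \<in> simplices V. \<exists>\<sigma>\<in>H. \<tau> \<subseteq> \<sigma>}"

definition simp_core :: "'v set set \<Rightarrow> 'v set set"  \<comment> \<open>\<open>\<delta>H\<close>\<close>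
  where "simp_core H = {\<sigma> \<in> H. \<forall>\<tau>. \<tau> \<noteq> {} \<and> \<tau> \<subseteq> \<sigma> \<longrightarrow> \<tau> \<in> H}"

definition ind_closure :: "'v set \<Rightarrow> 'v set set \<Rightarrow> 'v set set"  \<comment> \<open>\<open>\<Delta>\<close>-bar\<close>
  where "ind_closure V H = {\<tau> \<in> simplices V. \<exists>\<sigma>\<in>H. \<sigma> \<subseteq> \<tau>}"

definition ind_core :: "'v set \<Rightarrow> 'v set set \<Rightarrow> 'v set set"  \<comment> \<open>\<open>\<delta>\<close>-bar\<close>
  where "ind_core V H = {\<sigma> \<in> H. \<forall>\<tau>\<in>simplices V. \<sigma> \<subseteq> \<tau> \<longrightarrow> \<tau> \<in> H}"


section \<open>Free modules\<close>

text \<open>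
  The free module on a set of basis elements of type \<open>'k\<close> is modelled by the finitely supported
  functions \<open>'k \<Rightarrow>\<^sub>0 'r\<close>.
\<close>

definition scale :: "'r \<Rightarrow> ('k \<Rightarrow>\<^sub>0 'r) \<Rightarrow> ('k \<Rightarrow>\<^sub>0 'r::comm_ring_1)"
  where "scale r = Poly_Mapping.map ((*) r)"

text \<open>The linear extension of a map defined on basis elements.\<close>

definition lin_ext :: "('k \<Rightarrow> ('l \<Rightarrow>\<^sub>0 'r)) \<Rightarrow> ('k \<Rightarrow>\<^sub>0 'r) \<Rightarrow> ('l \<Rightarrow>\<^sub>0 'r::comm_ring_1)"
  where "lin_ext f p = (\<Sum>k\<in>Poly_Mapping.keys p. scale (Poly_Mapping.lookup p k) (f k))"

text \<open>
  \<open>R_k(H)\<close>.  For a hypergraph \<open>H \<subseteq> simplices V\<close> it is \<open>0\<close> if \<open>k < 0\<close>, as the members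
  of \<open>H\<close> have at least one vertex.  Being a module, it leaves the two multiplicative fields
  of the record unused.
\<close>

definition chain_module :: "'v set set \<Rightarrow> int \<Rightarrow> ('r::comm_ring_1, 'v set \<Rightarrow>\<^sub>0 'r) module"
  where "chain_module H k =
    \<lparr>carrier = {c. Poly_Mapping.keys c \<subseteq> {\<sigma> \<in> H. int (card \<sigma>) = k + 1}},
     monoid.mult = undefined, one = undefined, ring.zero = 0, add = (+), smult = scale\<rparr>"


section \<open>Exterior algebras\<close>

text \<open>
  The tensor algebra of the free module with basis \<open>V\<close>: the word \<open>[v1, \<dots>, vk]\<close> stands for
  the product of the generators belonging to \<open>v1, \<dots>, vk\<close>.
\<close>

definition tensor_alg :: "'v set \<Rightarrow> ('v list \<Rightarrow>\<^sub>0 'r::comm_ring_1) ring"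
  where "tensor_alg V =
    \<lparr>carrier = {p. Poly_Mapping.keys p \<subseteq> lists V},
     monoid.mult = (\<lambda>p q. lin_ext (\<lambda>u. lin_ext (\<lambda>w. Poly_Mapping.single (u @ w) 1) q) p),
     one = Poly_Mapping.single [] 1, ring.zero = 0, add = (+)\<rparr>"

definition ext_ideal :: "'v set \<Rightarrow> ('v list \<Rightarrow>\<^sub>0 'r::comm_ring_1) set"
  where "ext_ideal V =
    Idl\<^bsub>tensor_alg V\<^esub> {x \<otimes>\<^bsub>tensor_alg V\<^esub> x | x. Poly_Mapping.keys x \<subseteq> (\<lambda>v. [v]) ` V}"

text \<open>
  One algebra serves both as the exterior algebra on the symbols \<open>\<partial>/\<partial>v\<close> and as the one on the
  symbols \<open>dv\<close>; the two differ only in how they act on chains.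
\<close>

definition ext_alg :: "'v set \<Rightarrow> ('v list \<Rightarrow>\<^sub>0 'r::comm_ring_1) set ring"
  where "ext_alg V = tensor_alg V Quot ext_ideal V"

definition ext_deg :: "'v set \<Rightarrow> nat \<Rightarrow> ('v list \<Rightarrow>\<^sub>0 'r::comm_ring_1) set set"
  where "ext_deg V k =
    {ext_ideal V +>\<^bsub>tensor_alg V\<^esub> p | p. Poly_Mapping.keys p \<subseteq> {w \<in> lists V. length w = k}}"

abbreviation wedge ::
  "'v set \<Rightarrow> ('v list \<Rightarrow>\<^sub>0 'r::comm_ring_1) set \<Rightarrow> ('v list \<Rightarrow>\<^sub>0 'r) set \<Rightarrow> ('v list \<Rightarrow>\<^sub>0 'r) set"
  where "wedge V \<xi> \<eta> \<equiv> \<xi> \<otimes>\<^bsub>ext_alg V\<^esub> \<eta>"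

text \<open>In both operators the index \<open>i\<close> is the number of vertices of \<open>\<sigma>\<close> preceding \<open>v\<close>.\<close>

definition partial_op :: "'v::linorder \<Rightarrow> 'v set \<Rightarrow> ('v set \<Rightarrow>\<^sub>0 'r::comm_ring_1)"
  where "partial_op v \<sigma> =
    (if v \<in> \<sigma> \<and> card \<sigma> \<ge> 2
     then Poly_Mapping.single (\<sigma> - {v}) ((-1) ^ card {u \<in> \<sigma>. u < v}) else 0)"

definition d_op :: "'v::linorder \<Rightarrow> 'v set \<Rightarrow> ('v set \<Rightarrow>\<^sub>0 'r::comm_ring_1)"
  where "d_op v \<sigma> =
    (if v \<in> \<sigma> then 0
     else Poly_Mapping.single (insert v \<sigma>) ((-1) ^ card {u \<in> \<sigma>. u < v}))"

text \<open>
  Products act as compositions.  The action of a class in the exterior algebra is the common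
  value of the actions of its representatives; on chains of \<open>simplices V\<close> all representatives
  act alike.
\<close>

definition tensor_act ::
  "('v \<Rightarrow> 'v set \<Rightarrow> ('v set \<Rightarrow>\<^sub>0 'r)) \<Rightarrow> ('v list \<Rightarrow>\<^sub>0 'r) \<Rightarrow> ('v set \<Rightarrow>\<^sub>0 'r)
    \<Rightarrow> ('v set \<Rightarrow>\<^sub>0 'r::comm_ring_1)"
  where "tensor_act g p x = lin_ext (\<lambda>w. foldr (\<lambda>v. lin_ext (g v)) w x) p"

definition ext_act ::
  "('v \<Rightarrow> 'v set \<Rightarrow> ('v set \<Rightarrow>\<^sub>0 'r)) \<Rightarrow> ('v list \<Rightarrow>\<^sub>0 'r) set \<Rightarrow> ('v set \<Rightarrow>\<^sub>0 'r)
    \<Rightarrow> ('v set \<Rightarrow>\<^sub>0 'r::comm_ring_1)"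
  where "ext_act g \<xi> x = the_elem ((\<lambda>p. tensor_act g p x) ` \<xi>)"


section \<open>Complexes and their (co)homology\<close>

text \<open>
  A complex is indexed by the integers; its differential maps the term of index \<open>n\<close> to the
  one of index \<open>n + step\<close>, where \<open>step = -1\<close> for chain and \<open>step = 1\<close> for cochain complexes.
\<close>

record ('r, 'a) cx =
  step :: int
  cx_term :: "int \<Rightarrow> ('r, 'a) module"
  cx_diff :: "int \<Rightarrow> 'a \<Rightarrow> 'a"

definition cycles :: "('r, 'a) cx \<Rightarrow> int \<Rightarrow> 'a set"
  where "cycles C n =
    {c \<in> carrier (cx_term C n). cx_diff C n c = \<zero>\<^bsub>cx_term C (n + step C)\<^esub>}"

definition boundaries :: "('r, 'a) cx \<Rightarrow> int \<Rightarrow> 'a set"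
  where "boundaries C n = cx_diff C (n - step C) ` carrier (cx_term C (n - step C))"

definition quot_module :: "('r, 'a) module \<Rightarrow> 'a set \<Rightarrow> ('r, 'a set) module"
  where "quot_module M B =
    \<lparr>carrier = a_rcosets\<^bsub>M\<^esub> B, monoid.mult = undefined, one = undefined,
     ring.zero = B, add = set_add M,
     smult = (\<lambda>r X. \<Union>x\<in>X. B +>\<^bsub>M\<^esub> (r \<odot>\<^bsub>M\<^esub> x))\<rparr>"

definition homology :: "('r, 'a) cx \<Rightarrow> int \<Rightarrow> ('r, 'a set) module"
  where "homology C n = quot_module ((cx_term C n)\<lparr>carrier := cycles C n\<rparr>) (boundaries C n)"

text \<open>
  The map into the (co)homology of \<open>C\<close> induced by \<open>f\<close>: the class of \<open>x\<close> goes to the class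
  of \<open>f x\<close>.  If the latter depends on the choice of \<open>x\<close>, the result is not a coset.
\<close>

definition induced :: "('r, 'b) cx \<Rightarrow> int \<Rightarrow> ('a \<Rightarrow> 'b) \<Rightarrow> 'a set \<Rightarrow> 'b set"
  where "induced C n f X = (\<Union>x\<in>X. boundaries C n +>\<^bsub>cx_term C n\<^esub> f x)"

text \<open>
  The constrained complexes, with the terms of negative index equal to \<open>0\<close>.  In particular,
  the differential vanishes if its source or its target has negative index.
\<close>

definition constrained_deg :: "nat \<Rightarrow> int \<Rightarrow> int \<Rightarrow> int"
  where "constrained_deg t m n =
    (let l = m div (2 * int t + 1); q = m mod (2 * int t + 1)
     in (n + l) * (2 * int t + 1) + q)"

definition constrained_cx ::
  "int \<Rightarrow> (('v set \<Rightarrow>\<^sub>0 'r) \<Rightarrow> ('v set \<Rightarrow>\<^sub>0 'r)) \<Rightarrow> nat \<Rightarrow> int \<Rightarrow> 'v set set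
    \<Rightarrow> ('r::comm_ring_1, 'v set \<Rightarrow>\<^sub>0 'r) cx"
  where "constrained_cx e f t m K =
    \<lparr>step = e,
     cx_term = (\<lambda>n. chain_module (if 0 \<le> n then K else {}) (constrained_deg t m n)),
     cx_diff = (\<lambda>n c. if 0 \<le> n \<and> 0 \<le> n + e then f c else 0)\<rparr>"

definition chain_cx ::
  "nat \<Rightarrow> ('v list \<Rightarrow>\<^sub>0 'r) set \<Rightarrow> int \<Rightarrow> 'v::linorder set set \<Rightarrow> ('r::comm_ring_1, 'v set \<Rightarrow>\<^sub>0 'r) cx"
  where "chain_cx t \<alpha> m K = constrained_cx (-1) (ext_act partial_op \<alpha>) t m K"

definition cochain_cx ::
  "nat \<Rightarrow> ('v list \<Rightarrow>\<^sub>0 'r) set \<Rightarrow> int \<Rightarrow> 'v::linorder set set \<Rightarrow> ('r::comm_ring_1, 'v set \<Rightarrow>\<^sub>0 'r) cx"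
  where "cochain_cx t \<omega> m L = constrained_cx 1 (ext_act d_op \<omega>) t m L"


section \<open>Mayer--Vietoris sequences\<close>

definition module_sum :: "('r, 'a) module \<Rightarrow> ('r, 'b) module \<Rightarrow> ('r, 'a \<times> 'b) module"
  where "module_sum M N =
    \<lparr>carrier = carrier M \<times> carrier N, monoid.mult = undefined, one = undefined,
     ring.zero = (\<zero>\<^bsub>M\<^esub>, \<zero>\<^bsub>N\<^esub>),
     add = (\<lambda>(x, y) (x', y'). (x \<oplus>\<^bsub>M\<^esub> x', y \<oplus>\<^bsub>N\<^esub> y')),
     smult = (\<lambda>r (x, y). (r \<odot>\<^bsub>M\<^esub> x, r \<odot>\<^bsub>N\<^esub> y))\<rparr>"

text \<open>The scalars are all elements of the type \<open>'r\<close>.\<close>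

definition mod_homs :: "('r, 'a) module \<Rightarrow> ('r, 'b) module \<Rightarrow> ('a \<Rightarrow> 'b) set"
  where "mod_homs M N =
    {h \<in> carrier M \<rightarrow> carrier N.
      (\<forall>x\<in>carrier M. \<forall>y\<in>carrier M. h (x \<oplus>\<^bsub>M\<^esub> y) = h x \<oplus>\<^bsub>N\<^esub> h y) \<and>
      (\<forall>r. \<forall>x\<in>carrier M. h (r \<odot>\<^bsub>M\<^esub> x) = r \<odot>\<^bsub>N\<^esub> h x)}"

text \<open>
  Sequences with the terms and arrows
  \<open>\<dots> \<rightarrow> mvI n \<rightarrow> mvS n \<rightarrow> mvU n \<rightarrow> mvI (n + mv_step) \<rightarrow> \<dots>\<close>
  (intersection, direct sum, union).
\<close>

record ('r, 'a) mv =
  mv_step :: int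
  mvI :: "int \<Rightarrow> ('r, 'a set) module"
  mvS :: "int \<Rightarrow> ('r, 'a set \<times> 'a set) module"
  mvU :: "int \<Rightarrow> ('r, 'a set) module"
  arrI :: "int \<Rightarrow> 'a set \<Rightarrow> 'a set \<times> 'a set"
  arrS :: "int \<Rightarrow> 'a set \<times> 'a set \<Rightarrow> 'a set"
  arrU :: "int \<Rightarrow> 'a set \<Rightarrow> 'a set"

text \<open>
  The sequence of \<open>0 \<rightarrow> C (K1 \<inter> K2) \<rightarrow> C K1 \<oplus> C K2 \<rightarrow> C (K1 \<union> K2) \<rightarrow> 0\<close> with the maps
  \<open>x \<mapsto> (x, x)\<close> and \<open>(y, z) \<mapsto> y - z\<close>.  The connecting arrow sends the class of a cycle
  \<open>y - z\<close> to the class of the differential of \<open>y\<close>, which is also that of \<open>z\<close>.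
\<close>

definition mv_seq ::
  "('v set set \<Rightarrow> ('r, 'a) cx) \<Rightarrow> 'v set set \<Rightarrow> 'v set set \<Rightarrow> ('r, 'a) mv"
  where "mv_seq C K1 K2 =
    (let CI = C (K1 \<inter> K2); C1 = C K1; C2 = C K2; CU = C (K1 \<union> K2) in
      \<lparr>mv_step = step CU,
       mvI = homology CI,
       mvS = (\<lambda>n. module_sum (homology C1 n) (homology C2 n)),
       mvU = homology CU,
       arrI = (\<lambda>n X. (induced C1 n id X, induced C2 n id X)),
       arrS = (\<lambda>n (Y, Z).
         \<Union>y\<in>Y. \<Union>z\<in>Z. boundaries CU n +>\<^bsub>cx_term CU n\<^esub> (y \<ominus>\<^bsub>cx_term CU n\<^esub> z)),
       arrU = (\<lambda>n X.
         \<Union>{boundaries CI (n + step CU) +>\<^bsub>cx_term CI (n + step CU)\<^esub> cx_diff C1 n y | y z.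
            y \<in> carrier (cx_term C1 n) \<and> z \<in> carrier (cx_term C2 n) \<and>
            y \<ominus>\<^bsub>cx_term CU n\<^esub> z \<in> X})\<rparr>)"

record ('a, 'b) mv_map =
  mapI :: "int \<Rightarrow> 'a set \<Rightarrow> 'b set"
  mapS :: "int \<Rightarrow> 'a set \<times> 'a set \<Rightarrow> 'b set \<times> 'b set"
  mapU :: "int \<Rightarrow> 'a set \<Rightarrow> 'b set"

definition mv_morphism :: "('r, 'a) mv \<Rightarrow> ('r, 'b) mv \<Rightarrow> ('a, 'b) mv_map \<Rightarrow> bool"
  where "mv_morphism S T F \<longleftrightarrow>
    mv_step S = mv_step T \<and>
    (\<forall>n. mapI F n \<in> mod_homs (mvI S n) (mvI T n) \<and>
         mapS F n \<in> mod_homs (mvS S n) (mvS T n) \<and>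
         mapU F n \<in> mod_homs (mvU S n) (mvU T n) \<and>
         (\<forall>x\<in>carrier (mvI S n). arrI T n (mapI F n x) = mapS F n (arrI S n x)) \<and>
         (\<forall>x\<in>carrier (mvS S n). arrS T n (mapS F n x) = mapU F n (arrS S n x)) \<and>
         (\<forall>x\<in>carrier (mvU S n). arrU T n (mapU F n x) = mapI F (n + mv_step S) (arrU S n x)))"

definition mv_comp :: "('b, 'c) mv_map \<Rightarrow> ('a, 'b) mv_map \<Rightarrow> ('a, 'c) mv_map"
  where "mv_comp G F =
    \<lparr>mapI = (\<lambda>n. mapI G n \<circ> mapI F n), mapS = (\<lambda>n. mapS G n \<circ> mapS F n),
     mapU = (\<lambda>n. mapU G n \<circ> mapU F n)\<rparr>"

definition mv_id :: "('a, 'a) mv_map"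
  where "mv_id = \<lparr>mapI = (\<lambda>n. id), mapS = (\<lambda>n. id), mapU = (\<lambda>n. id)\<rparr>"

text \<open>Equality of two morphisms with the same source \<open>S\<close>.\<close>

definition mv_eq :: "('r, 'a) mv \<Rightarrow> ('a, 'b) mv_map \<Rightarrow> ('a, 'b) mv_map \<Rightarrow> bool"
  where "mv_eq S F G \<longleftrightarrow>
    (\<forall>n. (\<forall>x\<in>carrier (mvI S n). mapI F n x = mapI G n x) \<and>
         (\<forall>x\<in>carrier (mvS S n). mapS F n x = mapS G n x) \<and>
         (\<forall>x\<in>carrier (mvU S n). mapU F n x = mapU G n x))"

text \<open>The family of maps into \<open>mv_seq C K1 K2\<close> induced by the map \<open>f\<close> of chains.\<close>

definition mv_induced ::
  "('v set set \<Rightarrow> ('r, 'b) cx) \<Rightarrow> 'v set set \<Rightarrow> 'v set set \<Rightarrow> ('a \<Rightarrow> 'b) \<Rightarrow> ('a, 'b) mv_map"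
  where "mv_induced C K1 K2 f =
    \<lparr>mapI = (\<lambda>n. induced (C (K1 \<inter> K2)) n f),
     mapS = (\<lambda>n. map_prod (induced (C K1) n f) (induced (C K2) n f)),
     mapU = (\<lambda>n. induced (C (K1 \<union> K2)) n f)\<rparr>"


section \<open>Mayer--Vietoris objects of hypergraphs\<close>

record ('r, 'a) hmv =
  lower :: "('r, 'a) mv"
  upper :: "('r, 'a) mv"
  incl :: "('a, 'a) mv_map"

definition hmv_object ::
  "('v set set \<Rightarrow> ('r, 'a) cx) \<Rightarrow> ('v set set \<Rightarrow> 'v set set) \<Rightarrow> ('v set set \<Rightarrow> 'v set set)
    \<Rightarrow> 'v set set \<Rightarrow> 'v set set \<Rightarrow> ('r, 'a) hmv"
  where "hmv_object C lo up H1 H2 =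
    \<lparr>lower = mv_seq C (lo H1) (lo H2), upper = mv_seq C (up H1) (up H2),
     incl = mv_induced C (up H1) (up H2) id\<rparr>"

type_synonym ('a, 'b) hmv_map = "('a, 'b) mv_map \<times> ('a, 'b) mv_map"

definition hmv_morphism :: "('r, 'a) hmv \<Rightarrow> ('r, 'b) hmv \<Rightarrow> ('a, 'b) hmv_map \<Rightarrow> bool"
  where "hmv_morphism S T F \<longleftrightarrow>
    mv_morphism (lower S) (lower T) (fst F) \<and> mv_morphism (upper S) (upper T) (snd F) \<and>
    mv_eq (lower S) (mv_comp (snd F) (incl S)) (mv_comp (incl T) (fst F))"

definition hmv_comp :: "('b, 'c) hmv_map \<Rightarrow> ('a, 'b) hmv_map \<Rightarrow> ('a, 'c) hmv_map"
  where "hmv_comp G F = (mv_comp (fst G) (fst F), mv_comp (snd G) (snd F))"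

definition hmv_id :: "('a, 'a) hmv_map"
  where "hmv_id = (mv_id, mv_id)"

definition hmv_eq :: "('r, 'a) hmv \<Rightarrow> ('a, 'b) hmv_map \<Rightarrow> ('a, 'b) hmv_map \<Rightarrow> bool"
  where "hmv_eq S F G \<longleftrightarrow> mv_eq (lower S) (fst F) (fst G) \<and> mv_eq (upper S) (snd F) (snd G)"

definition hmv_induced ::
  "('v set set \<Rightarrow> ('r, 'b) cx) \<Rightarrow> ('v set set \<Rightarrow> 'v set set) \<Rightarrow> ('v set set \<Rightarrow> 'v set set)
    \<Rightarrow> 'v set set \<Rightarrow> 'v set set \<Rightarrow> ('a \<Rightarrow> 'b) \<Rightarrow> ('a, 'b) hmv_map"
  where "hmv_induced C lo up H1 H2 f =
    (mv_induced C (lo H1) (lo H2) f, mv_induced C (up H1) (up H2) f)"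

definition MV_hom ::
  "'v::linorder set \<Rightarrow> 'v set set \<Rightarrow> 'v set set \<Rightarrow> nat \<Rightarrow> ('v list \<Rightarrow>\<^sub>0 'r) set \<Rightarrow> int
    \<Rightarrow> ('r::comm_ring_1, 'v set \<Rightarrow>\<^sub>0 'r) hmv"
  where "MV_hom V H1 H2 t \<alpha> m = hmv_object (chain_cx t \<alpha> m) simp_core (simp_closure V) H1 H2"

definition MV_cohom ::
  "'v::linorder set \<Rightarrow> 'v set set \<Rightarrow> 'v set set \<Rightarrow> nat \<Rightarrow> ('v list \<Rightarrow>\<^sub>0 'r) set \<Rightarrow> int
    \<Rightarrow> ('r::comm_ring_1, 'v set \<Rightarrow>\<^sub>0 'r) hmv"
  where "MV_cohom V H1 H2 t \<omega> m =
    hmv_object (cochain_cx t \<omega> m) (ind_core V) (ind_closure V) H1 H2"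

text \<open>
  The families \<open>\<beta>\<^sub>*\<close> on the object with index \<open>m\<close> for \<open>\<beta>\<close> of degree \<open>2 * s\<close>,
  and likewise \<open>\<mu>\<^sub>*\<close>.
\<close>

definition beta_star ::
  "'v::linorder set \<Rightarrow> 'v set set \<Rightarrow> 'v set set \<Rightarrow> nat \<Rightarrow> ('v list \<Rightarrow>\<^sub>0 'r) set \<Rightarrow> int \<Rightarrow> nat
    \<Rightarrow> ('v list \<Rightarrow>\<^sub>0 'r::comm_ring_1) set \<Rightarrow> ('v set \<Rightarrow>\<^sub>0 'r, 'v set \<Rightarrow>\<^sub>0 'r) hmv_map"
  where "beta_star V H1 H2 t \<alpha> m s \<beta> =
    hmv_induced (chain_cx t \<alpha> (m - 2 * int s)) simp_core (simp_closure V) H1 H2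
      (ext_act partial_op \<beta>)"

definition mu_star ::
  "'v::linorder set \<Rightarrow> 'v set set \<Rightarrow> 'v set set \<Rightarrow> nat \<Rightarrow> ('v list \<Rightarrow>\<^sub>0 'r) set \<Rightarrow> int \<Rightarrow> nat
    \<Rightarrow> ('v list \<Rightarrow>\<^sub>0 'r::comm_ring_1) set \<Rightarrow> ('v set \<Rightarrow>\<^sub>0 'r, 'v set \<Rightarrow>\<^sub>0 'r) hmv_map"
  where "mu_star V H1 H2 t \<omega> m s \<mu> =
    hmv_induced (cochain_cx t \<omega> (m + 2 * int s)) (ind_core V) (ind_closure V) H1 H2
      (ext_act d_op \<mu>)"


section \<open>Bijections of vertices\<close>

definition vertex_morphism ::
  "'v set \<Rightarrow> 'v set set \<Rightarrow> 'v set set \<Rightarrow> 'w set \<Rightarrow> 'w set set \<Rightarrow> 'w set set \<Rightarrow> ('v \<Rightarrow> 'w) \<Rightarrow> bool"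
  where "vertex_morphism V H1 H2 V' H1' H2' \<phi> \<longleftrightarrow>
    bij_betw \<phi> V V' \<and> (\<forall>\<sigma>\<in>H1. \<phi> ` \<sigma> \<in> H1') \<and> (\<forall>\<sigma>\<in>H2. \<phi> ` \<sigma> \<in> H2')"

text \<open>
  For a bijection \<open>\<phi>\<close> of vertex sets the image of a coset of \<open>ext_ideal\<close> under the
  isomorphism of tensor algebras is again such a coset.
\<close>

definition ext_map :: "('v \<Rightarrow> 'w) \<Rightarrow> ('v list \<Rightarrow>\<^sub>0 'r) set \<Rightarrow> ('w list \<Rightarrow>\<^sub>0 'r::comm_ring_1) set"
  where "ext_map \<phi> \<xi> = lin_ext (\<lambda>w. Poly_Mapping.single (map \<phi> w) 1) ` \<xi>"

definition sort_sign :: "('v::linorder \<Rightarrow> 'w::linorder) \<Rightarrow> 'v set \<Rightarrow> int"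
  where "sort_sign \<phi> \<sigma> =
    sign (THE p. p permutes {..<card \<sigma>} \<and>
      sorted (permute_list p (map \<phi> (sorted_list_of_set \<sigma>))))"

definition chain_map ::
  "('v::linorder \<Rightarrow> 'w::linorder) \<Rightarrow> ('v set \<Rightarrow>\<^sub>0 'r) \<Rightarrow> ('w set \<Rightarrow>\<^sub>0 'r::comm_ring_1)"
  where "chain_map \<phi> = lin_ext (\<lambda>\<sigma>. Poly_Mapping.single (\<phi> ` \<sigma>) (of_int (sort_sign \<phi> \<sigma>)))"

text \<open>The families induced by \<open>chain_map \<phi>\<close>; the remaining arguments describe the target.\<close>

definition phi_hom ::
  "'w::linorder set \<Rightarrow> 'w set set \<Rightarrow> 'w set set \<Rightarrow> nat \<Rightarrow> ('w list \<Rightarrow>\<^sub>0 'r) set \<Rightarrow> int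
    \<Rightarrow> ('v::linorder \<Rightarrow> 'w) \<Rightarrow> ('v set \<Rightarrow>\<^sub>0 'r::comm_ring_1, 'w set \<Rightarrow>\<^sub>0 'r) hmv_map"
  where "phi_hom V' H1' H2' t \<alpha>' m \<phi> =
    hmv_induced (chain_cx t \<alpha>' m) simp_core (simp_closure V') H1' H2' (chain_map \<phi>)"

definition phi_cohom ::
  "'w::linorder set \<Rightarrow> 'w set set \<Rightarrow> 'w set set \<Rightarrow> nat \<Rightarrow> ('w list \<Rightarrow>\<^sub>0 'r) set \<Rightarrow> int
    \<Rightarrow> ('v::linorder \<Rightarrow> 'w) \<Rightarrow> ('v set \<Rightarrow>\<^sub>0 'r::comm_ring_1, 'w set \<Rightarrow>\<^sub>0 'r) hmv_map"
  where "phi_cohom V' H1' H2' t \<omega>' m \<phi> =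
    hmv_induced (cochain_cx t \<omega>' m) (ind_core V') (ind_closure V') H1' H2' (chain_map \<phi>)"

end

theory Submission
  imports Defs
begin

text \<open>
  Everything in the theorem is induced by maps of chains, so it reduces to identities between chains.
  There are two kinds of them.

  \<^item> \<^emph>\<open>Graded commutativity.\<close>  The operators \<open>\<partial>/\<partial>v\<close> anticommute with each other, and so do the
  operators \<open>dv\<close> (\<open>partial_op_anticommute\<close>, \<open>d_op_anticommute\<close>).  Hence the actions of two
  homogeneous elements of degrees \<open>k\<close> and \<open>l\<close> commute up to the sign \<open>(-1)\<^sup>k\<^sup>l\<close>
  (\<open>tensor_act_commute\<close>).  For an odd element this says that its square is its own negative, hence \<open>0\<close>
  because \<open>2\<close> is invertible (\<open>tensor_act_odd_square\<close>).  This one fact makes the action of the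
  exterior algebra well defined, since its ideal of relations is generated by squares of elements of
  degree \<open>1\<close> (\<open>ext_ideal_annihilates\<close>), and it makes \<open>\<alpha>\<close> and \<open>\<omega>\<close> differentials.  Elements of even
  degree commute with everything.  They are therefore (co)chain maps, their products do not depend on the
  order, and wedge products act as compositions.

  \<^item> \<^emph>\<open>Signs of bijections.\<close>  The sign of the permutation that sorts the images of the vertices of a
  simplex is \<open>-1\<close> to the number of inversions (\<open>sort_sign_eq\<close>).  Deleting or adding one vertex changes
  this sign by the parities of the positions of the vertex and of its image
  (\<open>inversion_sign_insert\<close>), and these are the signs in \<open>\<partial>/\<partial>v\<close> and \<open>dv\<close>.  So \<open>\<phi>\<^sub>#\<close> is
  equivariant (\<open>partial_op_equivariant\<close>, \<open>d_op_equivariant\<close>), while multiplicativity of inversion signs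
  gives compatibility with compositions.

  The passage from chains to Mayer--Vietoris sequences is formal.  Every arrow has an explicit value on
  the class of a chain (\<open>arrI_hclass\<close>, \<open>arrS_hclass\<close>, \<open>arrU_hclass\<close>), and these values are expressed
  by differences and differentials, with which a (co)chain map commutes; so it induces a morphism
  of sequences (\<open>mv_induced_morphism\<close>), and equations between chain maps give equations between the
  induced morphisms (\<open>mv_induced_comp\<close>).

  The homological and the cohomological statement are two instances of the same argument: the locale
  \<open>hypergraph_setting\<close> fixes the family of operators, the direction \<open>e\<close> in which it moves degrees, and
  the two constructions that turn a hypergraph into a set of simplices closed under the operators.
\<close>

section \<open>Linear extensions\<close>

lemma lookup_scale [simp]: "Poly_Mapping.lookup (scale r p) k = r * Poly_Mapping.lookup p k"
  by (simp add: scale_def map.rep_eq when_def)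

lemma keys_scale: "Poly_Mapping.keys (scale r p) \<subseteq> Poly_Mapping.keys p"
  by (auto simp: in_keys_iff)

lemma scale_simps [simp]:
  "scale 0 p = 0" "scale r 0 = 0" "scale 1 p = p" "scale (-1) p = - p"
  "scale r (Poly_Mapping.single k c) = Poly_Mapping.single k (r * c)"
  by (auto intro!: poly_mapping_eqI simp: lookup_single when_def)

lemma scale_scale [simp]: "scale r (scale c p) = scale (r * c) p"
  by (auto intro!: poly_mapping_eqI simp: mult.assoc)

lemma scale_add: "scale r (p + q) = scale r p + scale r q" "scale (r + c) p = scale r p + scale c p"
  by (auto intro!: poly_mapping_eqI simp: lookup_add algebra_simps)

lemma scale_uminus: "scale r (- p) = - scale r p" "scale (- r) p = - scale r p"
  by (auto intro!: poly_mapping_eqI)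

lemma scale_diff: "scale r (p - q) = scale r p - scale r q"
  using scale_add(1)[of r p "- q"] by (simp add: scale_uminus)

lemma scale_sum: "scale r (sum f A) = (\<Sum>a\<in>A. scale r (f a))"
  by (induction A rule: infinite_finite_induct) (auto simp: scale_add)

lemma keys_add_sub:
  "Poly_Mapping.keys p \<subseteq> S \<Longrightarrow> Poly_Mapping.keys q \<subseteq> S \<Longrightarrow> Poly_Mapping.keys (p + q) \<subseteq> S"
  using keys_add[of p q] by blast

lemma keys_scale_sub: "Poly_Mapping.keys p \<subseteq> S \<Longrightarrow> Poly_Mapping.keys (scale r p) \<subseteq> S"
  using keys_scale[of r p] by blast

lemma keys_minus_sub: "Poly_Mapping.keys p \<subseteq> S \<Longrightarrow> Poly_Mapping.keys (- p) \<subseteq> S"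
  for p :: "'k \<Rightarrow>\<^sub>0 'r::comm_ring_1"
  using keys_scale_sub[of p S "-1"] by simp

lemma keys_sum_sub:
  "(\<And>a. a \<in> A \<Longrightarrow> Poly_Mapping.keys (f a) \<subseteq> S) \<Longrightarrow> Poly_Mapping.keys (sum f A) \<subseteq> S"
  by (induction A rule: infinite_finite_induct) (simp_all add: keys_add_sub)

lemma lin_ext_superset:
  assumes "finite S" "Poly_Mapping.keys p \<subseteq> S"
  shows "lin_ext f p = (\<Sum>k\<in>S. scale (Poly_Mapping.lookup p k) (f k))"
  unfolding lin_ext_def by (rule sum.mono_neutral_left) (use assms in \<open>auto simp: in_keys_iff\<close>)

lemma lin_ext_0 [simp]: "lin_ext f 0 = 0"
  by (simp add: lin_ext_def)

lemma lin_ext_single [simp]: "lin_ext f (Poly_Mapping.single k r) = scale r (f k)"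
  by (subst lin_ext_superset[of "{k}"]) auto

lemma lin_ext_add: "lin_ext f (p + q) = lin_ext f p + lin_ext f q"
proof -
  let ?S = "Poly_Mapping.keys p \<union> Poly_Mapping.keys q"
  have "finite ?S" "Poly_Mapping.keys (p + q) \<subseteq> ?S" using keys_add[of p q] by auto
  then show ?thesis
    by (simp add: lin_ext_superset[of ?S] lookup_add scale_add sum.distrib)
qed

lemma lin_ext_scale: "lin_ext f (scale r p) = scale r (lin_ext f p)"
  by (simp add: lin_ext_superset[of "Poly_Mapping.keys p"] keys_scale scale_sum)

lemma lin_ext_uminus: "lin_ext f (- p) = - lin_ext f p"
  using lin_ext_scale[of f "-1" p] by simp

lemma lin_ext_sum: "lin_ext f (sum p A) = (\<Sum>a\<in>A. lin_ext f (p a))"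
  by (induction A rule: infinite_finite_induct) (auto simp: lin_ext_add)

lemma lin_ext_cong:
  "(\<And>k. k \<in> Poly_Mapping.keys p \<Longrightarrow> f k = g k) \<Longrightarrow> lin_ext f p = lin_ext g p"
  by (simp add: lin_ext_def)

lemma lin_ext_fun_add: "lin_ext (\<lambda>k. f k + g k) p = lin_ext f p + lin_ext g p"
  by (simp add: lin_ext_def scale_add sum.distrib)

lemma lin_ext_fun_scale: "lin_ext (\<lambda>k. scale r (f k)) p = scale r (lin_ext f p)"
  by (simp add: lin_ext_def scale_sum mult.commute)

lemma lin_ext_fun_uminus: "lin_ext (\<lambda>k. - f k) p = - lin_ext f p"
  using lin_ext_fun_scale[of "-1" f p] by simp

lemma lin_ext_fun_0 [simp]: "lin_ext (\<lambda>k. 0) p = 0"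
  by (simp add: lin_ext_def)

lemma lin_ext_lin_ext: "lin_ext f (lin_ext g p) = lin_ext (\<lambda>k. lin_ext f (g k)) p"
  unfolding lin_ext_def[of g] lin_ext_def[of "\<lambda>k. lin_ext f (g k)"]
  by (simp add: lin_ext_sum lin_ext_scale)

lemma lin_ext_basis: "lin_ext (\<lambda>k. Poly_Mapping.single k 1) p = p"
  by (rule poly_mapping_eqI)
    (auto simp: lin_ext_def lookup_sum lookup_single when_def sum.delta' in_keys_iff cong: if_cong)

text \<open>
  The interchange of two finite sums; it turns the commutation of single words into that of arbitrary
  elements of the tensor algebra.
\<close>

lemma lin_ext_swap:
  "lin_ext (\<lambda>k. lin_ext (\<lambda>l. f k l) q) p = lin_ext (\<lambda>l. lin_ext (\<lambda>k. f k l) p) q"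
  unfolding lin_ext_def by (simp add: scale_sum mult.commute sum.swap[of _ "Poly_Mapping.keys p"])

lemma keys_lin_ext:
  "(\<And>k. k \<in> Poly_Mapping.keys p \<Longrightarrow> Poly_Mapping.keys (f k) \<subseteq> S) \<Longrightarrow>
    Poly_Mapping.keys (lin_ext f p) \<subseteq> S"
  unfolding lin_ext_def by (intro keys_sum_sub keys_scale_sub)

section \<open>Homology classes\<close>

text \<open>
  The terms are submodules of one free module and share its operations.  Hence classes of all
  complexes under consideration can be handled with the plain operations on chains.
\<close>

definition free_cx :: "('r::comm_ring_1, 'k \<Rightarrow>\<^sub>0 'r) cx \<Rightarrow> bool"
  where "free_cx C \<longleftrightarrow> (\<forall>n.
    zero (cx_term C n) = 0 \<and> add (cx_term C n) = (+) \<and> smult (cx_term C n) = scale \<and>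
    0 \<in> carrier (cx_term C n) \<and>
    (\<forall>x\<in>carrier (cx_term C n).
      (\<forall>y\<in>carrier (cx_term C n). x + y \<in> carrier (cx_term C n) \<and>
        cx_diff C n (x + y) = cx_diff C n x + cx_diff C n y) \<and>
      (\<forall>r. scale r x \<in> carrier (cx_term C n) \<and>
        cx_diff C n (scale r x) = scale r (cx_diff C n x)) \<and>
      cx_diff C n x \<in> carrier (cx_term C (n + step C)) \<and>
      cx_diff C (n + step C) (cx_diff C n x) = 0))"

text \<open>
  One map serves all indices, since the terms for all indices consist of chains of the same type.
\<close>

definition cx_hom ::
  "('r::comm_ring_1, 'k \<Rightarrow>\<^sub>0 'r) cx \<Rightarrow> ('r, 'l \<Rightarrow>\<^sub>0 'r) cx \<Rightarrow> (('k \<Rightarrow>\<^sub>0 'r) \<Rightarrow> ('l \<Rightarrow>\<^sub>0 'r)) \<Rightarrow> bool"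
  where "cx_hom C D h \<longleftrightarrow> step C = step D \<and> (\<forall>n. \<forall>x\<in>carrier (cx_term C n).
    h x \<in> carrier (cx_term D n) \<and> (\<forall>y\<in>carrier (cx_term C n). h (x + y) = h x + h y) \<and>
    (\<forall>r. h (scale r x) = scale r (h x)) \<and> h (cx_diff C n x) = cx_diff D n (h x))"

text \<open>
  Maps on quotients are given as unions over representatives.
\<close>

lemma UN_eq_const: "a \<in> A \<Longrightarrow> (\<And>x. x \<in> A \<Longrightarrow> f x = c) \<Longrightarrow> (\<Union>x\<in>A. f x) = c"
  by blast

definition hclass :: "('r, 'a) cx \<Rightarrow> int \<Rightarrow> 'a \<Rightarrow> 'a set"
  where "hclass C n x = boundaries C n +>\<^bsub>cx_term C n\<^esub> x"

context
  fixes C :: "('r::comm_ring_1, 'k \<Rightarrow>\<^sub>0 'r) cx"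
  assumes C: "free_cx C"
begin

lemma free_cx_ops [simp]:
  "zero (cx_term C n) = 0" "add (cx_term C n) = (+)" "smult (cx_term C n) = scale"
  "0 \<in> carrier (cx_term C n)"
  using C by (auto simp: free_cx_def)

lemma free_cx_closed:
  "x \<in> carrier (cx_term C n) \<Longrightarrow> y \<in> carrier (cx_term C n) \<Longrightarrow> x + y \<in> carrier (cx_term C n)"
  "x \<in> carrier (cx_term C n) \<Longrightarrow> scale r x \<in> carrier (cx_term C n)"
  "x \<in> carrier (cx_term C n) \<Longrightarrow> cx_diff C n x \<in> carrier (cx_term C (n + step C))"
  using C by (auto simp: free_cx_def)

lemma free_cx_diff:
  "x \<in> carrier (cx_term C n) \<Longrightarrow> y \<in> carrier (cx_term C n) \<Longrightarrow>
    cx_diff C n (x + y) = cx_diff C n x + cx_diff C n y"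
  "x \<in> carrier (cx_term C n) \<Longrightarrow> cx_diff C n (scale r x) = scale r (cx_diff C n x)"
  "x \<in> carrier (cx_term C n) \<Longrightarrow> cx_diff C (n + step C) (cx_diff C n x) = 0"
  using C by (auto simp: free_cx_def)

lemma free_cx_diff_0 [simp]: "cx_diff C n 0 = 0"
  using free_cx_diff(2)[of 0 n 0] by simp

lemma free_cx_minus:
  assumes "x \<in> carrier (cx_term C n)" "y \<in> carrier (cx_term C n)"
  shows "x - y \<in> carrier (cx_term C n)" "cx_diff C n (x - y) = cx_diff C n x - cx_diff C n y"
  using assms free_cx_closed(1)[of x n "scale (-1) y"] free_cx_closed(2)[of y n "-1"]
    free_cx_diff(1)[of x n "scale (-1) y"] free_cx_diff(2)[of y n "-1"] by auto

lemma free_cx_a_minus: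
  assumes "y \<in> carrier (cx_term C n)"
  shows "x \<ominus>\<^bsub>cx_term C n\<^esub> y = x - y"
proof -
  have "- y \<in> carrier (cx_term C n)"
    using free_cx_minus(1)[of 0 n y] assms by simp
  then have "\<ominus>\<^bsub>cx_term C n\<^esub> y = - y"
    unfolding a_inv_def m_inv_def
    by (intro the_equality) (auto simp: eq_neg_iff_add_eq_0 add.commute[of y])
  then show ?thesis by (simp add: a_minus_def)
qed

lemma mem_boundaries:
  "b \<in> boundaries C n \<longleftrightarrow> (\<exists>u\<in>carrier (cx_term C (n - step C)). b = cx_diff C (n - step C) u)"
  by (auto simp: boundaries_def)

lemma boundaries_closed:
  "0 \<in> boundaries C n"
  "b \<in> boundaries C n \<Longrightarrow> b' \<in> boundaries C n \<Longrightarrow> b + b' \<in> boundaries C n"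
  "b \<in> boundaries C n \<Longrightarrow> scale r b \<in> boundaries C n"
  "b \<in> boundaries C n \<Longrightarrow> - b \<in> boundaries C n"
  "b \<in> boundaries C n \<Longrightarrow> b' \<in> boundaries C n \<Longrightarrow> b - b' \<in> boundaries C n"
proof -
  show "0 \<in> boundaries C n" unfolding mem_boundaries by (rule bexI[of _ 0]) auto
  show a: "b + b' \<in> boundaries C n" if bb: "b \<in> boundaries C n" "b' \<in> boundaries C n" for b b'
  proof -
    obtain u u' where "u \<in> carrier (cx_term C (n - step C))" "b = cx_diff C (n - step C) u"
      "u' \<in> carrier (cx_term C (n - step C))" "b' = cx_diff C (n - step C) u'"
      using bb by (auto simp: mem_boundaries)
    then show ?thesis unfolding mem_boundaries
      by (intro bexI[of _ "u + u'"]) (auto simp: free_cx_diff free_cx_closed)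
  qed
  show s: "scale r b \<in> boundaries C n" if b: "b \<in> boundaries C n" for b r
  proof -
    obtain u where "u \<in> carrier (cx_term C (n - step C))" "b = cx_diff C (n - step C) u"
      using b by (auto simp: mem_boundaries)
    then show ?thesis unfolding mem_boundaries
      by (intro bexI[of _ "scale r u"]) (auto simp: free_cx_diff free_cx_closed)
  qed
  show m: "- b \<in> boundaries C n" if "b \<in> boundaries C n" for b
    using s[OF that, of "-1"] by simp
  show "b - b' \<in> boundaries C n" if "b \<in> boundaries C n" "b' \<in> boundaries C n"
    using a[OF that(1) m[OF that(2)]] by simp
qed

lemma boundaries_carrier: "b \<in> boundaries C n \<Longrightarrow> b \<in> carrier (cx_term C n)"
  unfolding mem_boundaries using free_cx_closed(3)[of _ "n - step C"] by auto

lemma mem_hclass: "y \<in> hclass C n x \<longleftrightarrow> y - x \<in> boundaries C n"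
proof -
  have "y \<in> hclass C n x \<longleftrightarrow> (\<exists>b\<in>boundaries C n. y = b + x)"
    by (simp add: hclass_def a_r_coset_def')
  also have "\<dots> \<longleftrightarrow> (\<exists>b\<in>boundaries C n. y - x = b)" by (simp add: diff_eq_eq)
  finally show ?thesis by simp
qed

lemma hclass_self: "x \<in> hclass C n x"
  by (simp add: mem_hclass boundaries_closed)

lemma hclass_eqI:
  assumes "x - y \<in> boundaries C n" shows "hclass C n x = hclass C n y"
proof -
  have "z - x \<in> boundaries C n \<longleftrightarrow> z - y \<in> boundaries C n" for z
    using boundaries_closed(2)[of "z - x" n, OF _ assms] boundaries_closed(5)[of "z - y" n, OF _ assms]
    by auto
  then show ?thesis by (auto simp: mem_hclass)
qed

lemma homology_carrier: "carrier (homology C n) = hclass C n ` cycles C n"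
  by (auto simp: homology_def quot_module_def A_RCOSETS_def' hclass_def a_r_coset_def')

lemma mem_cycles:
  "x \<in> cycles C n \<longleftrightarrow> x \<in> carrier (cx_term C n) \<and> cx_diff C n x = 0"
  by (simp add: cycles_def)

lemma hclass_carrier:
  "x \<in> carrier (cx_term C n) \<Longrightarrow> y \<in> hclass C n x \<Longrightarrow> y \<in> carrier (cx_term C n)"
  unfolding mem_hclass using free_cx_closed(1)[of x n "y - x"] boundaries_carrier[of "y - x" n] by simp

lemma homology_add: "hclass C n x \<oplus>\<^bsub>homology C n\<^esub> hclass C n y = hclass C n (x + y)"
proof -
  have "(\<exists>a b. a - x \<in> boundaries C n \<and> b - y \<in> boundaries C n \<and> c = a + b) \<longleftrightarrow>
    c - (x + y) \<in> boundaries C n" for c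
  proof
    assume "\<exists>a b. a - x \<in> boundaries C n \<and> b - y \<in> boundaries C n \<and> c = a + b"
    then obtain a b where "a - x \<in> boundaries C n" "b - y \<in> boundaries C n" "c = a + b" by blast
    then show "c - (x + y) \<in> boundaries C n"
      using boundaries_closed(2)[of "a - x" n "b - y"] by (simp add: algebra_simps)
  next
    assume "c - (x + y) \<in> boundaries C n"
    then show "\<exists>a b. a - x \<in> boundaries C n \<and> b - y \<in> boundaries C n \<and> c = a + b"
      by (intro exI[of _ x] exI[of _ "c - x"]) (auto simp: boundaries_closed algebra_simps)
  qed
  then show ?thesis
    by (simp add: homology_def quot_module_def set_add_def' mem_hclass[symmetric] set_eq_iff Bex_def)
qed

lemma homology_smult: "r \<odot>\<^bsub>homology C n\<^esub> hclass C n x = hclass C n (scale r x)"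
proof -
  have "hclass C n (scale r y) = hclass C n (scale r x)" if "y \<in> hclass C n x" for y
    using that boundaries_closed(3)[of "y - x" n r] by (intro hclass_eqI) (auto simp: mem_hclass scale_diff)
  moreover have "r \<odot>\<^bsub>homology C n\<^esub> hclass C n x = (\<Union>y\<in>hclass C n x. hclass C n (scale r y))"
    by (simp add: homology_def quot_module_def hclass_def a_r_coset_def')
  ultimately show ?thesis using UN_eq_const[OF hclass_self[of x n]] by metis
qed

end

lemma cx_homD:
  assumes "cx_hom C D h" "x \<in> carrier (cx_term C n)"
  shows "h x \<in> carrier (cx_term D n)" "y \<in> carrier (cx_term C n) \<Longrightarrow> h (x + y) = h x + h y"
    "h (scale r x) = scale r (h x)" "h (cx_diff C n x) = cx_diff D n (h x)"
  using assms by (auto simp: cx_hom_def)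

lemma cx_hom_minus:
  assumes "free_cx C" "cx_hom C D h" "x \<in> carrier (cx_term C n)" "y \<in> carrier (cx_term C n)"
  shows "h (x - y) = h x - h y"
  using cx_homD(2)[OF assms(2,3), of "scale (-1) y"] cx_homD(3)[OF assms(2,4), of "-1"]
    free_cx_closed(2)[OF assms(1,4), of "-1"] by simp

lemma cx_hom_cycles:
  assumes "free_cx C" "free_cx D" "cx_hom C D h" "x \<in> cycles C n"
  shows "h x \<in> cycles D n"
proof -
  have x: "x \<in> carrier (cx_term C n)" "cx_diff C n x = 0" using assms(1,4) by (auto simp: mem_cycles)
  have "h 0 = 0" using cx_homD(3)[OF assms(3), of 0 n 0] assms(1) by simp
  with x show ?thesis using cx_homD(1,4)[OF assms(3) x(1)] assms(2) by (simp add: mem_cycles)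
qed

lemma cx_hom_boundaries:
  assumes "free_cx C" "free_cx D" "cx_hom C D h" "b \<in> boundaries C n"
  shows "h b \<in> boundaries D n"
proof -
  have "step C = step D" using assms(3) by (simp add: cx_hom_def)
  moreover obtain u where "u \<in> carrier (cx_term C (n - step C))" "b = cx_diff C (n - step C) u"
    using assms(4) by (auto simp: mem_boundaries[OF assms(1)])
  ultimately show ?thesis
    using cx_homD(1,4)[OF assms(3)] by (auto simp: mem_boundaries[OF assms(2)])
qed

text \<open>
  Since \<open>h\<close> maps boundaries to boundaries, all representatives contribute the same coset.
\<close>

lemma induced_hclass:
  assumes C: "free_cx C" and D: "free_cx D" and h: "cx_hom C D h"
    and x: "x \<in> carrier (cx_term C n)"
  shows "induced D n h (hclass C n x) = hclass D n (h x)"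
proof -
  have "hclass D n (h y) = hclass D n (h x)" if "y \<in> hclass C n x" for y
  proof (rule hclass_eqI[OF D])
    have "y \<in> carrier (cx_term C n)" using hclass_carrier[OF C x that] .
    then show "h y - h x \<in> boundaries D n"
      using cx_hom_minus[OF C h _ x, of y] cx_hom_boundaries[OF C D h, of "y - x" n] that mem_hclass[OF C]
      by simp
  qed
  then show ?thesis using hclass_self[OF C, of x n]
    unfolding induced_def hclass_def[symmetric] by (rule UN_eq_const[rotated])
qed

lemma induced_mod_hom:
  assumes C: "free_cx C" and D: "free_cx D" and h: "cx_hom C D h"
  shows "induced D n h \<in> mod_homs (homology C n) (homology D n)"
proof -
  have *: "X \<in> carrier (homology C n) \<Longrightarrow> \<exists>x\<in>cycles C n. x \<in> carrier (cx_term C n) \<and> X = hclass C n x" for X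
    using C by (auto simp: homology_carrier mem_cycles)
  show ?thesis unfolding mod_homs_def
    using C D h
    by (auto dest!: * simp: induced_hclass homology_add homology_smult free_cx_closed cx_homD
      homology_carrier[OF D] intro!: imageI cx_hom_cycles[OF C D h])
qed

section \<open>The arrows of Mayer--Vietoris sequences on classes\<close>

text \<open>
  The hypotheses behind a Mayer--Vietoris sequence: the four complexes are included in each other,
  an element of both \<open>C K1\<close> and \<open>C K2\<close> is one of the intersection, and the differences fill the union.
  The last two conditions are the exactness of \<open>C K1 \<oplus> C K2\<close> in the middle and of the map to the union
  on the right.
\<close>

definition mv_pair :: "('v set set \<Rightarrow> ('r::comm_ring_1, 'k \<Rightarrow>\<^sub>0 'r) cx) \<Rightarrow> 'v set set \<Rightarrow> 'v set set \<Rightarrow> bool"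
  where "mv_pair C K1 K2 \<longleftrightarrow>
    free_cx (C (K1 \<inter> K2)) \<and> free_cx (C K1) \<and> free_cx (C K2) \<and> free_cx (C (K1 \<union> K2)) \<and>
    cx_hom (C (K1 \<inter> K2)) (C K1) id \<and> cx_hom (C (K1 \<inter> K2)) (C K2) id \<and>
    cx_hom (C K1) (C (K1 \<union> K2)) id \<and> cx_hom (C K2) (C (K1 \<union> K2)) id \<and>
    (\<forall>n. carrier (cx_term (C K1) n) \<inter> carrier (cx_term (C K2) n)
        \<subseteq> carrier (cx_term (C (K1 \<inter> K2)) n)) \<and>
    (\<forall>n. \<forall>x\<in>carrier (cx_term (C (K1 \<union> K2)) n).
        \<exists>y\<in>carrier (cx_term (C K1) n). \<exists>z\<in>carrier (cx_term (C K2) n). x = y - z)"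

lemma mv_seq_simps:
  "mv_step (mv_seq C K1 K2) = step (C (K1 \<union> K2))"
  "mvI (mv_seq C K1 K2) n = homology (C (K1 \<inter> K2)) n"
  "mvS (mv_seq C K1 K2) n = module_sum (homology (C K1) n) (homology (C K2) n)"
  "mvU (mv_seq C K1 K2) n = homology (C (K1 \<union> K2)) n"
  by (simp_all add: mv_seq_def Let_def)

lemma arrI_hclass:
  assumes "mv_pair C K1 K2" "x \<in> carrier (cx_term (C (K1 \<inter> K2)) n)"
  shows "arrI (mv_seq C K1 K2) n (hclass (C (K1 \<inter> K2)) n x) = (hclass (C K1) n x, hclass (C K2) n x)"
  using assms by (simp add: mv_seq_def Let_def induced_hclass mv_pair_def)

lemma arrS_hclass:
  assumes mv: "mv_pair C K1 K2"
    and y: "y \<in> carrier (cx_term (C K1) n)" and z: "z \<in> carrier (cx_term (C K2) n)"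
  shows "arrS (mv_seq C K1 K2) n (hclass (C K1) n y, hclass (C K2) n z) = hclass (C (K1 \<union> K2)) n (y - z)"
proof -
  let ?U = "C (K1 \<union> K2)"
  have C: "free_cx (C K1)" "free_cx (C K2)" "free_cx ?U" 
    and i: "cx_hom (C K1) ?U id" "cx_hom (C K2) ?U id"
    using mv by (auto simp: mv_pair_def)
  have *: "boundaries ?U n +>\<^bsub>cx_term ?U n\<^esub> (y' \<ominus>\<^bsub>cx_term ?U n\<^esub> z') = hclass ?U n (y - z)"
    if "y' \<in> hclass (C K1) n y" "z' \<in> hclass (C K2) n z" for y' z'
  proof -
    have z': "z' \<in> carrier (cx_term ?U n)"
      using hclass_carrier[OF C(2) z that(2)] cx_homD(1)[OF i(2)] by fastforce
    have "y' - y \<in> boundaries ?U n" "z' - z \<in> boundaries ?U n"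
      using that C cx_hom_boundaries[OF C(1,3) i(1)] cx_hom_boundaries[OF C(2,3) i(2)]
      by (auto simp: mem_hclass)
    then have "y' - y - (z' - z) \<in> boundaries ?U n" by (rule boundaries_closed(5)[OF C(3)])
    then have "hclass ?U n (y' - z') = hclass ?U n (y - z)"
      by (intro hclass_eqI[OF C(3)]) (simp add: algebra_simps)
    then show ?thesis by (simp add: free_cx_a_minus[OF C(3) z'] hclass_def)
  qed
  show ?thesis
    unfolding mv_seq_def Let_def mv.simps prod.case
    by (intro UN_eq_const[OF hclass_self[OF C(1)]] UN_eq_const[OF hclass_self[OF C(2)]] *)
qed

text \<open>
  Write the boundary by which the two representatives differ as \<open>d(u1 - u2)\<close> with \<open>u1\<close> and \<open>u2\<close> from the
  two parts.  Then \<open>y' - y - d u1 = z' - z - d u2\<close> lies in both parts, hence in the intersection, and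
  its differential is that of \<open>y' - y\<close> because \<open>d\<close> squares to \<open>0\<close>.
\<close>

lemma connecting_well_defined:
  assumes mv: "mv_pair C K1 K2"
    and y: "y \<in> carrier (cx_term (C K1) n)" and z: "z \<in> carrier (cx_term (C K2) n)"
    and y': "y' \<in> carrier (cx_term (C K1) n)" and z': "z' \<in> carrier (cx_term (C K2) n)"
    and b: "(y' - z') - (y - z) \<in> boundaries (C (K1 \<union> K2)) n"
  shows "cx_diff (C K1) n y' - cx_diff (C K1) n y \<in> boundaries (C (K1 \<inter> K2)) (n + step (C (K1 \<union> K2)))"
proof -
  let ?U = "C (K1 \<union> K2)" and ?I = "C (K1 \<inter> K2)"
  have C: "free_cx (C K1)" "free_cx (C K2)" "free_cx ?U" "free_cx ?I"
    and i: "cx_hom (C K1) ?U id" "cx_hom (C K2) ?U id" "cx_hom ?I (C K1) id"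
    using mv by (auto simp: mv_pair_def)
  have st: "step (C K1) = step ?U" "step (C K2) = step ?U" "step ?I = step ?U"
    using i by (auto simp: cx_hom_def)
  obtain u where u: "u \<in> carrier (cx_term ?U (n - step ?U))"
      "(y' - z') - (y - z) = cx_diff ?U (n - step ?U) u"
    using b mem_boundaries[OF C(3)] by blast
  obtain u1 u2 where u12: "u1 \<in> carrier (cx_term (C K1) (n - step ?U))"
      "u2 \<in> carrier (cx_term (C K2) (n - step ?U))" "u = u1 - u2"
    using mv u(1) unfolding mv_pair_def by blast
  \<comment> \<open>Used below: \<open>d1 - d2\<close> is the boundary by which the two representatives differ.\<close>
  define d1 d2 where "d1 = cx_diff (C K1) (n - step ?U) u1" and "d2 = cx_diff (C K2) (n - step ?U) u2"
  have d: "d1 \<in> carrier (cx_term (C K1) n)" "d2 \<in> carrier (cx_term (C K2) n)"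
    using free_cx_closed(3)[OF C(1) u12(1)] free_cx_closed(3)[OF C(2) u12(2)] st by (auto simp: d1_def d2_def)
  have dd: "cx_diff (C K1) n d1 = 0"
    using free_cx_diff(3)[OF C(1) u12(1)] st by (simp add: d1_def)
  have "cx_diff ?U (n - step ?U) u = d1 - d2"
    using free_cx_minus(2)[OF C(3), of u1 _ u2] cx_homD(1,4)[OF i(1) u12(1)] cx_homD(1,4)[OF i(2) u12(2)] u12(3)
    by (simp add: d1_def d2_def)
  then have eq: "(y' - y) - d1 = (z' - z) - d2" using u(2) by (simp add: algebra_simps)
  define w where "w = (y' - y) - d1"
  have w1: "w \<in> carrier (cx_term (C K1) n)"
    unfolding w_def by (intro free_cx_minus[OF C(1)] y y' d)
  have w2: "w \<in> carrier (cx_term (C K2) n)"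
    unfolding w_def eq by (intro free_cx_minus[OF C(2)] z z' d)
  have w: "w \<in> carrier (cx_term ?I n)" using w1 w2 mv by (auto simp: mv_pair_def)
  have "cx_diff (C K1) n w = cx_diff (C K1) n y' - cx_diff (C K1) n y"
    unfolding w_def using d dd y y' by (simp add: free_cx_minus[OF C(1)])
  moreover have "cx_diff ?I n w = cx_diff (C K1) n w" using cx_homD(4)[OF i(3) w] by simp
  ultimately show ?thesis using w st by (force simp: boundaries_def)
qed

text \<open>
  All decompositions of all representatives of a class give the same coset, so that the union in the
  definition of the connecting arrow may be computed from any one of them.
\<close>

lemma arrU_hclass:
  assumes mv: "mv_pair C K1 K2"
    and y: "y \<in> carrier (cx_term (C K1) n)" and z: "z \<in> carrier (cx_term (C K2) n)"
  shows "arrU (mv_seq C K1 K2) n (hclass (C (K1 \<union> K2)) n (y - z)) =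
    hclass (C (K1 \<inter> K2)) (n + step (C (K1 \<union> K2))) (cx_diff (C K1) n y)"
proof -
  let ?U = "C (K1 \<union> K2)" and ?I = "C (K1 \<inter> K2)"
  have C: "free_cx ?U" "free_cx ?I" and i: "cx_hom (C K2) ?U id"
    using mv by (auto simp: mv_pair_def)
  have z_U: "z' \<in> carrier (cx_term ?U n)" if "z' \<in> carrier (cx_term (C K2) n)" for z'
    using cx_homD(1)[OF i that] by simp
  have "arrU (mv_seq C K1 K2) n (hclass ?U n (y - z)) =
    \<Union>{hclass ?I (n + step ?U) (cx_diff (C K1) n y') | y' z'.
        y' \<in> carrier (cx_term (C K1) n) \<and> z' \<in> carrier (cx_term (C K2) n) \<and>
        y' - z' \<in> hclass ?U n (y - z)}"
    unfolding mv_seq_def Let_def hclass_def mv.simps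
    by (rule arg_cong[of _ _ Union], rule Collect_cong) (metis free_cx_a_minus[OF C(1) z_U])
  also have "\<dots> = \<Union>{hclass ?I (n + step ?U) (cx_diff (C K1) n y)}"
    using hclass_self[OF C(1), of "y - z" n] y z
      connecting_well_defined[OF mv y z] hclass_eqI[OF C(2)] mem_hclass[OF C(1)]
    by (intro arg_cong[of _ _ Union]) blast
  finally show ?thesis by simp
qed

text \<open>
  For a cycle \<open>y - z\<close> the differentials of \<open>y\<close> and \<open>z\<close> agree, so that their common value
  lies in both parts.
\<close>

lemma connecting_cycle:
  assumes mv: "mv_pair C K1 K2"
    and y: "y \<in> carrier (cx_term (C K1) n)" and z: "z \<in> carrier (cx_term (C K2) n)"
    and c: "y - z \<in> cycles (C (K1 \<union> K2)) n"
  shows "cx_diff (C K1) n y \<in> carrier (cx_term (C (K1 \<inter> K2)) (n + step (C (K1 \<union> K2))))"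
proof -
  let ?U = "C (K1 \<union> K2)"
  have C: "free_cx (C K1)" "free_cx (C K2)" "free_cx ?U" 
    and i: "cx_hom (C K1) ?U id" "cx_hom (C K2) ?U id"
    using mv by (auto simp: mv_pair_def)
  have st: "step (C K1) = step ?U" "step (C K2) = step ?U"
    using i by (auto simp: cx_hom_def)
  have "cx_diff (C K1) n y = cx_diff (C K2) n z"
    using c free_cx_minus(2)[OF C(3), of y n z] cx_homD(1,4)[OF i(1) y] cx_homD(1,4)[OF i(2) z]
    by (simp add: mem_cycles[OF C(3)])
  then show ?thesis
    using mv free_cx_closed(3)[OF C(1) y] free_cx_closed(3)[OF C(2) z] st by (auto simp: mv_pair_def)
qed

definition mv_hom where
  "mv_hom C K1 K2 D L1 L2 h \<longleftrightarrow> cx_hom (C (K1 \<inter> K2)) (D (L1 \<inter> L2)) h \<and>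
    cx_hom (C K1) (D L1) h \<and> cx_hom (C K2) (D L2) h \<and> cx_hom (C (K1 \<union> K2)) (D (L1 \<union> L2)) h"

text \<open>
  All arrows are given on classes by differences and differentials of chains, which \<open>h\<close> preserves;
  so each square of the ladder is checked on one representative.
\<close>

lemma mv_induced_morphism:
  assumes C: "mv_pair C K1 K2" and D: "mv_pair D L1 L2" and h: "mv_hom C K1 K2 D L1 L2 h"
  shows "mv_morphism (mv_seq C K1 K2) (mv_seq D L1 L2) (mv_induced D L1 L2 h)"
proof -
  let ?CI = "C (K1 \<inter> K2)" and ?CU = "C (K1 \<union> K2)" and ?DI = "D (L1 \<inter> L2)" and ?DU = "D (L1 \<union> L2)"
  have fC: "free_cx ?CI" "free_cx (C K1)" "free_cx (C K2)" "free_cx ?CU" and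
    iC: "cx_hom ?CI (C K1) id" "cx_hom ?CI (C K2) id" "cx_hom (C K1) ?CU id" "cx_hom (C K2) ?CU id"
    and dec: "\<And>n x. x \<in> carrier (cx_term ?CU n) \<Longrightarrow>
        \<exists>y\<in>carrier (cx_term (C K1) n). \<exists>z\<in>carrier (cx_term (C K2) n). x = y - z"
    using C by (auto simp: mv_pair_def)
  have fD: "free_cx ?DI" "free_cx (D L1)" "free_cx (D L2)" "free_cx ?DU"
    using D by (auto simp: mv_pair_def)
  have hh: "cx_hom ?CI ?DI h" "cx_hom (C K1) (D L1) h" "cx_hom (C K2) (D L2) h" "cx_hom ?CU ?DU h"
    using h by (auto simp: mv_hom_def)
  have st: "step ?CU = step ?DU" using hh(4) by (simp add: cx_hom_def)
  have ind_simps: "mapI (mv_induced D L1 L2 h) n = induced ?DI n h"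
    "mapS (mv_induced D L1 L2 h) n = map_prod (induced (D L1) n h) (induced (D L2) n h)"
    "mapU (mv_induced D L1 L2 h) n = induced ?DU n h" for n
    by (simp_all add: mv_induced_def)
  show ?thesis
    unfolding mv_morphism_def
  proof (intro conjI allI ballI)
    show "mv_step (mv_seq C K1 K2) = mv_step (mv_seq D L1 L2)" by (simp add: mv_seq_simps st)
  next
    fix n
    show "mapI (mv_induced D L1 L2 h) n \<in> mod_homs (mvI (mv_seq C K1 K2) n) (mvI (mv_seq D L1 L2) n)"
      unfolding mv_seq_simps ind_simps by (rule induced_mod_hom[OF fC(1) fD(1) hh(1)])
    show "mapU (mv_induced D L1 L2 h) n \<in> mod_homs (mvU (mv_seq C K1 K2) n) (mvU (mv_seq D L1 L2) n)"
      unfolding mv_seq_simps ind_simps by (rule induced_mod_hom[OF fC(4) fD(4) hh(4)])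
    show "mapS (mv_induced D L1 L2 h) n \<in> mod_homs (mvS (mv_seq C K1 K2) n) (mvS (mv_seq D L1 L2) n)"
      unfolding mv_seq_simps ind_simps
      using induced_mod_hom[OF fC(2) fD(2) hh(2), of n] induced_mod_hom[OF fC(3) fD(3) hh(3), of n]
      by (auto simp: mod_homs_def module_sum_def)
  next
    fix n X assume "X \<in> carrier (mvI (mv_seq C K1 K2) n)"
    then obtain x where x: "x \<in> carrier (cx_term ?CI n)" "X = hclass ?CI n x"
      using fC by (auto simp: mv_seq_simps homology_carrier mem_cycles)
    have "x \<in> carrier (cx_term (C K1) n)" "x \<in> carrier (cx_term (C K2) n)"
      using x(1) cx_homD(1)[OF iC(1)] cx_homD(1)[OF iC(2)] by fastforce+
    then show "arrI (mv_seq D L1 L2) n (mapI (mv_induced D L1 L2 h) n X) =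
        mapS (mv_induced D L1 L2 h) n (arrI (mv_seq C K1 K2) n X)"
      using x fC fD hh by (simp add: ind_simps induced_hclass arrI_hclass[OF C] arrI_hclass[OF D] cx_homD)
  next
    fix n P assume "P \<in> carrier (mvS (mv_seq C K1 K2) n)"
    then obtain y z where yz: "y \<in> carrier (cx_term (C K1) n)" "z \<in> carrier (cx_term (C K2) n)"
        "P = (hclass (C K1) n y, hclass (C K2) n z)"
      using fC by (auto simp: mv_seq_simps module_sum_def homology_carrier mem_cycles)
    have U: "y \<in> carrier (cx_term ?CU n)" "z \<in> carrier (cx_term ?CU n)"
      using yz cx_homD(1)[OF iC(3)] cx_homD(1)[OF iC(4)] by fastforce+
    show "arrS (mv_seq D L1 L2) n (mapS (mv_induced D L1 L2 h) n P) =
        mapU (mv_induced D L1 L2 h) n (arrS (mv_seq C K1 K2) n P)"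
      using yz U fC fD hh
      by (simp add: ind_simps induced_hclass arrS_hclass[OF C] arrS_hclass[OF D] cx_homD
          cx_hom_minus[OF fC(4) hh(4)] free_cx_minus)
  next
    fix n X assume "X \<in> carrier (mvU (mv_seq C K1 K2) n)"
    then obtain x where x: "x \<in> cycles ?CU n" "X = hclass ?CU n x"
      using fC by (auto simp: mv_seq_simps homology_carrier)
    then obtain y z where yz: "y \<in> carrier (cx_term (C K1) n)" "z \<in> carrier (cx_term (C K2) n)" "x = y - z"
      using dec fC(4) by (metis mem_cycles)
    have U: "y \<in> carrier (cx_term ?CU n)" "z \<in> carrier (cx_term ?CU n)"
      using yz cx_homD(1)[OF iC(3)] cx_homD(1)[OF iC(4)] by fastforce+
    have d: "cx_diff (C K1) n y \<in> carrier (cx_term ?CI (n + step ?CU))"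
      using connecting_cycle[OF C yz(1,2)] x yz by simp
    have "arrU (mv_seq D L1 L2) n (mapU (mv_induced D L1 L2 h) n X) =
        arrU (mv_seq D L1 L2) n (hclass ?DU n (h y - h z))"
      using x yz(3) U fC fD hh by (simp add: ind_simps induced_hclass free_cx_minus cx_hom_minus[OF fC(4) hh(4)])
    also have "\<dots> = hclass ?DI (n + step ?CU) (h (cx_diff (C K1) n y))"
      using arrU_hclass[OF D cx_homD(1)[OF hh(2) yz(1)] cx_homD(1)[OF hh(3) yz(2)]]
        cx_homD(4)[OF hh(2) yz(1)] st by simp
    also have "\<dots> = mapI (mv_induced D L1 L2 h) (n + step ?CU) (arrU (mv_seq C K1 K2) n X)"
      using x(2) yz by (simp add: ind_simps arrU_hclass[OF C] induced_hclass[OF fC(1) fD(1) hh(1) d])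
    finally show "arrU (mv_seq D L1 L2) n (mapU (mv_induced D L1 L2 h) n X) =
        mapI (mv_induced D L1 L2 h) (n + mv_step (mv_seq C K1 K2)) (arrU (mv_seq C K1 K2) n X)"
      by (simp add: mv_seq_simps)
  qed
qed

section \<open>Compositions of induced morphisms\<close>

lemma mv_pair_hclass_cases:
  assumes "mv_pair C K1 K2"
  shows "X \<in> carrier (mvI (mv_seq C K1 K2) n) \<Longrightarrow>
      \<exists>x\<in>carrier (cx_term (C (K1 \<inter> K2)) n). X = hclass (C (K1 \<inter> K2)) n x"
    and "P \<in> carrier (mvS (mv_seq C K1 K2) n) \<Longrightarrow>
      \<exists>y\<in>carrier (cx_term (C K1) n). \<exists>z\<in>carrier (cx_term (C K2) n).
        P = (hclass (C K1) n y, hclass (C K2) n z)"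
    and "X \<in> carrier (mvU (mv_seq C K1 K2) n) \<Longrightarrow>
      \<exists>x\<in>carrier (cx_term (C (K1 \<union> K2)) n). X = hclass (C (K1 \<union> K2)) n x"
  using assms by (auto simp: mv_pair_def mv_seq_simps module_sum_def homology_carrier mem_cycles)

lemma mv_induced_simps:
  "mapI (mv_induced D L1 L2 h) n = induced (D (L1 \<inter> L2)) n h"
  "mapS (mv_induced D L1 L2 h) n = map_prod (induced (D L1) n h) (induced (D L2) n h)"
  "mapU (mv_induced D L1 L2 h) n = induced (D (L1 \<union> L2)) n h"
  by (simp_all add: mv_induced_def)

lemma mv_eq_sym: "mv_eq S F G \<Longrightarrow> mv_eq S G F"
  by (simp add: mv_eq_def)

lemma mv_eq_trans: "mv_eq S F G \<Longrightarrow> mv_eq S G H \<Longrightarrow> mv_eq S F H"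
  by (simp add: mv_eq_def)

lemma cx_hom_comp:
  assumes h: "cx_hom C D h" and g: "cx_hom D E g"
  shows "cx_hom C E (g \<circ> h)"
  unfolding cx_hom_def[of C E]
proof (intro conjI allI ballI)
  show "step C = step E" using assms by (simp add: cx_hom_def)
  fix n x r assume x: "x \<in> carrier (cx_term C n)"
  note h' = cx_homD[OF h x] and g' = cx_homD[OF g cx_homD(1)[OF h x]]
  show "(g \<circ> h) x \<in> carrier (cx_term E n)" "(g \<circ> h) (scale r x) = scale r ((g \<circ> h) x)"
    "(g \<circ> h) (cx_diff C n x) = cx_diff E n ((g \<circ> h) x)"
    using h' g' by simp_all
  fix y assume "y \<in> carrier (cx_term C n)"
  then show "(g \<circ> h) (x + y) = (g \<circ> h) x + (g \<circ> h) y"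
    using h'(2) g'(2) cx_homD(1)[OF h] by simp
qed

lemma mv_hom_comp:
  assumes "mv_hom C K1 K2 D L1 L2 h" "mv_hom D L1 L2 E M1 M2 g"
  shows "mv_hom C K1 K2 E M1 M2 (g \<circ> h)"
  using assms unfolding mv_hom_def by (meson cx_hom_comp)

lemma mv_eqI:
  assumes C: "mv_pair C K1 K2"
    and "\<And>n x. x \<in> carrier (cx_term (C (K1 \<inter> K2)) n) \<Longrightarrow>
      mapI F n (hclass (C (K1 \<inter> K2)) n x) = mapI G n (hclass (C (K1 \<inter> K2)) n x)"
    and "\<And>n y z. y \<in> carrier (cx_term (C K1) n) \<Longrightarrow> z \<in> carrier (cx_term (C K2) n) \<Longrightarrow>
      mapS F n (hclass (C K1) n y, hclass (C K2) n z) = mapS G n (hclass (C K1) n y, hclass (C K2) n z)"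
    and "\<And>n x. x \<in> carrier (cx_term (C (K1 \<union> K2)) n) \<Longrightarrow>
      mapU F n (hclass (C (K1 \<union> K2)) n x) = mapU G n (hclass (C (K1 \<union> K2)) n x)"
  shows "mv_eq (mv_seq C K1 K2) F G"
  using assms(2-4) unfolding mv_eq_def by (auto dest!: mv_pair_hclass_cases[OF C])

lemma mv_pair_carrier_Un:
  assumes "mv_pair C K1 K2"
  shows "x \<in> carrier (cx_term (C (K1 \<inter> K2)) n) \<Longrightarrow> x \<in> carrier (cx_term (C (K1 \<union> K2)) n)"
    "x \<in> carrier (cx_term (C K1) n) \<Longrightarrow> x \<in> carrier (cx_term (C (K1 \<union> K2)) n)"
    "x \<in> carrier (cx_term (C K2) n) \<Longrightarrow> x \<in> carrier (cx_term (C (K1 \<union> K2)) n)"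
proof -
  have i: "cx_hom (C (K1 \<inter> K2)) (C K1) id" "cx_hom (C K1) (C (K1 \<union> K2)) id"
    "cx_hom (C K2) (C (K1 \<union> K2)) id"
    using assms by (auto simp: mv_pair_def)
  show b: "x \<in> carrier (cx_term (C K1) n) \<Longrightarrow> x \<in> carrier (cx_term (C (K1 \<union> K2)) n)"
    "x \<in> carrier (cx_term (C K2) n) \<Longrightarrow> x \<in> carrier (cx_term (C (K1 \<union> K2)) n)"
    using cx_homD(1)[OF i(2)] cx_homD(1)[OF i(3)] by fastforce+
  show "x \<in> carrier (cx_term (C (K1 \<inter> K2)) n) \<Longrightarrow> x \<in> carrier (cx_term (C (K1 \<union> K2)) n)"
    using cx_homD(1)[OF i(1)] b(1) by fastforce
qed

text \<open>
  The terms of the intersection and of the two parts lie in those of the union, so that it suffices to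
  compare the chain maps there.
\<close>

lemma mv_induced_comp:
  assumes C: "mv_pair C K1 K2" and D: "mv_pair D L1 L2" and E: "mv_pair E M1 M2"
    and h: "mv_hom C K1 K2 D L1 L2 h" and g: "mv_hom D L1 L2 E M1 M2 g" and f: "mv_hom C K1 K2 E M1 M2 f"
    and eq: "\<And>n x. x \<in> carrier (cx_term (C (K1 \<union> K2)) n) \<Longrightarrow> f x = g (h x)"
  shows "mv_eq (mv_seq C K1 K2) (mv_induced E M1 M2 f)
    (mv_comp (mv_induced E M1 M2 g) (mv_induced D L1 L2 h))"
proof -
  have *: "induced E' n f (hclass C' n x) = induced E' n g (induced D' n h (hclass C' n x))"
    if "x \<in> carrier (cx_term C' n)" "x \<in> carrier (cx_term (C (K1 \<union> K2)) n)"
      "free_cx C'" "free_cx D'" "free_cx E'" "cx_hom C' D' h" "cx_hom D' E' g" "cx_hom C' E' f"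
    for C' D' E' n x
    using that by (simp add: induced_hclass eq cx_homD(1))
  note defs = mv_comp_def mv_induced_simps
  note facts = C[unfolded mv_pair_def] D[unfolded mv_pair_def] E[unfolded mv_pair_def]
    h[unfolded mv_hom_def] g[unfolded mv_hom_def] f[unfolded mv_hom_def]
  show ?thesis
  proof (rule mv_eqI[OF C])
    fix n x assume x: "x \<in> carrier (cx_term (C (K1 \<inter> K2)) n)"
    show "mapI (mv_induced E M1 M2 f) n (hclass (C (K1 \<inter> K2)) n x) =
        mapI (mv_comp (mv_induced E M1 M2 g) (mv_induced D L1 L2 h)) n (hclass (C (K1 \<inter> K2)) n x)"
      using *[OF x mv_pair_carrier_Un(1)[OF C x], of "D (L1 \<inter> L2)" "E (M1 \<inter> M2)"] facts
      by (simp add: defs)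
  next
    fix n y z assume y: "y \<in> carrier (cx_term (C K1) n)" and z: "z \<in> carrier (cx_term (C K2) n)"
    show "mapS (mv_induced E M1 M2 f) n (hclass (C K1) n y, hclass (C K2) n z) =
        mapS (mv_comp (mv_induced E M1 M2 g) (mv_induced D L1 L2 h)) n (hclass (C K1) n y, hclass (C K2) n z)"
      using *[OF y mv_pair_carrier_Un(2)[OF C y], of "D L1" "E M1"]
        *[OF z mv_pair_carrier_Un(3)[OF C z], of "D L2" "E M2"] facts
      by (simp add: defs)
  next
    fix n x assume x: "x \<in> carrier (cx_term (C (K1 \<union> K2)) n)"
    show "mapU (mv_induced E M1 M2 f) n (hclass (C (K1 \<union> K2)) n x) =
        mapU (mv_comp (mv_induced E M1 M2 g) (mv_induced D L1 L2 h)) n (hclass (C (K1 \<union> K2)) n x)"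
      using *[OF x x, of "D (L1 \<union> L2)" "E (M1 \<union> M2)"] facts
      by (simp add: defs)
  qed
qed

lemma mv_eq_id:
  assumes C: "mv_pair C K1 K2" and f: "mv_hom C K1 K2 C K1 K2 f"
    and eq: "\<And>n x. x \<in> carrier (cx_term (C (K1 \<union> K2)) n) \<Longrightarrow> f x = x"
  shows "mv_eq (mv_seq C K1 K2) (mv_induced C K1 K2 f) mv_id"
proof -
  have *: "induced C' n f (hclass C' n x) = hclass C' n x"
    if "x \<in> carrier (cx_term C' n)" "x \<in> carrier (cx_term (C (K1 \<union> K2)) n)" "free_cx C'" "cx_hom C' C' f"
    for C' n x
    using that eq[of x n] by (simp add: induced_hclass)
  show ?thesis
    using C[unfolded mv_pair_def] f[unfolded mv_hom_def] mv_pair_carrier_Un[OF C]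
    by (intro mv_eqI[OF C]) (simp_all add: mv_id_def mv_induced_simps *)
qed

text \<open>
  The inclusion of the lower into the upper sequence is induced by the identity map of chains.
\<close>

definition hmv_pair where
  "hmv_pair C lo up H1 H2 \<longleftrightarrow> mv_pair C (lo H1) (lo H2) \<and> mv_pair C (up H1) (up H2) \<and>
    mv_hom C (lo H1) (lo H2) C (up H1) (up H2) id"

definition hmv_hom where
  "hmv_hom C lo up H1 H2 D lo' up' H1' H2' h \<longleftrightarrow>
    mv_hom C (lo H1) (lo H2) D (lo' H1') (lo' H2') h \<and>
    mv_hom C (up H1) (up H2) D (up' H1') (up' H2') h"

text \<open>
  The square with the two inclusions commutes because both of its composites are induced by \<open>h\<close> itself,
  regarded as a map from the lower complexes of the source to the upper complexes of the target.
\<close>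

lemma hmv_induced_morphism:
  assumes C: "hmv_pair C lo up H1 H2" and D: "hmv_pair D lo' up' H1' H2'"
    and h: "hmv_hom C lo up H1 H2 D lo' up' H1' H2' h"
  shows "hmv_morphism (hmv_object C lo up H1 H2) (hmv_object D lo' up' H1' H2')
    (hmv_induced D lo' up' H1' H2' h)"
proof -
  have c: "mv_pair C (lo H1) (lo H2)" "mv_pair C (up H1) (up H2)"
      "mv_hom C (lo H1) (lo H2) C (up H1) (up H2) id"
    and d: "mv_pair D (lo' H1') (lo' H2')" "mv_pair D (up' H1') (up' H2')"
      "mv_hom D (lo' H1') (lo' H2') D (up' H1') (up' H2') id"
    and hh: "mv_hom C (lo H1) (lo H2) D (lo' H1') (lo' H2') h"
      "mv_hom C (up H1) (up H2) D (up' H1') (up' H2') h"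
    using assms by (auto simp: hmv_pair_def hmv_hom_def)
  have f: "mv_hom C (lo H1) (lo H2) D (up' H1') (up' H2') h"
    using mv_hom_comp[OF c(3) hh(2)] by simp
  have "mv_eq (mv_seq C (lo H1) (lo H2))
     (mv_comp (mv_induced D (up' H1') (up' H2') h) (mv_induced C (up H1) (up H2) id))
     (mv_comp (mv_induced D (up' H1') (up' H2') id) (mv_induced D (lo' H1') (lo' H2') h))"
    by (rule mv_eq_trans[OF mv_eq_sym[OF mv_induced_comp[OF c(1,2) d(2) c(3) hh(2) f]]
          mv_induced_comp[OF c(1) d(1,2) hh(1) d(3) f]]) simp_all
  then show ?thesis
    by (simp add: hmv_morphism_def hmv_object_def hmv_induced_def
        mv_induced_morphism[OF c(1) d(1) hh(1)] mv_induced_morphism[OF c(2) d(2) hh(2)])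
qed

lemma hmv_eq_sym: "hmv_eq S F G \<Longrightarrow> hmv_eq S G F"
  by (simp add: hmv_eq_def mv_eq_sym)

lemma hmv_eq_trans: "hmv_eq S F G \<Longrightarrow> hmv_eq S G H \<Longrightarrow> hmv_eq S F H"
  by (simp add: hmv_eq_def mv_eq_def)

lemma hmv_induced_comp:
  assumes "hmv_pair C lo up H1 H2" "hmv_pair D lo' up' H1' H2'" "hmv_pair E lo'' up'' H1'' H2''"
    and "hmv_hom C lo up H1 H2 D lo' up' H1' H2' h"
    and "hmv_hom D lo' up' H1' H2' E lo'' up'' H1'' H2'' g"
    and "hmv_hom C lo up H1 H2 E lo'' up'' H1'' H2'' f"
    and "\<And>n x. x \<in> carrier (cx_term (C (lo H1 \<union> lo H2)) n) \<Longrightarrow> f x = g (h x)"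
    and "\<And>n x. x \<in> carrier (cx_term (C (up H1 \<union> up H2)) n) \<Longrightarrow> f x = g (h x)"
  shows "hmv_eq (hmv_object C lo up H1 H2) (hmv_induced E lo'' up'' H1'' H2'' f)
    (hmv_comp (hmv_induced E lo'' up'' H1'' H2'' g) (hmv_induced D lo' up' H1' H2' h))"
  using assms
  by (auto simp: hmv_eq_def hmv_object_def hmv_induced_def hmv_comp_def hmv_pair_def hmv_hom_def
      intro!: mv_induced_comp)

lemma hmv_eq_id:
  assumes "hmv_pair C lo up H1 H2" "hmv_hom C lo up H1 H2 C lo up H1 H2 f"
    and "\<And>n x. x \<in> carrier (cx_term (C (lo H1 \<union> lo H2)) n) \<Longrightarrow> f x = x"
    and "\<And>n x. x \<in> carrier (cx_term (C (up H1 \<union> up H2)) n) \<Longrightarrow> f x = x"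
  shows "hmv_eq (hmv_object C lo up H1 H2) (hmv_induced C lo up H1 H2 f) hmv_id"
  using assms
  by (auto simp: hmv_eq_def hmv_object_def hmv_induced_def hmv_id_def hmv_pair_def hmv_hom_def
      intro!: mv_eq_id)

section \<open>Constrained complexes\<close>

text \<open>
  The action of a class of the exterior algebra is controlled only on chains of simplices, so linearity
  has to be confined to them.
\<close>

definition linear_on :: "'k set \<Rightarrow> (('k \<Rightarrow>\<^sub>0 'r::comm_ring_1) \<Rightarrow> ('l \<Rightarrow>\<^sub>0 'r)) \<Rightarrow> bool"
  where "linear_on W f \<longleftrightarrow> (\<forall>x. Poly_Mapping.keys x \<subseteq> W \<longrightarrow>
    (\<forall>y. Poly_Mapping.keys y \<subseteq> W \<longrightarrow> f (x + y) = f x + f y) \<and> (\<forall>r. f (scale r x) = scale r (f x)))"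

definition graded_op ::
  "int \<Rightarrow> 'v set set \<Rightarrow> 'w set set \<Rightarrow> (('v set \<Rightarrow>\<^sub>0 'r::comm_ring_1) \<Rightarrow> ('w set \<Rightarrow>\<^sub>0 'r)) \<Rightarrow> bool"
  where "graded_op d K K' h \<longleftrightarrow>
    (\<forall>k c. Poly_Mapping.keys c \<subseteq> {\<sigma> \<in> K. int (card \<sigma>) = k + 1} \<longrightarrow>
      Poly_Mapping.keys (h c) \<subseteq> {\<sigma> \<in> K'. int (card \<sigma>) = k + d + 1})"

lemma graded_opD:
  "graded_op d K K' h \<Longrightarrow> Poly_Mapping.keys c \<subseteq> {\<sigma> \<in> K. int (card \<sigma>) = k + 1} \<Longrightarrow>
    Poly_Mapping.keys (h c) \<subseteq> {\<sigma> \<in> K'. int (card \<sigma>) = k + d + 1}"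
  by (simp add: graded_op_def)

text \<open>
  The terms of a chain in \<open>K1\<close> are split off; the others lie in \<open>K2\<close>.
\<close>

lemma chains_Un:
  fixes x :: "'k \<Rightarrow>\<^sub>0 'r::comm_ring_1"
  assumes "Poly_Mapping.keys x \<subseteq> K1 \<union> K2"
  shows "\<exists>y z. Poly_Mapping.keys y \<subseteq> Poly_Mapping.keys x \<inter> K1 \<and>
    Poly_Mapping.keys z \<subseteq> Poly_Mapping.keys x \<inter> K2 \<and> x = y + z"
proof -
  define s :: "'k set \<Rightarrow> 'k \<Rightarrow>\<^sub>0 'r" where "s A = (\<Sum>k\<in>A. Poly_Mapping.single k (Poly_Mapping.lookup x k))" for A
  have "Poly_Mapping.keys (s A) \<subseteq> A" for A
    unfolding s_def by (rule keys_sum_sub) simp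
  moreover have "x = s (Poly_Mapping.keys x \<inter> K1) + s (Poly_Mapping.keys x - K1)"
  proof -
    have "x = s (Poly_Mapping.keys x)" using lin_ext_basis[of x] by (simp add: lin_ext_def s_def)
    then show ?thesis unfolding s_def by (metis (no_types) sum.Int_Diff finite_keys)
  qed
  moreover have "Poly_Mapping.keys x - K1 \<subseteq> Poly_Mapping.keys x \<inter> K2" using assms by blast
  ultimately show ?thesis by (meson order_trans)
qed

lemma graded_op_Int: "graded_op d K1 L1 h \<Longrightarrow> graded_op d K2 L2 h \<Longrightarrow> graded_op d (K1 \<inter> K2) (L1 \<inter> L2) h"
  by (fastforce simp: graded_op_def subset_iff)

lemma graded_op_Un:
  fixes h :: "('v set \<Rightarrow>\<^sub>0 'r::comm_ring_1) \<Rightarrow> ('w set \<Rightarrow>\<^sub>0 'r)"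
  assumes "graded_op d K1 L1 h" "graded_op d K2 L2 h" "linear_on W h" "K1 \<subseteq> W" "K2 \<subseteq> W"
  shows "graded_op d (K1 \<union> K2) (L1 \<union> L2) h"
  unfolding graded_op_def
proof (intro allI impI)
  fix k and c :: "'v set \<Rightarrow>\<^sub>0 'r" assume c: "Poly_Mapping.keys c \<subseteq> {\<sigma> \<in> K1 \<union> K2. int (card \<sigma>) = k + 1}"
  then obtain y z where yz: "Poly_Mapping.keys y \<subseteq> Poly_Mapping.keys c \<inter> K1" "Poly_Mapping.keys z \<subseteq> Poly_Mapping.keys c \<inter> K2" "c = y + z"
    using chains_Un[of c K1 K2] by blast
  have "Poly_Mapping.keys (h y) \<subseteq> {\<sigma> \<in> L1. int (card \<sigma>) = k + d + 1}"
    by (rule graded_opD[OF assms(1)]) (use yz c in auto)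
  moreover have "Poly_Mapping.keys (h z) \<subseteq> {\<sigma> \<in> L2. int (card \<sigma>) = k + d + 1}"
    by (rule graded_opD[OF assms(2)]) (use yz c in auto)
  moreover have "h c = h y + h z"
    using assms(3-5) yz unfolding linear_on_def by blast
  ultimately show "Poly_Mapping.keys (h c) \<subseteq> {\<sigma> \<in> L1 \<union> L2. int (card \<sigma>) = k + d + 1}"
    using keys_add[of "h y" "h z"] by auto
qed

text \<open>
  Quotient and remainder of \<open>m\<close> recombine.  So a change of \<open>m\<close> by \<open>d\<close> shifts all degrees by \<open>d\<close>,
  whatever carries occur in the division.
\<close>

lemma constrained_deg_eq: "constrained_deg t m n = n * (2 * int t + 1) + m"
  unfolding constrained_deg_def Let_def
  using div_mult_mod_eq[of m "2 * int t + 1"] by (simp add: algebra_simps)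

lemma constrained_cx_simps:
  "step (constrained_cx e f t m K) = e"
  "carrier (cx_term (constrained_cx e f t m K) n) =
    {c. Poly_Mapping.keys c \<subseteq> {\<sigma> \<in> if 0 \<le> n then K else {}. int (card \<sigma>) = n * (2 * int t + 1) + m + 1}}"
  "zero (cx_term (constrained_cx e f t m K) n) = 0"
  "add (cx_term (constrained_cx e f t m K) n) = (+)"
  "smult (cx_term (constrained_cx e f t m K) n) = scale"
  "cx_diff (constrained_cx e f t m K) n c = (if 0 \<le> n \<and> 0 \<le> n + e then f c else 0)"
  by (simp_all add: constrained_cx_def chain_module_def constrained_deg_eq)

lemma linear_on_0: "linear_on W f \<Longrightarrow> f 0 = 0"
  unfolding linear_on_def by (metis empty_subsetI keys_zero scale_simps(1))

lemma linear_onD: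
  assumes "linear_on W f" "Poly_Mapping.keys x \<subseteq> W"
  shows "Poly_Mapping.keys y \<subseteq> W \<Longrightarrow> f (x + y) = f x + f y" "f (scale r x) = scale r (f x)"
  using assms by (simp_all add: linear_on_def)

lemma constrained_keys:
  assumes "x \<in> carrier (cx_term (constrained_cx e f t m K) n)"
  shows "Poly_Mapping.keys x \<subseteq> K" "0 \<le> n \<Longrightarrow>
    Poly_Mapping.keys x \<subseteq> {\<sigma> \<in> K. int (card \<sigma>) = n * (2 * int t + 1) + m + 1}"
  using assms by (auto simp: constrained_cx_simps split: if_splits)

text \<open>
  Replacing the terms of negative index by \<open>0\<close>, and the differentials from or to them as well, does not
  affect that differentials compose to \<open>0\<close>.
\<close>

lemma constrained_free_cx:
  fixes f :: "('v set \<Rightarrow>\<^sub>0 'r::comm_ring_1) \<Rightarrow> ('v set \<Rightarrow>\<^sub>0 'r)"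
  assumes f: "linear_on W f" "graded_op (e * (2 * int t + 1)) K K f" and K: "K \<subseteq> W"
    and sq: "\<And>c. Poly_Mapping.keys c \<subseteq> W \<Longrightarrow> f (f c) = 0"
  shows "free_cx (constrained_cx e f t m K)"
  unfolding free_cx_def
proof (intro allI conjI ballI)
  let ?C = "constrained_cx e f t m K"
  fix n
  show "zero (cx_term ?C n) = 0" "add (cx_term ?C n) = (+)" "smult (cx_term ?C n) = scale"
    "0 \<in> carrier (cx_term ?C n)"
    by (simp_all add: constrained_cx_simps)
  fix x assume x: "x \<in> carrier (cx_term ?C n)"
  note xW = subset_trans[OF constrained_keys(1)[OF x] K]
  show "scale r x \<in> carrier (cx_term ?C n)" for r
    using x by (simp add: constrained_cx_simps keys_scale_sub)
  show "cx_diff ?C n (scale r x) = scale r (cx_diff ?C n x)" for r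
    using linear_onD(2)[OF f(1) xW] by (simp add: constrained_cx_simps)
  show "cx_diff ?C (n + step ?C) (cx_diff ?C n x) = 0"
    using sq[OF xW] linear_on_0[OF f(1)] by (simp add: constrained_cx_simps)
  show "cx_diff ?C n x \<in> carrier (cx_term ?C (n + step ?C))"
  proof (cases "0 \<le> n \<and> 0 \<le> n + e")
    case True
    then show ?thesis
      using graded_opD[OF f(2) constrained_keys(2)[OF x]] by (simp add: constrained_cx_simps algebra_simps)
  qed (auto simp: constrained_cx_simps)
  fix y assume y: "y \<in> carrier (cx_term ?C n)"
  show "x + y \<in> carrier (cx_term ?C n)"
    using x y by (simp add: constrained_cx_simps keys_add_sub)
  show "cx_diff ?C n (x + y) = cx_diff ?C n x + cx_diff ?C n y"
    using linear_onD(1)[OF f(1) xW subset_trans[OF constrained_keys(1)[OF y] K]]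
    by (simp add: constrained_cx_simps)
qed

lemma constrained_cx_hom:
  fixes h :: "('v set \<Rightarrow>\<^sub>0 'r::comm_ring_1) \<Rightarrow> ('w set \<Rightarrow>\<^sub>0 'r)"
  assumes h: "linear_on W h" "graded_op (m' - m) K K' h" and K: "K \<subseteq> W"
    and comm: "\<And>c. Poly_Mapping.keys c \<subseteq> W \<Longrightarrow> h (f c) = f' (h c)"
  shows "cx_hom (constrained_cx e f t m K) (constrained_cx e f' t m' K') h"
  unfolding cx_hom_def
proof (intro allI conjI ballI)
  let ?C = "constrained_cx e f t m K" and ?D = "constrained_cx e f' t m' K'"
  show "step ?C = step ?D" by (simp add: constrained_cx_simps)
  fix n x assume x: "x \<in> carrier (cx_term ?C n)"
  note xW = subset_trans[OF constrained_keys(1)[OF x] K]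
  show "h (scale r x) = scale r (h x)" for r by (rule linear_onD(2)[OF h(1) xW])
  show "h (cx_diff ?C n x) = cx_diff ?D n (h x)"
    using comm[OF xW] linear_on_0[OF h(1)] by (simp add: constrained_cx_simps)
  show "h x \<in> carrier (cx_term ?D n)"
  proof (cases "0 \<le> n")
    case True
    then show ?thesis
      using graded_opD[OF h(2) constrained_keys(2)[OF x]] by (simp add: constrained_cx_simps algebra_simps)
  next
    case False
    then show ?thesis using x linear_on_0[OF h(1)] by (simp add: constrained_cx_simps)
  qed
  fix y assume y: "y \<in> carrier (cx_term ?C n)"
  show "h (x + y) = h x + h y"
    by (rule linear_onD(1)[OF h(1) xW subset_trans[OF constrained_keys(1)[OF y] K]])
qed

lemma linear_on_id: "linear_on W id"
  by (simp add: linear_on_def)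

lemma graded_op_id: "K \<subseteq> L \<Longrightarrow> graded_op 0 K L id"
  by (auto simp: graded_op_def)

lemma constrained_mv_hom:
  assumes h: "linear_on W h" "graded_op (m' - m) K1 L1 h" "graded_op (m' - m) K2 L2 h"
    and W: "K1 \<subseteq> W" "K2 \<subseteq> W"
    and comm: "\<And>c. Poly_Mapping.keys c \<subseteq> W \<Longrightarrow> h (f c) = f' (h c)"
  shows "mv_hom (constrained_cx e f t m) K1 K2 (constrained_cx e f' t m') L1 L2 h"
  unfolding mv_hom_def
  by (intro conjI constrained_cx_hom[of W] graded_op_Int graded_op_Un[of _ _ _ _ _ _ W] comm h)
    (use W in auto)

lemma constrained_mv_pair:
  assumes f: "linear_on W f" "graded_op (e * (2 * int t + 1)) K1 K1 f"
      "graded_op (e * (2 * int t + 1)) K2 K2 f"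
    and W: "K1 \<subseteq> W" "K2 \<subseteq> W"
    and sq: "\<And>c. Poly_Mapping.keys c \<subseteq> W \<Longrightarrow> f (f c) = 0"
  shows "mv_pair (constrained_cx e f t m) K1 K2"
proof -
  have i: "cx_hom (constrained_cx e f t m K) (constrained_cx e f t m L) id" if "K \<subseteq> L" "K \<subseteq> W" for K L
    by (rule constrained_cx_hom[of W]) (use that in \<open>auto simp: linear_on_id graded_op_id\<close>)
  have free: "free_cx (constrained_cx e f t m K)"
    if "K \<subseteq> W" "graded_op (e * (2 * int t + 1)) K K f" for K
    using f(1) that(2,1) sq by (rule constrained_free_cx)
  show ?thesis
    unfolding mv_pair_def
  proof (intro conjI allI ballI i free f graded_op_Int graded_op_Un[of _ _ _ _ _ _ W] W)
    fix n
    show "carrier (cx_term (constrained_cx e f t m K1) n) \<inter> carrier (cx_term (constrained_cx e f t m K2) n)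
      \<subseteq> carrier (cx_term (constrained_cx e f t m (K1 \<inter> K2)) n)"
      by (auto simp: constrained_cx_simps)
    fix x assume x: "x \<in> carrier (cx_term (constrained_cx e f t m (K1 \<union> K2)) n)"
    then have "Poly_Mapping.keys x \<subseteq> K1 \<union> K2" by (auto simp: constrained_cx_simps split: if_splits)
    then obtain y z where yz: "Poly_Mapping.keys y \<subseteq> Poly_Mapping.keys x \<inter> K1" "Poly_Mapping.keys z \<subseteq> Poly_Mapping.keys x \<inter> K2" "x = y + z"
      using chains_Un[of x K1 K2] by blast
    then show "\<exists>y\<in>carrier (cx_term (constrained_cx e f t m K1) n).
        \<exists>z\<in>carrier (cx_term (constrained_cx e f t m K2) n). x = y - z"
      using x by (intro bexI[of _ y] bexI[of _ "- z"])
        (auto simp: constrained_cx_simps intro!: keys_minus_sub split: if_splits)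
  qed (use W in auto)
qed

section \<open>Exterior algebras acting on chains\<close>

definition tmul :: "('v list \<Rightarrow>\<^sub>0 'r) \<Rightarrow> ('v list \<Rightarrow>\<^sub>0 'r) \<Rightarrow> ('v list \<Rightarrow>\<^sub>0 'r::comm_ring_1)"
  where "tmul p q = lin_ext (\<lambda>u. lin_ext (\<lambda>w. Poly_Mapping.single (u @ w) 1) q) p"

lemma tensor_alg_simps [simp]:
  "carrier (tensor_alg V) = {p. Poly_Mapping.keys p \<subseteq> lists V}"
  "\<zero>\<^bsub>tensor_alg V\<^esub> = 0" "\<one>\<^bsub>tensor_alg V\<^esub> = Poly_Mapping.single [] 1"
  "add (tensor_alg V) = (+)" "monoid.mult (tensor_alg V) = tmul"
  by (simp_all add: tensor_alg_def tmul_def fun_eq_iff)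

lemma keys_tmul:
  assumes "\<And>u w. u \<in> Poly_Mapping.keys p \<Longrightarrow> w \<in> Poly_Mapping.keys q \<Longrightarrow> u @ w \<in> S"
  shows "Poly_Mapping.keys (tmul p q) \<subseteq> S"
  unfolding tmul_def using assms by (intro keys_lin_ext) auto

lemma keys_tmul_lists:
  "Poly_Mapping.keys p \<subseteq> lists V \<Longrightarrow> Poly_Mapping.keys q \<subseteq> lists V \<Longrightarrow>
    Poly_Mapping.keys (tmul p q) \<subseteq> lists V"
  by (rule keys_tmul) (auto dest!: subsetD)

lemma tmul_assoc: "tmul (tmul p q) r = tmul p (tmul q r)"
  unfolding tmul_def by (simp add: lin_ext_lin_ext)

lemma tensor_alg_ring: "ring (tensor_alg V :: ('v list \<Rightarrow>\<^sub>0 'r::comm_ring_1) ring)"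
proof (rule ringI)
  show "abelian_group (tensor_alg V :: ('v list \<Rightarrow>\<^sub>0 'r) ring)"
  proof (rule abelian_groupI)
    fix p :: "'v list \<Rightarrow>\<^sub>0 'r" assume "p \<in> carrier (tensor_alg V)"
    then show "\<exists>q\<in>carrier (tensor_alg V). q \<oplus>\<^bsub>tensor_alg V\<^esub> p = \<zero>\<^bsub>tensor_alg V\<^esub>"
      by (intro bexI[of _ "- p"]) (simp_all add: keys_minus_sub)
  qed (simp_all add: keys_add_sub add_ac)
  show "Group.monoid (tensor_alg V :: ('v list \<Rightarrow>\<^sub>0 'r) ring)"
  proof (rule monoidI)
    show "p \<otimes>\<^bsub>tensor_alg V\<^esub> q \<in> carrier (tensor_alg V)"
      if "p \<in> carrier (tensor_alg V)" "q \<in> carrier (tensor_alg V)" for p q :: "'v list \<Rightarrow>\<^sub>0 'r"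
      using that by (simp add: keys_tmul_lists)
    show "\<one>\<^bsub>tensor_alg V\<^esub> \<otimes>\<^bsub>tensor_alg V\<^esub> p = p" for p :: "'v list \<Rightarrow>\<^sub>0 'r"
      by (simp add: tmul_def lin_ext_basis)
    show "p \<otimes>\<^bsub>tensor_alg V\<^esub> \<one>\<^bsub>tensor_alg V\<^esub> = p" for p :: "'v list \<Rightarrow>\<^sub>0 'r"
      by (simp add: tmul_def lin_ext_basis)
  qed (simp_all add: tmul_assoc)
qed (simp_all add: tmul_def lin_ext_add lin_ext_fun_add)

lemma ext_ideal_generators:
  "{x \<otimes>\<^bsub>tensor_alg V\<^esub> x | x. Poly_Mapping.keys x \<subseteq> (\<lambda>v. [v]) ` V} \<subseteq> carrier (tensor_alg V)"
proof clarify
  fix x :: "'a list \<Rightarrow>\<^sub>0 'b" assume "Poly_Mapping.keys x \<subseteq> (\<lambda>v. [v]) ` V"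
  then have "Poly_Mapping.keys x \<subseteq> lists V" by auto
  then show "x \<otimes>\<^bsub>tensor_alg V\<^esub> x \<in> carrier (tensor_alg V)" by (simp add: keys_tmul_lists)
qed

lemma ext_ideal_ideal: "ideal (ext_ideal V) (tensor_alg V)"
  unfolding ext_ideal_def by (rule ring.genideal_ideal[OF tensor_alg_ring ext_ideal_generators])

lemma square_ext_ideal:
  "Poly_Mapping.keys x \<subseteq> (\<lambda>v. [v]) ` V \<Longrightarrow> tmul x x \<in> ext_ideal V"
  unfolding ext_ideal_def
  by (rule subsetD[OF ring.genideal_self[OF tensor_alg_ring ext_ideal_generators]]) auto

lemma ext_ideal_closed:
  "p \<in> ext_ideal V \<Longrightarrow> q \<in> ext_ideal V \<Longrightarrow> p + q \<in> ext_ideal V"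
  "0 \<in> ext_ideal V"
  "p \<in> ext_ideal V \<Longrightarrow> Poly_Mapping.keys q \<subseteq> lists V \<Longrightarrow> tmul p q \<in> ext_ideal V"
  "p \<in> ext_ideal V \<Longrightarrow> Poly_Mapping.keys q \<subseteq> lists V \<Longrightarrow> tmul q p \<in> ext_ideal V"
  using ideal.I_r_closed[OF ext_ideal_ideal[of V], of p q] ideal.I_l_closed[OF ext_ideal_ideal[of V], of p q]
    additive_subgroup.a_closed[OF ideal.axioms(1)[OF ext_ideal_ideal[of V]], of p q]
    additive_subgroup.zero_closed[OF ideal.axioms(1)[OF ext_ideal_ideal[of V]]] by simp_all

text \<open>
  This is the way to show that all relations of the exterior algebra have a property: it suffices that the
  squares of elements of degree \<open>1\<close> have it and that it passes to sums and multiples.  Negatives come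
  for free as multiples by the scalar \<open>-1\<close>.
\<close>

lemma ext_ideal_least:
  fixes A :: "('v list \<Rightarrow>\<^sub>0 'r::comm_ring_1) set"
  assumes sub: "A \<subseteq> {p. Poly_Mapping.keys p \<subseteq> lists V}" and zero: "0 \<in> A"
    and add: "\<And>p q. p \<in> A \<Longrightarrow> q \<in> A \<Longrightarrow> p + q \<in> A"
    and mult: "\<And>p x. p \<in> A \<Longrightarrow> Poly_Mapping.keys x \<subseteq> lists V \<Longrightarrow> tmul x p \<in> A"
      "\<And>p x. p \<in> A \<Longrightarrow> Poly_Mapping.keys x \<subseteq> lists V \<Longrightarrow> tmul p x \<in> A"
    and square: "\<And>x. Poly_Mapping.keys x \<subseteq> (\<lambda>v. [v]) ` V \<Longrightarrow> tmul x x \<in> A"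
  shows "ext_ideal V \<subseteq> A"
proof -
  interpret T: ring "tensor_alg V :: ('v list \<Rightarrow>\<^sub>0 'r) ring" by (rule tensor_alg_ring)
  have "ideal A (tensor_alg V)"
  proof (rule idealI[OF tensor_alg_ring])
    show "subgroup A (add_monoid (tensor_alg V))"
    proof
      fix p assume p: "p \<in> A"
      have "tmul (Poly_Mapping.single [] (-1)) p = - p"
        by (simp add: tmul_def lin_ext_basis single_uminus lin_ext_uminus)
      then have "- p \<in> A" using mult(1)[OF p, of "Poly_Mapping.single [] (-1)"] by simp
      moreover from this have "\<ominus>\<^bsub>tensor_alg V\<^esub> p = - p"
        using p sub T.minus_equality[of "- p" p] by auto
      ultimately show "inv\<^bsub>add_monoid (tensor_alg V)\<^esub> p \<in> A" by (simp add: a_inv_def)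
    qed (use sub zero add in auto)
  qed (simp_all add: mult)
  then show ?thesis
    unfolding ext_ideal_def by (rule T.genideal_minimal) (auto simp: square)
qed

definition word_act ::
  "('v \<Rightarrow> 'v set \<Rightarrow> ('v set \<Rightarrow>\<^sub>0 'r)) \<Rightarrow> 'v list \<Rightarrow> ('v set \<Rightarrow>\<^sub>0 'r) \<Rightarrow> ('v set \<Rightarrow>\<^sub>0 'r::comm_ring_1)"
  where "word_act g w = foldr (\<lambda>v. lin_ext (g v)) w"

lemma word_act_simps [simp]:
  "word_act g [] x = x" "word_act g (v # w) x = lin_ext (g v) (word_act g w x)"
  "word_act g (u @ w) x = word_act g u (word_act g w x)"
  by (simp_all add: word_act_def)

lemma tensor_act_word: "tensor_act g p x = lin_ext (\<lambda>w. word_act g w x) p"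
  by (simp add: tensor_act_def word_act_def)

lemma word_act_linear:
  "word_act g w (x + y) = word_act g w x + word_act g w y"
  "word_act g w (scale r x) = scale r (word_act g w x)"
  by (induction w) (simp_all add: lin_ext_add lin_ext_scale)

lemma word_act_0 [simp]: "word_act g w 0 = 0"
  using word_act_linear(2)[of g w 0 0] by simp

lemma word_act_lin_ext: "word_act g w (lin_ext f p) = lin_ext (\<lambda>k. word_act g w (f k)) p"
proof -
  have "word_act g w (sum h A) = (\<Sum>k\<in>A. word_act g w (h k))" for h :: "'c \<Rightarrow> 'a set \<Rightarrow>\<^sub>0 'b" and A
    by (induction A rule: infinite_finite_induct) (simp_all add: word_act_linear)
  then show ?thesis by (simp add: lin_ext_def word_act_linear)
qed

lemma tensor_act_linear:
  "tensor_act g p (x + y) = tensor_act g p x + tensor_act g p y"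
  "tensor_act g p (scale r x) = scale r (tensor_act g p x)"
  "tensor_act g (p + q) x = tensor_act g p x + tensor_act g q x"
  by (simp_all add: tensor_act_word word_act_linear lin_ext_fun_add lin_ext_fun_scale lin_ext_add)

lemma tensor_act_0 [simp]: "tensor_act g 0 x = 0" "tensor_act g p 0 = 0"
  by (simp_all add: tensor_act_word)

lemma tensor_act_tmul: "tensor_act g (tmul p q) x = tensor_act g p (tensor_act g q x)"
  by (simp add: tensor_act_word tmul_def lin_ext_lin_ext word_act_lin_ext)

text \<open>
  The integer \<open>e\<close> is the change in the number of vertices: \<open>-1\<close> for \<open>\<partial>/\<partial>v\<close> and \<open>1\<close> for \<open>dv\<close>.
\<close>

definition closed_under ::
  "'v set \<Rightarrow> int \<Rightarrow> ('v \<Rightarrow> 'v set \<Rightarrow> ('v set \<Rightarrow>\<^sub>0 'r::comm_ring_1)) \<Rightarrow> 'v set set \<Rightarrow> bool"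
  where "closed_under V e g K \<longleftrightarrow> (\<forall>v\<in>V. \<forall>\<sigma>\<in>K.
    Poly_Mapping.keys (g v \<sigma>) \<subseteq> {\<tau> \<in> K. int (card \<tau>) = int (card \<sigma>) + e})"

definition homogeneous :: "'v set \<Rightarrow> nat \<Rightarrow> ('v list \<Rightarrow>\<^sub>0 'r::comm_ring_1) set"
  where "homogeneous V k = {p. Poly_Mapping.keys p \<subseteq> {w \<in> lists V. length w = k}}"

lemma homogeneous_carrier: "p \<in> homogeneous V k \<Longrightarrow> Poly_Mapping.keys p \<subseteq> lists V"
  by (auto simp: homogeneous_def)

lemma word_act_graded:
  fixes g :: "'v \<Rightarrow> 'v set \<Rightarrow> ('v set \<Rightarrow>\<^sub>0 'r::comm_ring_1)"
  assumes "closed_under V e g K" "w \<in> lists V"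
  shows "graded_op (e * int (length w)) K K (word_act g w)"
  unfolding graded_op_def
proof (intro allI impI)
  fix k and c :: "'v set \<Rightarrow>\<^sub>0 'r" assume c: "Poly_Mapping.keys c \<subseteq> {\<sigma> \<in> K. int (card \<sigma>) = k + 1}"
  show "Poly_Mapping.keys (word_act g w c) \<subseteq> {\<sigma> \<in> K. int (card \<sigma>) = k + e * int (length w) + 1}"
    using assms(2)
  proof (induction w)
    case Nil
    then show ?case using c by simp
  next
    case (Cons v w)
    have IH: "Poly_Mapping.keys (word_act g w c) \<subseteq> {\<sigma> \<in> K. int (card \<sigma>) = k + e * int (length w) + 1}"
      using Cons by auto
    show ?case unfolding word_act_simps
    proof (rule keys_lin_ext)
      fix \<sigma> assume "\<sigma> \<in> Poly_Mapping.keys (word_act g w c)"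
      then have "\<sigma> \<in> K" "int (card \<sigma>) = k + e * int (length w) + 1" using IH by auto
      moreover have "v \<in> V" using Cons by simp
      ultimately show "Poly_Mapping.keys (g v \<sigma>) \<subseteq>
          {\<sigma> \<in> K. int (card \<sigma>) = k + e * int (length (v # w)) + 1}"
        using assms(1) unfolding closed_under_def by (fastforce simp: algebra_simps)
    qed
  qed
qed

lemma tensor_act_graded:
  fixes g :: "'v \<Rightarrow> 'v set \<Rightarrow> ('v set \<Rightarrow>\<^sub>0 'r::comm_ring_1)"
  assumes "closed_under V e g K" "p \<in> homogeneous V k"
  shows "graded_op (e * int k) K K (tensor_act g p)"
  unfolding graded_op_def tensor_act_word
proof (intro allI impI keys_lin_ext)
  fix j w and c :: "'v set \<Rightarrow>\<^sub>0 'r" assume "Poly_Mapping.keys c \<subseteq> {\<sigma> \<in> K. int (card \<sigma>) = j + 1}" "w \<in> Poly_Mapping.keys p"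
  moreover from this have "w \<in> lists V" "length w = k" using assms(2) by (auto simp: homogeneous_def)
  ultimately show "Poly_Mapping.keys (word_act g w c) \<subseteq> {\<sigma> \<in> K. int (card \<sigma>) = j + e * int k + 1}"
    using graded_opD[OF word_act_graded[OF assms(1)]] by blast
qed

lemma word_act_closed:
  assumes "closed_under V e g K" "w \<in> lists V" "Poly_Mapping.keys c \<subseteq> K"
  shows "Poly_Mapping.keys (word_act g w c) \<subseteq> K"
  using assms(2)
proof (induction w)
  case Nil
  then show ?case using assms(3) by simp
next
  case (Cons v w)
  then have "Poly_Mapping.keys (word_act g w c) \<subseteq> K" "v \<in> V" by auto
  then show ?case unfolding word_act_simps
    using assms(1) by (intro keys_lin_ext) (auto simp: closed_under_def)
qed

lemma tensor_act_closed:
  assumes "closed_under V e g K" "Poly_Mapping.keys p \<subseteq> lists V" "Poly_Mapping.keys c \<subseteq> K"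
  shows "Poly_Mapping.keys (tensor_act g p c) \<subseteq> K"
  unfolding tensor_act_word using assms by (intro keys_lin_ext word_act_closed) auto

text \<open>
  The common features of the two families of operators \<open>\<partial>/\<partial>v\<close> and \<open>dv\<close> from which everything about the
  action of the exterior algebra follows.  Anticommutation is demanded on basis elements only.
\<close>

locale anticommuting_action =
  fixes V :: "'v set" and e :: int and g :: "'v \<Rightarrow> 'v set \<Rightarrow> ('v set \<Rightarrow>\<^sub>0 'r::comm_ring_1)"
  assumes two: "(2::'r) dvd 1"
    and closed: "closed_under V e g (simplices V)"
    and anti: "\<And>u v \<sigma>. u \<in> V \<Longrightarrow> v \<in> V \<Longrightarrow> \<sigma> \<in> simplices V \<Longrightarrow>
      lin_ext (g u) (g v \<sigma>) = - lin_ext (g v) (g u \<sigma>)"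
begin

lemma letters_anticommute:
  assumes "u \<in> V" "v \<in> V" "Poly_Mapping.keys c \<subseteq> simplices V"
  shows "lin_ext (g u) (lin_ext (g v) c) = - lin_ext (g v) (lin_ext (g u) c)"
proof -
  have "lin_ext (\<lambda>\<sigma>. lin_ext (g u) (g v \<sigma>)) c = lin_ext (\<lambda>\<sigma>. - lin_ext (g v) (g u \<sigma>)) c"
    by (rule lin_ext_cong, rule anti) (use assms in auto)
  then show ?thesis by (simp add: lin_ext_lin_ext lin_ext_fun_uminus)
qed

lemma letter_word_commute:
  assumes "u \<in> V" "w \<in> lists V" "Poly_Mapping.keys c \<subseteq> simplices V"
  shows "lin_ext (g u) (word_act g w c) = scale ((-1) ^ length w) (word_act g w (lin_ext (g u) c))"
  using assms(2)
proof (induction w)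
  case (Cons v w)
  then have "lin_ext (g u) (word_act g (v # w) c) = - lin_ext (g v) (lin_ext (g u) (word_act g w c))"
    using letters_anticommute[OF assms(1) _ word_act_closed[OF closed _ assms(3)], of v w] by simp
  then show ?case using Cons by (simp add: lin_ext_scale scale_uminus)
qed simp

text \<open>
  Moving \<open>u\<close> past \<open>w\<close> exchanges each letter of \<open>u\<close> with each letter of \<open>w\<close>.
\<close>

lemma words_commute:
  assumes "u \<in> lists V" "w \<in> lists V" "Poly_Mapping.keys c \<subseteq> simplices V"
  shows "word_act g u (word_act g w c) =
    scale ((-1) ^ (length u * length w)) (word_act g w (word_act g u c))"
  using assms(1)
proof (induction u)
  case (Cons v u)
  then have "lin_ext (g v) (word_act g w (word_act g u c)) =
      scale ((-1) ^ length w) (word_act g w (lin_ext (g v) (word_act g u c)))"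
    using letter_word_commute[OF _ assms(2) word_act_closed[OF closed _ assms(3)], of v u] by simp
  then show ?case using Cons by (simp add: lin_ext_scale power_add mult.commute)
qed simp

lemma tensor_act_commute:
  assumes "p \<in> homogeneous V k" "q \<in> homogeneous V l" "Poly_Mapping.keys c \<subseteq> simplices V"
  shows "tensor_act g p (tensor_act g q c) = scale ((-1) ^ (k * l)) (tensor_act g q (tensor_act g p c))"
proof -
  have "tensor_act g p (tensor_act g q c) =
      lin_ext (\<lambda>u. lin_ext (\<lambda>w. word_act g u (word_act g w c)) q) p"
    by (simp add: tensor_act_word word_act_lin_ext)
  also have "\<dots> = lin_ext (\<lambda>u. lin_ext (\<lambda>w. scale ((-1) ^ (k * l)) (word_act g w (word_act g u c))) q) p"
    using assms by (intro lin_ext_cong, subst words_commute) (auto simp: homogeneous_def subset_iff)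
  also have "\<dots> = scale ((-1) ^ (k * l)) (tensor_act g q (tensor_act g p c))"
    by (simp add: lin_ext_fun_scale lin_ext_swap[of _ q p] tensor_act_word word_act_lin_ext)
  finally show ?thesis .
qed

text \<open>
  An odd element anticommutes with itself, so twice its square is \<open>0\<close>; here \<open>2\<close> has to be invertible.
\<close>

lemma tensor_act_odd_square:
  assumes p: "p \<in> homogeneous V k" "odd k" and c: "Poly_Mapping.keys c \<subseteq> simplices V"
  shows "tensor_act g p (tensor_act g p c) = 0"
proof -
  let ?x = "tensor_act g p (tensor_act g p c)"
  have "?x = - ?x" using tensor_act_commute[OF p(1) p(1) c] p(2) by (simp add: uminus_power_if)
  then have "scale 2 ?x = 0"
    using scale_add(2)[of 1 1 ?x] by (simp add: eq_neg_iff_add_eq_0)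
  moreover obtain h where "1 = 2 * (h :: 'r)" using two by (auto simp: dvd_def)
  ultimately show ?thesis
    by (metis scale_scale scale_simps(2,3) mult.commute)
qed

text \<open>
  The generating relations are squares of elements of the odd degree \<open>1\<close>, and the elements that act as \<open>0\<close> on
  the chains of simplices form an ideal, as these chains are preserved by the action.
\<close>

lemma ext_ideal_annihilates:
  assumes "p \<in> ext_ideal V" "Poly_Mapping.keys c \<subseteq> simplices V"
  shows "tensor_act g p c = 0"
proof -
  let ?A = "{p. Poly_Mapping.keys p \<subseteq> lists V \<and>
    (\<forall>c. Poly_Mapping.keys c \<subseteq> simplices V \<longrightarrow> tensor_act g p c = 0)}"
  have "ext_ideal V \<subseteq> ?A"
  proof (rule ext_ideal_least)
    fix p x :: "'v list \<Rightarrow>\<^sub>0 'r" assume "p \<in> ?A" "Poly_Mapping.keys x \<subseteq> lists V"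
    then show "tmul x p \<in> ?A" "tmul p x \<in> ?A"
      using tensor_act_closed[OF closed, of x] by (simp_all add: tensor_act_tmul keys_tmul_lists)
  next
    fix x :: "'v list \<Rightarrow>\<^sub>0 'r" assume "Poly_Mapping.keys x \<subseteq> (\<lambda>v. [v]) ` V"
    then have "x \<in> homogeneous V 1" by (auto simp: homogeneous_def)
    then show "tmul x x \<in> ?A"
      using tensor_act_odd_square[of x 1] homogeneous_carrier[of x V 1]
      by (simp add: tensor_act_tmul keys_tmul_lists)
  qed (auto simp: tensor_act_linear dest!: keys_add[THEN subsetD])
  then show ?thesis using assms by auto
qed

text \<open>
  All representatives of a class differ by elements acting as \<open>0\<close>, so the set of their values is a
  singleton.
\<close>

lemma ext_act_class:
  assumes "Poly_Mapping.keys c \<subseteq> simplices V"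
  shows "ext_act g (ext_ideal V +>\<^bsub>tensor_alg V\<^esub> p) c = tensor_act g p c"
proof -
  have "(\<lambda>p. tensor_act g p c) ` (ext_ideal V +>\<^bsub>tensor_alg V\<^esub> p) = {tensor_act g p c}"
    using assms ext_ideal_closed(2)[of V]
    by (auto simp: a_r_coset_def' tensor_act_linear ext_ideal_annihilates image_iff)
  then show ?thesis by (simp add: ext_act_def)
qed

end

lemma ext_degE:
  assumes "\<xi> \<in> ext_deg V k"
  obtains p where "p \<in> homogeneous V k" "\<xi> = ext_ideal V +>\<^bsub>tensor_alg V\<^esub> p"
  using assms by (auto simp: ext_deg_def homogeneous_def)

lemma wedge_class:
  assumes "p \<in> homogeneous V k" "q \<in> homogeneous V l"
  shows "wedge V (ext_ideal V +>\<^bsub>tensor_alg V\<^esub> p) (ext_ideal V +>\<^bsub>tensor_alg V\<^esub> q) =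
    ext_ideal V +>\<^bsub>tensor_alg V\<^esub> tmul p q"
  using ideal.rcoset_mult_add[OF ext_ideal_ideal, of p V q] assms[THEN homogeneous_carrier]
  by (simp add: ext_alg_def FactRing_def)

lemma tmul_homogeneous:
  "p \<in> homogeneous V k \<Longrightarrow> q \<in> homogeneous V l \<Longrightarrow> tmul p q \<in> homogeneous V (k + l)"
  unfolding homogeneous_def mem_Collect_eq by (rule keys_tmul) (auto dest!: subsetD)

lemma wedge_ext_deg:
  assumes "\<xi> \<in> ext_deg V k" "\<eta> \<in> ext_deg V l" shows "wedge V \<xi> \<eta> \<in> ext_deg V (k + l)"
proof -
  obtain p q where p: "p \<in> homogeneous V k" "\<xi> = ext_ideal V +>\<^bsub>tensor_alg V\<^esub> p"
    and q: "q \<in> homogeneous V l" "\<eta> = ext_ideal V +>\<^bsub>tensor_alg V\<^esub> q"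
    using assms by (auto elim!: ext_degE)
  then show ?thesis
    using tmul_homogeneous[OF p(1) q(1)] by (auto simp: wedge_class ext_deg_def homogeneous_def)
qed

context anticommuting_action begin

lemma ext_act_linear: "\<xi> \<in> ext_deg V k \<Longrightarrow> linear_on (simplices V) (ext_act g \<xi>)"
  by (auto simp: linear_on_def ext_act_class tensor_act_linear keys_add_sub keys_scale_sub elim!: ext_degE)

lemma ext_act_graded:
  assumes "\<xi> \<in> ext_deg V k" "closed_under V e g K" "K \<subseteq> simplices V"
  shows "graded_op (e * int k) K K (ext_act g \<xi>)"
proof -
  obtain p where p: "p \<in> homogeneous V k" "\<xi> = ext_ideal V +>\<^bsub>tensor_alg V\<^esub> p" using assms(1) by (rule ext_degE)
  have "ext_act g \<xi> c = tensor_act g p c" if "Poly_Mapping.keys c \<subseteq> {\<sigma> \<in> K. P \<sigma>}" for P c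
    unfolding p(2) by (rule ext_act_class) (use that assms(3) in auto)
  then show ?thesis
    using tensor_act_graded[OF assms(2) p(1)] by (simp add: graded_op_def)
qed

lemma ext_act_closed:
  assumes "\<xi> \<in> ext_deg V k" "Poly_Mapping.keys c \<subseteq> simplices V"
  shows "Poly_Mapping.keys (ext_act g \<xi> c) \<subseteq> simplices V"
proof -
  obtain p where p: "p \<in> homogeneous V k" "\<xi> = ext_ideal V +>\<^bsub>tensor_alg V\<^esub> p" using assms(1) by (rule ext_degE)
  then show ?thesis
    using tensor_act_closed[OF closed homogeneous_carrier[OF p(1)] assms(2)] assms(2)
    by (simp add: ext_act_class)
qed

lemma ext_act_commute:
  assumes "\<xi> \<in> ext_deg V k" "\<eta> \<in> ext_deg V l" "even k \<or> even l" "Poly_Mapping.keys c \<subseteq> simplices V"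
  shows "ext_act g \<xi> (ext_act g \<eta> c) = ext_act g \<eta> (ext_act g \<xi> c)"
proof -
  obtain p q where p: "p \<in> homogeneous V k" "\<xi> = ext_ideal V +>\<^bsub>tensor_alg V\<^esub> p"
    and q: "q \<in> homogeneous V l" "\<eta> = ext_ideal V +>\<^bsub>tensor_alg V\<^esub> q"
    using assms(1,2) by (auto elim!: ext_degE)
  have "(-1 :: 'r) ^ (k * l) = 1" using assms(3) by auto
  then show ?thesis
    using tensor_act_commute[OF p(1) q(1) assms(4)] assms(4)
      ext_act_closed[OF assms(1,4)] ext_act_closed[OF assms(2,4)]
    unfolding p(2) q(2) by (simp add: ext_act_class)
qed

lemma ext_act_odd_square:
  assumes "\<xi> \<in> ext_deg V k" "odd k" "Poly_Mapping.keys c \<subseteq> simplices V"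
  shows "ext_act g \<xi> (ext_act g \<xi> c) = 0"
  using assms ext_act_closed[OF assms(1,3)] by (auto elim!: ext_degE simp: ext_act_class tensor_act_odd_square)

lemma ext_act_wedge:
  assumes "\<xi> \<in> ext_deg V k" "\<eta> \<in> ext_deg V l" "Poly_Mapping.keys c \<subseteq> simplices V"
  shows "ext_act g (wedge V \<xi> \<eta>) c = ext_act g \<xi> (ext_act g \<eta> c)"
  using assms ext_act_closed[OF assms(2,3)]
  by (auto elim!: ext_degE simp: wedge_class ext_act_class tensor_act_tmul)

end

section \<open>The operators of deleting and inserting a vertex\<close>

definition preceding :: "'v::linorder \<Rightarrow> 'v set \<Rightarrow> nat"
  where "preceding v \<sigma> = card {u \<in> \<sigma>. u < v}"

lemma preceding_insert:
  assumes "finite \<sigma>" "u \<notin> \<sigma>"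
  shows "preceding v (insert u \<sigma>) = preceding v \<sigma> + (if u < v then 1 else 0)"
proof -
  have "{w \<in> insert u \<sigma>. w < v} = (if u < v then insert u {w \<in> \<sigma>. w < v} else {w \<in> \<sigma>. w < v})" by auto
  then show ?thesis using assms by (simp add: preceding_def)
qed

lemma preceding_remove:
  assumes "finite \<sigma>" "u \<in> \<sigma>"
  shows "preceding v \<sigma> = preceding v (\<sigma> - {u}) + (if u < v then 1 else 0)"
  using preceding_insert[of "\<sigma> - {u}" u v] assms by (simp add: insert_absorb)

lemma partial_op_eq: "partial_op v \<sigma> =
    (if v \<in> \<sigma> \<and> 2 \<le> card \<sigma> then Poly_Mapping.single (\<sigma> - {v}) ((-1) ^ preceding v \<sigma>) else 0)"
  by (simp add: partial_op_def preceding_def)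

lemma d_op_eq: "d_op v \<sigma> =
    (if v \<in> \<sigma> then 0 else Poly_Mapping.single (insert v \<sigma>) ((-1) ^ preceding v \<sigma>))"
  by (simp add: d_op_def preceding_def)

text \<open>
  Of two vertices, deleting the smaller one first lowers the position of the larger one by one, whereas
  deleting the larger one first does not affect the position of the smaller one.  On edges both composites
  vanish, since the last vertex is never deleted.
\<close>

lemma partial_op_anticommute:
  assumes "finite \<sigma>"
  shows "lin_ext (partial_op u) (partial_op v \<sigma>) =
    - lin_ext (partial_op v) (partial_op u \<sigma> :: 'v::linorder set \<Rightarrow>\<^sub>0 'r::comm_ring_1)"
proof (cases "u \<noteq> v \<and> u \<in> \<sigma> \<and> v \<in> \<sigma> \<and> 3 \<le> card \<sigma>")
  case True
  then have "preceding v \<sigma> + preceding u (\<sigma> - {v}) + 1 = preceding u \<sigma> + preceding v (\<sigma> - {u}) \<or>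
      preceding v \<sigma> + preceding u (\<sigma> - {v}) = preceding u \<sigma> + preceding v (\<sigma> - {u}) + 1"
    using assms preceding_remove[of \<sigma> u v] preceding_remove[of \<sigma> v u] by (auto split: if_splits)
  then have "(-1 :: 'r) ^ (preceding v \<sigma> + preceding u (\<sigma> - {v})) =
      - ((-1) ^ (preceding u \<sigma> + preceding v (\<sigma> - {u})))"
    by (metis (no_types, opaque_lifting) add.commute power_Suc mult_minus1 plus_1_eq_Suc minus_minus)
  moreover have "\<sigma> - {v} - {u} = \<sigma> - {u} - {v}" "v \<noteq> u" using True by auto
  ultimately show ?thesis
    using True assms by (simp add: partial_op_eq power_add single_uminus[symmetric])
next
  case False
  then show ?thesis using assms
    by (cases "u = v") (auto simp: partial_op_eq card_Diff_singleton_if)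
qed

text \<open>
  As for deletions: inserting the smaller of two vertices first raises the position of the larger one.
\<close>

lemma d_op_anticommute:
  assumes "finite \<sigma>"
  shows "lin_ext (d_op u) (d_op v \<sigma>) =
    - lin_ext (d_op v) (d_op u \<sigma> :: 'v::linorder set \<Rightarrow>\<^sub>0 'r::comm_ring_1)"
proof (cases "u \<noteq> v \<and> u \<notin> \<sigma> \<and> v \<notin> \<sigma>")
  case True
  then have "preceding v \<sigma> + preceding u (insert v \<sigma>) + 1 = preceding u \<sigma> + preceding v (insert u \<sigma>) \<or>
      preceding v \<sigma> + preceding u (insert v \<sigma>) = preceding u \<sigma> + preceding v (insert u \<sigma>) + 1"
    using assms preceding_insert[of \<sigma> u v] preceding_insert[of \<sigma> v u] by (auto split: if_splits)
  then have "(-1 :: 'r) ^ (preceding v \<sigma> + preceding u (insert v \<sigma>)) =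
      - ((-1) ^ (preceding u \<sigma> + preceding v (insert u \<sigma>)))"
    by (metis (no_types, opaque_lifting) add.commute power_Suc mult_minus1 plus_1_eq_Suc minus_minus)
  moreover have "insert u (insert v \<sigma>) = insert v (insert u \<sigma>)" "v \<noteq> u" using True by auto
  ultimately show ?thesis
    using True assms by (simp add: d_op_eq power_add single_uminus[symmetric])
next
  case False
  then show ?thesis using assms
    by (cases "u = v") (auto simp: d_op_eq)
qed

lemma partial_op_closed:
  assumes "K \<subseteq> simplices V" "\<And>\<sigma> \<tau>. \<sigma> \<in> K \<Longrightarrow> \<tau> \<noteq> {} \<Longrightarrow> \<tau> \<subseteq> \<sigma> \<Longrightarrow> \<tau> \<in> K"
  shows "closed_under V (-1) partial_op K"
  unfolding closed_under_def
proof (intro ballI)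
  fix v \<sigma> assume "v \<in> V" and \<sigma>: "\<sigma> \<in> K"
  have fin: "finite \<sigma>" using \<sigma> assms(1) by (auto simp: simplices_def)
  show "Poly_Mapping.keys (partial_op v \<sigma> :: 'a set \<Rightarrow>\<^sub>0 'b) \<subseteq> {\<tau> \<in> K. int (card \<tau>) = int (card \<sigma>) + -1}"
  proof (cases "v \<in> \<sigma> \<and> 2 \<le> card \<sigma>")
    case True
    then have c: "card (\<sigma> - {v}) = card \<sigma> - 1" by simp
    then have "card (\<sigma> - {v}) \<noteq> 0" using True by linarith
    then have "\<sigma> - {v} \<noteq> {}" by (rule contrapos_nn) (simp only: card.empty)
    then have "\<sigma> - {v} \<in> K" by (intro assms(2)[OF \<sigma>]) auto
    then show ?thesis using True c by (simp add: partial_op_eq)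
  qed (auto simp: partial_op_eq)
qed

lemma d_op_closed:
  assumes "K \<subseteq> simplices V" "\<And>\<sigma> \<tau>. \<sigma> \<in> K \<Longrightarrow> \<tau> \<in> simplices V \<Longrightarrow> \<sigma> \<subseteq> \<tau> \<Longrightarrow> \<tau> \<in> K"
  shows "closed_under V 1 d_op K"
  unfolding closed_under_def
proof (intro ballI)
  fix v \<sigma> assume v: "v \<in> V" and \<sigma>: "\<sigma> \<in> K"
  have s: "finite \<sigma>" "\<sigma> \<subseteq> V" using \<sigma> assms(1) by (auto simp: simplices_def)
  have "insert v \<sigma> \<in> K" by (rule assms(2)[OF \<sigma>]) (use s v in \<open>auto simp: simplices_def\<close>)
  then show "Poly_Mapping.keys (d_op v \<sigma> :: 'a set \<Rightarrow>\<^sub>0 'b) \<subseteq> {\<tau> \<in> K. int (card \<tau>) = int (card \<sigma>) + 1}"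
    using s by (simp add: d_op_eq)
qed

lemma partial_op_action:
  assumes "(2::'r::comm_ring_1) dvd 1"
  shows "anticommuting_action V (-1) (partial_op :: 'v::linorder \<Rightarrow> 'v set \<Rightarrow> 'v set \<Rightarrow>\<^sub>0 'r)"
  by (unfold_locales; (intro assms partial_op_closed partial_op_anticommute)?)
    (auto simp: simplices_def intro: finite_subset)

lemma d_op_action:
  assumes "(2::'r::comm_ring_1) dvd 1"
  shows "anticommuting_action V 1 (d_op :: 'v::linorder \<Rightarrow> 'v set \<Rightarrow> 'v set \<Rightarrow>\<^sub>0 'r)"
  by (unfold_locales; (intro assms d_op_closed d_op_anticommute)?) (auto simp: simplices_def)

section \<open>Signs of vertex bijections\<close>

text \<open>
  For a bijection of vertices this is the sign of the sorting permutation; unlike the latter it can be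
  computed by adding one vertex at a time.
\<close>

definition inversion_sign :: "('v::linorder \<Rightarrow> 'w::linorder) \<Rightarrow> 'v set \<Rightarrow> int"
  where "inversion_sign \<phi> \<sigma> = (-1) ^ card {(u, v). u \<in> \<sigma> \<and> v \<in> \<sigma> \<and> u < v \<and> \<phi> v < \<phi> u}"

text \<open>
  Each vertex \<open>u\<close> of \<open>A\<close> may precede \<open>v\<close> and its image may precede that of \<open>v\<close>.  It forms an inversion with
  \<open>v\<close> if exactly one of the two happens.  So the number of new inversions and the sum of the positions of
  \<open>v\<close> and \<open>\<phi> v\<close> have the same parity.
\<close>

lemma inversion_sign_insert:
  assumes fin: "finite A" and v: "v \<notin> A" and inj: "inj_on \<phi> (insert v A)"
  shows "inversion_sign \<phi> (insert v A) =
    inversion_sign \<phi> A * (-1) ^ (preceding v A + preceding (\<phi> v) (\<phi> ` A))"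
proof -
  let ?I = "\<lambda>A. {(u, v). u \<in> A \<and> v \<in> A \<and> u < v \<and> \<phi> v < \<phi> u}"
  \<comment> \<open>\<open>B\<close> and \<open>C\<close> are the vertices forming an inversion with \<open>v\<close>; those in \<open>D\<close> are counted
    in both positions.\<close>
  define B where "B = {u \<in> A. u < v \<and> \<phi> v < \<phi> u}"
  define C where "C = {u \<in> A. v < u \<and> \<phi> u < \<phi> v}"
  define D where "D = {u \<in> A. u < v \<and> \<phi> u < \<phi> v}"
  have finI: "finite (?I A)" by (rule finite_subset[of _ "A \<times> A"]) (use fin in auto)
  have fins: "finite B" "finite C" "finite D" using fin by (auto simp: B_def C_def D_def)
  have ne: "u \<in> A \<Longrightarrow> u \<noteq> v \<and> \<phi> u \<noteq> \<phi> v" for u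
    using inj_onD[OF inj, of u v] v by auto
  have "?I (insert v A) = ?I A \<union> ((\<lambda>u. (u, v)) ` B \<union> Pair v ` C)"
    by (auto simp: B_def C_def)
  moreover have "?I A \<inter> ((\<lambda>u. (u, v)) ` B \<union> Pair v ` C) = {}" "(\<lambda>u. (u, v)) ` B \<inter> Pair v ` C = {}"
    using v by (auto simp: B_def C_def)
  ultimately have I: "card (?I (insert v A)) = card (?I A) + (card B + card C)"
    using finI fins by (simp add: card_Un_disjoint card_image inj_on_def)
  have tri: "(u < v \<or> v < u) \<and> (\<phi> u < \<phi> v \<or> \<phi> v < \<phi> u)" if "u \<in> A" for u
    using ne[OF that] by (simp add: neq_iff)
  have "{u \<in> A. u < v} = D \<union> B" unfolding D_def B_def using tri by blast
  moreover have "card (D \<union> B) = card D + card B"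
    by (intro card_Un_disjoint fins) (auto simp: B_def D_def)
  ultimately have p: "preceding v A = card D + card B" by (simp only: preceding_def)
  have "{u \<in> A. \<phi> u < \<phi> v} = D \<union> C" unfolding D_def C_def using tri by blast
  then have "{w \<in> \<phi> ` A. w < \<phi> v} = \<phi> ` (D \<union> C)" by blast
  moreover have "inj_on \<phi> (D \<union> C)" using inj by (rule inj_on_subset) (auto simp: D_def C_def)
  ultimately have "preceding (\<phi> v) (\<phi> ` A) = card (D \<union> C)" by (simp only: preceding_def card_image)
  moreover have "card (D \<union> C) = card D + card C"
    by (intro card_Un_disjoint fins) (auto simp: C_def D_def)
  ultimately have q: "preceding (\<phi> v) (\<phi> ` A) = card D + card C" by simp
  have "(-1::int) ^ (card D + card B + (card D + card C)) = (-1) ^ (card B + card C)"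
    by (auto simp: minus_one_power_iff)
  then show ?thesis unfolding inversion_sign_def I p q by (simp add: power_add)
qed

lemma inversion_sign_remove:
  assumes fin: "finite \<sigma>" and v: "v \<in> \<sigma>" and inj: "inj_on \<phi> \<sigma>"
  shows "inversion_sign \<phi> \<sigma> =
    inversion_sign \<phi> (\<sigma> - {v}) * (-1) ^ (preceding v \<sigma> + preceding (\<phi> v) (\<phi> ` \<sigma>))"
proof -
  have "\<phi> ` (\<sigma> - {v}) = \<phi> ` \<sigma> - {\<phi> v}" using inj v by (auto simp: inj_on_def)
  then have "preceding (\<phi> v) (\<phi> ` (\<sigma> - {v})) = preceding (\<phi> v) (\<phi> ` \<sigma>)"
    using preceding_remove[of "\<phi> ` \<sigma>" "\<phi> v" "\<phi> v"] fin v by simp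
  moreover have "preceding v (\<sigma> - {v}) = preceding v \<sigma>"
    using preceding_remove[of \<sigma> v v] fin v by simp
  ultimately show ?thesis
    using inversion_sign_insert[of "\<sigma> - {v}" v \<phi>] fin v inj by (simp add: insert_absorb)
qed

lemma inversion_sign_mono:
  assumes "\<And>u v. u \<in> A \<Longrightarrow> v \<in> A \<Longrightarrow> u < v \<Longrightarrow> \<phi> u \<le> \<phi> v"
  shows "inversion_sign \<phi> A = 1"
proof -
  have "{(u, v). u \<in> A \<and> v \<in> A \<and> u < v \<and> \<phi> v < \<phi> u} = {}" using assms by fastforce
  then show ?thesis by (simp only: inversion_sign_def card.empty power_0)
qed

text \<open>
  When a vertex \<open>v\<close> is added, the position of \<open>\<phi> v\<close> enters both factors on the right and cancels; what
  remains are the positions of \<open>v\<close> and of \<open>\<psi> (\<phi> v)\<close>, as on the left.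
\<close>

lemma inversion_sign_comp:
  assumes "finite A" "inj_on \<phi> A" "inj_on \<psi> (\<phi> ` A)"
  shows "inversion_sign (\<psi> \<circ> \<phi>) A = inversion_sign \<psi> (\<phi> ` A) * inversion_sign \<phi> A"
  using assms
proof (induction A rule: finite_induct)
  case empty
  then show ?case by (simp add: inversion_sign_def)
next
  case (insert v A)
  have v: "\<phi> v \<notin> \<phi> ` A" using insert by (auto simp: inj_on_def)
  have inj: "inj_on \<phi> A" "inj_on \<psi> (\<phi> ` A)" using insert.prems by (auto simp: inj_on_def)
  have "inversion_sign (\<psi> \<circ> \<phi>) (insert v A) = inversion_sign (\<psi> \<circ> \<phi>) A *
      (-1) ^ (preceding v A + preceding ((\<psi> \<circ> \<phi>) v) ((\<psi> \<circ> \<phi>) ` A))"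
    using insert.prems by (intro inversion_sign_insert insert.hyps comp_inj_on)
  also have "\<dots> = inversion_sign \<psi> (\<phi> ` A) * inversion_sign \<phi> A *
      (-1) ^ (preceding v A + preceding (\<psi> (\<phi> v)) (\<psi> ` \<phi> ` A))"
    by (simp only: insert.IH[OF inj] o_apply image_comp)
  also have "(-1::int) ^ (preceding v A + preceding (\<psi> (\<phi> v)) (\<psi> ` \<phi> ` A)) =
      (-1) ^ (preceding (\<phi> v) (\<phi> ` A) + preceding (\<psi> (\<phi> v)) (\<psi> ` \<phi> ` A)) *
      (-1) ^ (preceding v A + preceding (\<phi> v) (\<phi> ` A))"
    by (auto simp: minus_one_power_iff)
  finally show ?case
    using insert.hyps insert.prems v by (simp add: inversion_sign_insert)
qed

text \<open>
  All vertices other than \<open>a\<close> and \<open>b\<close> are fixed and cause no inversion among themselves.  Adding first \<open>a\<close> and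
  then \<open>b\<close>, every position with respect to the fixed vertices is counted twice; the only
  other contribution is \<open>a\<close> preceding \<open>b\<close>.
\<close>

lemma inversion_sign_transpose:
  fixes a b :: "'v::linorder"
  assumes "finite A" "a \<in> A" "b \<in> A" "a < b"
  shows "inversion_sign (Transposition.transpose a b) A = -1"
proof -
  let ?\<tau> = "Transposition.transpose a b" and ?A = "A - {a, b}"
  have A: "A - {b} - {a} = ?A" "A = insert b (insert a ?A)" using assms by auto
  have im: "?\<tau> ` ?A = ?A" by (auto simp: image_iff transpose_def)
  have im1: "?\<tau> ` insert a ?A = insert b ?A" by (simp add: im)
  have one: "inversion_sign ?\<tau> ?A = 1"
    by (rule inversion_sign_mono) (auto simp: transpose_def)
  have "inversion_sign ?\<tau> (insert b (insert a ?A)) =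
      (-1) ^ (preceding a ?A + preceding b ?A) *
      (-1) ^ (preceding b (insert a ?A) + preceding a (insert b ?A))"
    using assms(1,4) by (subst inversion_sign_insert, simp, simp, simp)
      (simp add: inversion_sign_insert one im im1)
  also have "\<dots> = -1"
    using assms(1,4) by (auto simp: preceding_insert minus_one_power_iff)
  finally show ?thesis using A(2) by simp
qed

lemma inversion_sign_permutes:
  fixes p :: "nat \<Rightarrow> nat"
  assumes "p permutes {..<n}"
  shows "inversion_sign p {..<n} = sign p"
proof -
  show ?thesis using assms finite_lessThan
  proof (induction rule: permutes_induct)
    case id
    then show ?case by (simp add: inversion_sign_mono sign_id)
  next
    case (swap a b p)
    have p: "p ` {..<n} = {..<n}" "inj_on p {..<n}" using swap by (auto simp: permutes_image permutes_inj_on)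
    have "inversion_sign (Transposition.transpose a b \<circ> p) {..<n} =
        inversion_sign (Transposition.transpose a b) {..<n} * sign p"
      using swap p by (simp add: inversion_sign_comp)
    moreover have "inversion_sign (Transposition.transpose a b) {..<n} = sign (Transposition.transpose a b)"
    proof (cases a b rule: linorder_cases)
      case less
      then show ?thesis using swap by (simp add: inversion_sign_transpose sign_swap_id)
    next
      case equal
      then show ?thesis by (simp add: inversion_sign_mono sign_id)
    next
      case greater
      then show ?thesis using swap inversion_sign_transpose[of "{..<n}" b a]
        by (simp add: transpose_commute[of a b] sign_swap_id)
    qed
    moreover have "permutation p" using swap by (auto simp: permutation_permutes)
    ultimately show ?case by (simp only: sign_compose permutation_swap_id)
  qed
qed

text \<open>
  With \<open>e\<close> the increasing enumeration of \<open>\<sigma>\<close> and \<open>p\<close> the sorting permutation, \<open>\<phi> \<circ> e \<circ> p\<close> is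
  increasing.  Hence the inversion signs of \<open>\<phi>\<close>, \<open>e\<close> (which is \<open>1\<close>) and \<open>p\<close> (which is its sign)
  multiply to \<open>1\<close>.
\<close>

lemma sort_sign_eq:
  assumes fin: "finite \<sigma>" and inj: "inj_on \<phi> \<sigma>"
  shows "sort_sign \<phi> \<sigma> = inversion_sign \<phi> \<sigma>"
proof -
  define xs where "xs = sorted_list_of_set \<sigma>"
  define n where "n = card \<sigma>"
  have xs: "length xs = n" "set xs = \<sigma>" "distinct xs" "sorted_wrt (<) xs"
    using fin by (auto simp: xs_def n_def)
  let ?ys = "map \<phi> xs"
  let ?P = "\<lambda>p. p permutes {..<n} \<and> sorted (permute_list p ?ys)"
  have dist: "distinct ?ys" using xs inj by (simp add: distinct_map)
  have "mset (sort ?ys) = mset ?ys" by simp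
  then obtain p where p: "p permutes {..<length ?ys}" "permute_list p ?ys = sort ?ys"
    by (rule mset_eq_permutation)
  have P: "?P p" using p xs(1) by simp
  \<comment> \<open>The images of the vertices are distinct, so that only one permutation sorts them.\<close>
  have uniq: "p' = p" if "?P p'" for p'
  proof -
    have p': "p' permutes {..<length ?ys}" using that xs(1) by simp
    then have "permute_list p' ?ys = sort ?ys"
      using that by (intro properties_for_sort[symmetric]) (auto simp: mset_permute_list)
    then have eq: "permute_list p' ?ys = permute_list p ?ys" using p by simp
    have "p' i = p i" for i
    proof (cases "i < n")
      case True
      then have "?ys ! p' i = ?ys ! p i"
        using eq xs(1) permute_list_nth[OF p', of i] permute_list_nth[OF p(1), of i] by simp
      moreover have "p' i < n" "p i < n"
        using True p p' xs(1) permutes_in_image[of p' "{..<n}" i] permutes_in_image[of p "{..<n}" i] by auto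
      ultimately show ?thesis using nth_eq_iff_index_eq[OF dist] xs(1) by simp
    next
      case False
      then show ?thesis using P that permutes_not_in[of p "{..<n}" i] permutes_not_in[of p' "{..<n}" i] by simp
    qed
    then show ?thesis by auto
  qed
  have "sort_sign \<phi> \<sigma> = sign (THE p. ?P p)" by (simp add: sort_sign_def xs_def n_def)
  also have "(THE p. ?P p) = p" using P uniq by (rule the_equality)
  finally have s: "sort_sign \<phi> \<sigma> = sign p" .
  let ?e = "(!) xs"
  have pp: "p permutes {..<n}" using P by simp
  have im: "p ` {..<n} = {..<n}" "inj_on p {..<n}" using pp by (auto simp: permutes_image permutes_inj_on)
  have e: "?e ` {..<n} = \<sigma>" "inj_on ?e {..<n}"
    using xs by (auto simp: set_conv_nth image_iff inj_on_nth)
  have "inversion_sign ?e {..<n} = 1"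
    by (rule inversion_sign_mono) (use xs in \<open>auto simp: sorted_wrt_iff_nth_less less_imp_le\<close>)
  moreover have "inversion_sign (\<phi> \<circ> ?e \<circ> p) {..<n} = 1"
  proof (rule inversion_sign_mono)
    fix i j assume ij: "i \<in> {..<n}" "j \<in> {..<n}" "i < j"
    have "permute_list p ?ys ! i \<le> permute_list p ?ys ! j"
      using P ij xs(1) by (intro sorted_nth_mono) auto
    moreover have "p i < n" "p j < n" using ij im by auto
    ultimately show "(\<phi> \<circ> ?e \<circ> p) i \<le> (\<phi> \<circ> ?e \<circ> p) j"
      using ij xs(1) permute_list_nth[OF p(1)] by simp
  qed
  moreover have "inversion_sign (\<phi> \<circ> ?e \<circ> p) {..<n} = inversion_sign (\<phi> \<circ> ?e) {..<n} * sign p"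
    using im e inj comp_inj_on[OF e(2), of \<phi>] by (simp add: inversion_sign_comp inversion_sign_permutes[OF pp])
  moreover have "inversion_sign (\<phi> \<circ> ?e) {..<n} = inversion_sign \<phi> \<sigma> * inversion_sign ?e {..<n}"
    using e inj by (simp add: inversion_sign_comp)
  ultimately have "inversion_sign \<phi> \<sigma> * sign p = 1" by simp
  then show ?thesis using s by (metis sign_def mult_1_right mult_minus1_right minus_minus)
qed

section \<open>Bijections of vertices\<close>

lemma chain_map_single:
  "chain_map \<phi> (Poly_Mapping.single \<sigma> r) = Poly_Mapping.single (\<phi> ` \<sigma>) (r * of_int (sort_sign \<phi> \<sigma>))"
  by (simp add: chain_map_def)

lemma chain_map_linear:
  "chain_map \<phi> (x + y) = chain_map \<phi> x + chain_map \<phi> y" "chain_map \<phi> (scale r x) = scale r (chain_map \<phi> x)"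
  by (simp_all add: chain_map_def lin_ext_add lin_ext_scale)

lemma chain_map_lin_ext: "chain_map \<phi> (lin_ext f p) = lin_ext (\<lambda>k. chain_map \<phi> (f k)) p"
  by (simp add: chain_map_def lin_ext_lin_ext)

lemma chain_map_graded:
  assumes "inj_on \<phi> V" "K \<subseteq> simplices V" "\<And>\<sigma>. \<sigma> \<in> K \<Longrightarrow> \<phi> ` \<sigma> \<in> K'"
  shows "graded_op 0 K K' (chain_map \<phi> :: ('v::linorder set \<Rightarrow>\<^sub>0 'r::comm_ring_1) \<Rightarrow> ('w::linorder set \<Rightarrow>\<^sub>0 'r))"
  unfolding graded_op_def chain_map_def
proof (intro allI impI keys_lin_ext)
  fix k \<sigma> and c :: "'v set \<Rightarrow>\<^sub>0 'r"
  assume "Poly_Mapping.keys c \<subseteq> {\<sigma> \<in> K. int (card \<sigma>) = k + 1}" "\<sigma> \<in> Poly_Mapping.keys c"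
  then have \<sigma>: "\<sigma> \<in> K" "int (card \<sigma>) = k + 1" by auto
  then have "inj_on \<phi> \<sigma>" using assms(1,2) by (auto simp: simplices_def intro: inj_on_subset)
  then show "Poly_Mapping.keys (Poly_Mapping.single (\<phi> ` \<sigma>) (of_int (sort_sign \<phi> \<sigma>) :: 'r)) \<subseteq>
      {\<sigma> \<in> K'. int (card \<sigma>) = k + 0 + 1}"
    using \<sigma> assms(3) by (simp add: card_image)
qed

lemma chain_map_id:
  assumes "Poly_Mapping.keys c \<subseteq> simplices V"
  shows "chain_map id c = c"
proof -
  have "chain_map id c = lin_ext (\<lambda>\<sigma>. Poly_Mapping.single \<sigma> 1) c"
    unfolding chain_map_def
    by (rule lin_ext_cong) (use assms in \<open>auto simp: simplices_def sort_sign_eq inversion_sign_mono\<close>)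
  then show ?thesis by (simp add: lin_ext_basis)
qed

text \<open>
  The inversion sign is multiplicative, and so is the sign with which \<open>\<phi>\<^sub>#\<close> acts on a simplex.
\<close>

lemma chain_map_comp:
  assumes "inj_on \<phi> V" "inj_on \<psi> (\<phi> ` V)" "Poly_Mapping.keys c \<subseteq> simplices V"
  shows "chain_map (\<psi> \<circ> \<phi>) c = chain_map \<psi> (chain_map \<phi> c)"
proof -
  have "Poly_Mapping.single ((\<psi> \<circ> \<phi>) ` \<sigma>) (of_int (sort_sign (\<psi> \<circ> \<phi>) \<sigma>)) =
      chain_map \<psi> (Poly_Mapping.single (\<phi> ` \<sigma>) (of_int (sort_sign \<phi> \<sigma>)))"
    if "\<sigma> \<in> Poly_Mapping.keys c" for \<sigma>
  proof -
    have \<sigma>: "finite \<sigma>" "\<sigma> \<subseteq> V" using that assms(3) by (auto simp: simplices_def)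
    have inj: "inj_on \<phi> \<sigma>" "inj_on \<psi> (\<phi> ` \<sigma>)"
      using assms(1,2) \<sigma>(2) by (meson inj_on_subset image_mono)+
    have "sort_sign (\<psi> \<circ> \<phi>) \<sigma> = sort_sign \<psi> (\<phi> ` \<sigma>) * sort_sign \<phi> \<sigma>"
      using \<sigma>(1) inj comp_inj_on[OF inj] by (simp only: sort_sign_eq inversion_sign_comp finite_imageI)
    then show ?thesis by (simp only: chain_map_single image_comp of_int_mult mult.commute)
  qed
  then show ?thesis
    unfolding chain_map_def[of "\<psi> \<circ> \<phi>"] chain_map_def[of \<phi>] chain_map_lin_ext
    by (rule lin_ext_cong)
qed

definition equivariant ::
  "'v::linorder set \<Rightarrow> ('v \<Rightarrow> 'v set \<Rightarrow> ('v set \<Rightarrow>\<^sub>0 'r)) \<Rightarrow> ('w \<Rightarrow> 'w set \<Rightarrow> ('w::linorder set \<Rightarrow>\<^sub>0 'r::comm_ring_1))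
    \<Rightarrow> ('v \<Rightarrow> 'w) \<Rightarrow> bool"
  where "equivariant V g g' \<phi> \<longleftrightarrow> (\<forall>v\<in>V. \<forall>\<sigma>\<in>simplices V.
    chain_map \<phi> (g v \<sigma>) = lin_ext (g' (\<phi> v)) (chain_map \<phi> (Poly_Mapping.single \<sigma> 1)))"

text \<open>
  By \<open>inversion_sign_remove\<close>, the signs of \<open>\<phi>\<close> on \<open>\<sigma>\<close> and \<open>\<sigma> - {v}\<close> differ by the positions of \<open>v\<close> in \<open>\<sigma>\<close> and of
  \<open>\<phi> v\<close> in the image, which are the signs of the two deletions.
\<close>

lemma partial_op_equivariant:
  assumes "inj_on \<phi> V"
  shows "equivariant V (partial_op :: _ \<Rightarrow> _ \<Rightarrow> _ \<Rightarrow>\<^sub>0 'r::comm_ring_1) partial_op \<phi>"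
  unfolding equivariant_def
proof (intro ballI)
  fix v \<sigma> assume v: "v \<in> V" and "\<sigma> \<in> simplices V"
  then have \<sigma>: "finite \<sigma>" "\<sigma> \<subseteq> V" by (auto simp: simplices_def)
  have inj: "inj_on \<phi> \<sigma>" using assms \<sigma>(2) by (rule inj_on_subset)
  have mem: "\<phi> v \<in> \<phi> ` \<sigma> \<longleftrightarrow> v \<in> \<sigma>" using inj_on_image_mem_iff[OF assms v \<sigma>(2)] .
  show "chain_map \<phi> (partial_op v \<sigma> :: _ \<Rightarrow>\<^sub>0 'r) =
      lin_ext (partial_op (\<phi> v)) (chain_map \<phi> (Poly_Mapping.single \<sigma> 1))"
  proof (cases "v \<in> \<sigma> \<and> 2 \<le> card \<sigma>")
    case True
    have im: "\<phi> ` (\<sigma> - {v}) = \<phi> ` \<sigma> - {\<phi> v}" using inj True by (auto simp: inj_on_def)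
    have inj': "inj_on \<phi> (\<sigma> - {v})" using inj by (rule inj_on_subset) auto
    have "(-1) ^ preceding v \<sigma> * sort_sign \<phi> (\<sigma> - {v}) = sort_sign \<phi> \<sigma> * (-1) ^ preceding (\<phi> v) (\<phi> ` \<sigma>)"
      using inversion_sign_remove[of \<sigma> v \<phi>] inj inj' \<sigma> True
      by (auto simp: sort_sign_eq minus_one_power_iff)
    then have "of_int ((-1) ^ preceding v \<sigma> * sort_sign \<phi> (\<sigma> - {v})) =
        (of_int (sort_sign \<phi> \<sigma> * (-1) ^ preceding (\<phi> v) (\<phi> ` \<sigma>)) :: 'r)" by (simp only:)
    then show ?thesis
      using True mem inj by (simp add: partial_op_eq chain_map_single im card_image)
  next
    case False
    then show ?thesis using mem inj by (auto simp: partial_op_eq chain_map_single card_image chain_map_def)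
  qed
qed

lemma d_op_equivariant:
  assumes "inj_on \<phi> V"
  shows "equivariant V (d_op :: _ \<Rightarrow> _ \<Rightarrow> _ \<Rightarrow>\<^sub>0 'r::comm_ring_1) d_op \<phi>"
  unfolding equivariant_def
proof (intro ballI)
  fix v \<sigma> assume v: "v \<in> V" and "\<sigma> \<in> simplices V"
  then have \<sigma>: "finite \<sigma>" "\<sigma> \<subseteq> V" by (auto simp: simplices_def)
  have inj': "inj_on \<phi> (insert v \<sigma>)" using assms by (rule inj_on_subset) (use v \<sigma> in auto)
  then have inj: "inj_on \<phi> \<sigma>" by (rule inj_on_subset) auto
  have mem: "\<phi> v \<in> \<phi> ` \<sigma> \<longleftrightarrow> v \<in> \<sigma>" using inj_on_image_mem_iff[OF assms v \<sigma>(2)] .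
  show "chain_map \<phi> (d_op v \<sigma> :: _ \<Rightarrow>\<^sub>0 'r) =
      lin_ext (d_op (\<phi> v)) (chain_map \<phi> (Poly_Mapping.single \<sigma> 1))"
  proof (cases "v \<in> \<sigma>")
    case False
    have "(-1) ^ preceding v \<sigma> * sort_sign \<phi> (insert v \<sigma>) = sort_sign \<phi> \<sigma> * (-1) ^ preceding (\<phi> v) (\<phi> ` \<sigma>)"
      using inversion_sign_insert[of \<sigma> v \<phi>] inj inj' \<sigma> False
      by (auto simp: sort_sign_eq minus_one_power_iff simp del: inj_on_insert)
    then have "of_int ((-1) ^ preceding v \<sigma> * sort_sign \<phi> (insert v \<sigma>)) =
        (of_int (sort_sign \<phi> \<sigma> * (-1) ^ preceding (\<phi> v) (\<phi> ` \<sigma>)) :: 'r)" by (simp only:)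
    then show ?thesis
      using False mem by (simp add: d_op_eq chain_map_single)
  next
    case True
    then show ?thesis using mem by (simp add: d_op_eq chain_map_single chain_map_def)
  qed
qed

definition relabel :: "('v \<Rightarrow> 'w) \<Rightarrow> ('v list \<Rightarrow>\<^sub>0 'r) \<Rightarrow> ('w list \<Rightarrow>\<^sub>0 'r::comm_ring_1)"
  where "relabel \<phi> = lin_ext (\<lambda>w. Poly_Mapping.single (map \<phi> w) 1)"

lemma ext_map_relabel: "ext_map \<phi> \<xi> = relabel \<phi> ` \<xi>"
  by (simp add: ext_map_def relabel_def)

lemma relabel_linear:
  "relabel \<phi> (p + q) = relabel \<phi> p + relabel \<phi> q" "relabel \<phi> (- p) = - relabel \<phi> p" "relabel \<phi> 0 = 0"
  by (simp_all add: relabel_def lin_ext_add lin_ext_uminus)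

lemma relabel_comp: "relabel (\<psi> \<circ> \<phi>) p = relabel \<psi> (relabel \<phi> p)"
  by (simp add: relabel_def lin_ext_lin_ext)

lemma relabel_id:
  assumes "Poly_Mapping.keys p \<subseteq> lists V" "\<And>v. v \<in> V \<Longrightarrow> \<phi> v = v"
  shows "relabel \<phi> p = p"
proof -
  have "relabel \<phi> p = lin_ext (\<lambda>w. Poly_Mapping.single w 1) p"
    unfolding relabel_def
  proof (rule lin_ext_cong)
    fix w assume "w \<in> Poly_Mapping.keys p"
    then have "map \<phi> w = w" using assms by (auto intro!: map_idI)
    then show "Poly_Mapping.single (map \<phi> w) 1 = Poly_Mapping.single w 1" by simp
  qed
  then show ?thesis by (simp add: lin_ext_basis)
qed

lemma relabel_tmul: "relabel \<phi> (tmul p q) = tmul (relabel \<phi> p) (relabel \<phi> q)"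
  by (simp add: relabel_def tmul_def lin_ext_lin_ext)

lemma keys_relabel:
  assumes "\<And>w. w \<in> Poly_Mapping.keys p \<Longrightarrow> map \<phi> w \<in> S"
  shows "Poly_Mapping.keys (relabel \<phi> p) \<subseteq> S"
  unfolding relabel_def using assms by (intro keys_lin_ext) auto

lemma relabel_lists:
  assumes "\<phi> ` V \<subseteq> V'" "Poly_Mapping.keys p \<subseteq> lists V"
  shows "Poly_Mapping.keys (relabel \<phi> p) \<subseteq> lists V'"
  by (rule keys_relabel) (use assms in fastforce)

lemma relabel_homogeneous:
  assumes "\<phi> ` V \<subseteq> V'" "p \<in> homogeneous V k"
  shows "relabel \<phi> p \<in> homogeneous V' k"
  unfolding homogeneous_def mem_Collect_eq
  by (rule keys_relabel) (use assms in \<open>fastforce simp: homogeneous_def\<close>)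

lemma ext_ideal_subset: "ext_ideal V \<subseteq> {p. Poly_Mapping.keys p \<subseteq> lists V}"
  using additive_subgroup.a_subset[OF ideal.axioms(1)[OF ext_ideal_ideal]] by simp

lemma relabel_ext_ideal_subset:
  fixes \<phi> :: "'v \<Rightarrow> 'w"
  assumes "\<phi> ` V \<subseteq> V'" "p \<in> (ext_ideal V :: ('v list \<Rightarrow>\<^sub>0 'r::comm_ring_1) set)"
  shows "relabel \<phi> p \<in> ext_ideal V'"
proof -
  let ?A = "{p :: 'v list \<Rightarrow>\<^sub>0 'r. Poly_Mapping.keys p \<subseteq> lists V \<and> relabel \<phi> p \<in> ext_ideal V'}"
  have "ext_ideal V \<subseteq> ?A"
  proof (rule ext_ideal_least)
    fix p x :: "'v list \<Rightarrow>\<^sub>0 'r" assume "p \<in> ?A" "Poly_Mapping.keys x \<subseteq> lists V"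
    then show "tmul x p \<in> ?A" "tmul p x \<in> ?A"
      by (simp_all add: keys_tmul_lists relabel_tmul ext_ideal_closed relabel_lists[OF assms(1)])
  next
    fix x :: "'v list \<Rightarrow>\<^sub>0 'r" assume x: "Poly_Mapping.keys x \<subseteq> (\<lambda>v. [v]) ` V"
    have "Poly_Mapping.keys (relabel \<phi> x) \<subseteq> (\<lambda>v. [v]) ` V'"
      by (rule keys_relabel) (use x assms(1) in fastforce)
    then have "tmul (relabel \<phi> x) (relabel \<phi> x) \<in> ext_ideal V'" by (rule square_ext_ideal)
    moreover have "Poly_Mapping.keys x \<subseteq> lists V" using x by auto
    ultimately show "tmul x x \<in> ?A" by (simp add: relabel_tmul keys_tmul_lists)
  qed (auto simp: relabel_linear ext_ideal_closed dest!: keys_add[THEN subsetD])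
  then show ?thesis using assms by auto
qed

text \<open>
  Equality of the ideals, rather than an inclusion, uses the inverse bijection as well.  It is what makes the image of a
  coset a full coset.
\<close>

lemma relabel_ext_ideal:
  assumes "bij_betw \<phi> V V'"
  shows "relabel \<phi> ` ext_ideal V = ext_ideal V'"
proof
  have V: "\<phi> ` V \<subseteq> V'" "inv_into V \<phi> ` V' \<subseteq> V"
    using assms by (auto simp: bij_betw_def inv_into_into)
  show "relabel \<phi> ` ext_ideal V \<subseteq> ext_ideal V'"
    using relabel_ext_ideal_subset[OF V(1)] by auto
  show "ext_ideal V' \<subseteq> relabel \<phi> ` ext_ideal V"
  proof
    fix p assume p: "p \<in> ext_ideal V'"
    then have "p = relabel \<phi> (relabel (inv_into V \<phi>) p)"
      unfolding relabel_comp[symmetric]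
      by (intro relabel_id[of p V', symmetric])
        (use assms ext_ideal_subset[of V'] in \<open>auto simp: bij_betw_def f_inv_into_f\<close>)
    then show "p \<in> relabel \<phi> ` ext_ideal V"
      using relabel_ext_ideal_subset[OF V(2) p] by blast
  qed
qed

lemma ext_map_class:
  assumes "bij_betw \<phi> V V'"
  shows "ext_map \<phi> (ext_ideal V +>\<^bsub>tensor_alg V\<^esub> p) = ext_ideal V' +>\<^bsub>tensor_alg V'\<^esub> relabel \<phi> p"
proof -
  have "ext_map \<phi> (ext_ideal V +>\<^bsub>tensor_alg V\<^esub> p) = (\<lambda>q. q + relabel \<phi> p) ` (relabel \<phi> ` ext_ideal V)"
    by (auto simp: ext_map_relabel a_r_coset_def' relabel_linear image_iff)
  then show ?thesis
    unfolding relabel_ext_ideal[OF assms] by (auto simp: a_r_coset_def')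
qed

lemma ext_map_ext_deg:
  assumes "bij_betw \<phi> V V'" "\<xi> \<in> ext_deg V k"
  shows "ext_map \<phi> \<xi> \<in> ext_deg V' k"
proof -
  obtain p where p: "p \<in> homogeneous V k" "\<xi> = ext_ideal V +>\<^bsub>tensor_alg V\<^esub> p" using assms(2) by (rule ext_degE)
  have "relabel \<phi> p \<in> homogeneous V' k"
    by (rule relabel_homogeneous[OF _ p(1)]) (use assms(1) in \<open>auto simp: bij_betw_def\<close>)
  then show ?thesis unfolding p(2) ext_map_class[OF assms(1)] by (auto simp: ext_deg_def homogeneous_def)
qed

lemma ext_map_wedge:
  assumes "bij_betw \<phi> V V'" "\<xi> \<in> ext_deg V k" "\<eta> \<in> ext_deg V l"
  shows "ext_map \<phi> (wedge V \<xi> \<eta>) = wedge V' (ext_map \<phi> \<xi>) (ext_map \<phi> \<eta>)"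
proof -
  obtain p q where p: "p \<in> homogeneous V k" "\<xi> = ext_ideal V +>\<^bsub>tensor_alg V\<^esub> p"
    and q: "q \<in> homogeneous V l" "\<eta> = ext_ideal V +>\<^bsub>tensor_alg V\<^esub> q"
    using assms(2,3) by (auto elim!: ext_degE)
  have V: "\<phi> ` V \<subseteq> V'" using assms(1) by (auto simp: bij_betw_def)
  show ?thesis
    unfolding p(2) q(2) wedge_class[OF p(1) q(1)] ext_map_class[OF assms(1)] relabel_tmul
    by (rule wedge_class[OF relabel_homogeneous[OF V p(1)] relabel_homogeneous[OF V q(1)], symmetric])
qed

lemma ext_map_id:
  assumes "\<xi> \<in> ext_deg V k" shows "ext_map id \<xi> = \<xi>"
proof -
  have "relabel id p = p" for p :: "'a list \<Rightarrow>\<^sub>0 'b" by (rule relabel_id[of p UNIV]) auto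
  then show ?thesis by (simp add: ext_map_relabel)
qed

lemma ext_map_comp: "ext_map (\<psi> \<circ> \<phi>) \<xi> = ext_map \<psi> (ext_map \<phi> \<xi>)"
  by (simp add: ext_map_relabel image_image relabel_comp)

lemma chain_map_word_act:
  assumes "equivariant V g g' \<phi>" "closed_under V e g (simplices V)" "w \<in> lists V"
    "Poly_Mapping.keys c \<subseteq> simplices V"
  shows "chain_map \<phi> (word_act g w c) = word_act g' (map \<phi> w) (chain_map \<phi> c)"
  using assms(3)
proof (induction w)
  case (Cons v w)
  have "Poly_Mapping.keys (word_act g w c) \<subseteq> simplices V"
    using Cons word_act_closed[OF assms(2) _ assms(4)] by auto
  moreover have "chain_map \<phi> (lin_ext (g v) x) = lin_ext (g' (\<phi> v)) (chain_map \<phi> x)"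
    if "Poly_Mapping.keys x \<subseteq> simplices V" for x
  proof -
    have "chain_map \<phi> (lin_ext (g v) x) =
        lin_ext (\<lambda>\<sigma>. lin_ext (g' (\<phi> v)) (chain_map \<phi> (Poly_Mapping.single \<sigma> 1))) x"
      unfolding chain_map_lin_ext
      by (rule lin_ext_cong) (use that Cons assms(1) in \<open>auto simp: equivariant_def\<close>)
    also have "\<dots> = lin_ext (g' (\<phi> v)) (chain_map \<phi> (lin_ext (\<lambda>\<sigma>. Poly_Mapping.single \<sigma> 1) x))"
      by (simp only: chain_map_lin_ext lin_ext_lin_ext)
    finally show ?thesis by (simp only: lin_ext_basis)
  qed
  ultimately show ?case using Cons by simp
qed simp

text \<open>
  Equivariance passes from letters to words by induction, and from words to all elements by linearity.
\<close>

lemma chain_map_tensor_act: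
  assumes "equivariant V g g' \<phi>" "closed_under V e g (simplices V)" "Poly_Mapping.keys p \<subseteq> lists V"
    "Poly_Mapping.keys c \<subseteq> simplices V"
  shows "chain_map \<phi> (tensor_act g p c) = tensor_act g' (relabel \<phi> p) (chain_map \<phi> c)"
proof -
  have "chain_map \<phi> (tensor_act g p c) = lin_ext (\<lambda>w. word_act g' (map \<phi> w) (chain_map \<phi> c)) p"
    unfolding tensor_act_word chain_map_lin_ext
    by (rule lin_ext_cong) (use assms chain_map_word_act in blast)
  then show ?thesis by (simp add: tensor_act_word relabel_def lin_ext_lin_ext)
qed

section \<open>Mayer--Vietoris objects of hypergraphs\<close>

text \<open>
  The maps \<open>lo\<close> and \<open>up\<close> stand for \<open>\<delta>\<close> and \<open>\<Delta>\<close> in homology and for their barred versions in cohomology.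
\<close>

locale hypergraph_setting = anticommuting_action V e g
  for V :: "'v::linorder set" and e :: int and g :: "'v \<Rightarrow> 'v set \<Rightarrow> ('v set \<Rightarrow>\<^sub>0 'r::comm_ring_1)" +
  fixes lo up :: "'v set set \<Rightarrow> 'v set set" and H1 H2 :: "'v set set"
  assumes lo_closed: "closed_under V e g (lo H1)" "closed_under V e g (lo H2)"
    and up_closed: "closed_under V e g (up H1)" "closed_under V e g (up H2)"
    and lo_up: "lo H1 \<subseteq> up H1" "lo H2 \<subseteq> up H2"
    and up_simplices: "up H1 \<subseteq> simplices V" "up H2 \<subseteq> simplices V"
begin

lemma lo_simplices: "lo H1 \<subseteq> simplices V" "lo H2 \<subseteq> simplices V"
  using lo_up up_simplices by auto

text \<open>
  That the differential squares to \<open>0\<close> is the vanishing of odd squares.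
\<close>

lemma hmv_pair_constrained:
  assumes \<alpha>: "\<alpha> \<in> ext_deg V (2 * t + 1)"
  shows "hmv_pair (constrained_cx e (ext_act g \<alpha>) t m) lo up H1 H2"
proof -
  have p: "mv_pair (constrained_cx e (ext_act g \<alpha>) t m) K1 K2"
    if "closed_under V e g K1" "closed_under V e g K2" "K1 \<subseteq> simplices V" "K2 \<subseteq> simplices V" for K1 K2
  proof (rule constrained_mv_pair[OF ext_act_linear[OF \<alpha>] _ _ that(3,4)])
    have "e * (2 * int t + 1) = e * int (2 * t + 1)" by simp
    then show "graded_op (e * (2 * int t + 1)) K1 K1 (ext_act g \<alpha>)" "graded_op (e * (2 * int t + 1)) K2 K2 (ext_act g \<alpha>)"
      using ext_act_graded[OF \<alpha> that(1,3)] ext_act_graded[OF \<alpha> that(2,4)] by metis+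
  qed (auto intro!: ext_act_odd_square[OF \<alpha>])
  have "mv_hom (constrained_cx e (ext_act g \<alpha>) t m) (lo H1) (lo H2)
      (constrained_cx e (ext_act g \<alpha>) t m) (up H1) (up H2) id"
    by (rule constrained_mv_hom[of "simplices V"]) (use lo_up lo_simplices in \<open>auto simp: linear_on_id graded_op_id\<close>)
  then show ?thesis
    unfolding hmv_pair_def by (intro conjI p lo_closed up_closed lo_simplices up_simplices)
qed

text \<open>
  As \<open>\<beta>\<close> has even degree, it commutes with the differential \<open>\<alpha>\<close> without a sign.
\<close>

lemma act_hom:
  assumes \<alpha>: "\<alpha> \<in> ext_deg V (2 * t + 1)" and \<beta>: "\<beta> \<in> ext_deg V (2 * s)" and m': "m' = m + e * (2 * int s)"
  shows "hmv_hom (constrained_cx e (ext_act g \<alpha>) t m) lo up H1 H2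
    (constrained_cx e (ext_act g \<alpha>) t m') lo up H1 H2 (ext_act g \<beta>)"
proof -
  have "m' - m = e * int (2 * s)" using m' by simp
  then have gr: "graded_op (m' - m) K K (ext_act g \<beta>)" if "closed_under V e g K" "K \<subseteq> simplices V" for K
    using ext_act_graded[OF \<beta> that] by metis
  have "ext_act g \<beta> (ext_act g \<alpha> c) = ext_act g \<alpha> (ext_act g \<beta> c)" if "Poly_Mapping.keys c \<subseteq> simplices V" for c
    by (rule ext_act_commute[OF \<beta> \<alpha> _ that]) simp
  then show ?thesis
    unfolding hmv_hom_def
    by (intro conjI constrained_mv_hom[OF ext_act_linear[OF \<beta>]] gr lo_closed up_closed lo_simplices up_simplices)
qed

lemma keys_simplices:
  "x \<in> carrier (cx_term (constrained_cx e f t m (lo H1 \<union> lo H2)) n) \<Longrightarrow> Poly_Mapping.keys x \<subseteq> simplices V"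
  "x \<in> carrier (cx_term (constrained_cx e f t m (up H1 \<union> up H2)) n) \<Longrightarrow> Poly_Mapping.keys x \<subseteq> simplices V"
  using constrained_keys(1) lo_simplices up_simplices by (meson Un_least order_trans)+

lemma act_morphism:
  assumes "\<alpha> \<in> ext_deg V (2 * t + 1)" "\<beta> \<in> ext_deg V (2 * s)" "m' = m + e * (2 * int s)"
  shows "hmv_morphism (hmv_object (constrained_cx e (ext_act g \<alpha>) t m) lo up H1 H2)
    (hmv_object (constrained_cx e (ext_act g \<alpha>) t m') lo up H1 H2)
    (hmv_induced (constrained_cx e (ext_act g \<alpha>) t m') lo up H1 H2 (ext_act g \<beta>))"
  using assms by (intro hmv_induced_morphism hmv_pair_constrained act_hom)

lemma act_wedge:
  assumes \<alpha>: "\<alpha> \<in> ext_deg V (2 * t + 1)" and \<beta>: "\<beta>1 \<in> ext_deg V (2 * s1)" "\<beta>2 \<in> ext_deg V (2 * s2)"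
    and m: "m' = m + e * (2 * int s2)" "m'' = m' + e * (2 * int s1)"
  shows "hmv_eq (hmv_object (constrained_cx e (ext_act g \<alpha>) t m) lo up H1 H2)
    (hmv_induced (constrained_cx e (ext_act g \<alpha>) t m'') lo up H1 H2 (ext_act g (wedge V \<beta>1 \<beta>2)))
    (hmv_comp (hmv_induced (constrained_cx e (ext_act g \<alpha>) t m'') lo up H1 H2 (ext_act g \<beta>1))
      (hmv_induced (constrained_cx e (ext_act g \<alpha>) t m') lo up H1 H2 (ext_act g \<beta>2)))"
proof (rule hmv_induced_comp[OF hmv_pair_constrained[OF \<alpha>] hmv_pair_constrained[OF \<alpha>] hmv_pair_constrained[OF \<alpha>] act_hom[OF \<alpha> \<beta>(2) m(1)] act_hom[OF \<alpha> \<beta>(1) m(2)]])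
  have w: "wedge V \<beta>1 \<beta>2 \<in> ext_deg V (2 * (s1 + s2))"
    using wedge_ext_deg[OF \<beta>] by (simp add: distrib_left)
  show "hmv_hom (constrained_cx e (ext_act g \<alpha>) t m) lo up H1 H2
     (constrained_cx e (ext_act g \<alpha>) t m'') lo up H1 H2 (ext_act g (wedge V \<beta>1 \<beta>2))"
    by (rule act_hom[OF \<alpha> w]) (simp add: m algebra_simps)
qed (auto intro!: ext_act_wedge[OF \<beta>] dest: keys_simplices)

lemma act_wedge_commute:
  assumes \<alpha>: "\<alpha> \<in> ext_deg V (2 * t + 1)" and \<beta>: "\<beta>1 \<in> ext_deg V (2 * s1)" "\<beta>2 \<in> ext_deg V (2 * s2)"
    and m: "m' = m + e * (2 * int s1)" "m'' = m' + e * (2 * int s2)"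
  shows "hmv_eq (hmv_object (constrained_cx e (ext_act g \<alpha>) t m) lo up H1 H2)
    (hmv_induced (constrained_cx e (ext_act g \<alpha>) t m'') lo up H1 H2 (ext_act g (wedge V \<beta>1 \<beta>2)))
    (hmv_comp (hmv_induced (constrained_cx e (ext_act g \<alpha>) t m'') lo up H1 H2 (ext_act g \<beta>2))
      (hmv_induced (constrained_cx e (ext_act g \<alpha>) t m') lo up H1 H2 (ext_act g \<beta>1)))"
proof (rule hmv_induced_comp[OF hmv_pair_constrained[OF \<alpha>] hmv_pair_constrained[OF \<alpha>] hmv_pair_constrained[OF \<alpha>] act_hom[OF \<alpha> \<beta>(1) m(1)] act_hom[OF \<alpha> \<beta>(2) m(2)]])
  have w: "wedge V \<beta>1 \<beta>2 \<in> ext_deg V (2 * (s1 + s2))"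
    using wedge_ext_deg[OF \<beta>] by (simp add: distrib_left)
  show "hmv_hom (constrained_cx e (ext_act g \<alpha>) t m) lo up H1 H2
     (constrained_cx e (ext_act g \<alpha>) t m'') lo up H1 H2 (ext_act g (wedge V \<beta>1 \<beta>2))"
    by (rule act_hom[OF \<alpha> w]) (simp add: m algebra_simps)
  have "ext_act g (wedge V \<beta>1 \<beta>2) x = ext_act g \<beta>2 (ext_act g \<beta>1 x)" if "Poly_Mapping.keys x \<subseteq> simplices V" for x
    using ext_act_wedge[OF \<beta> that] ext_act_commute[OF \<beta> _ that] by simp
  then show "x \<in> carrier (cx_term (constrained_cx e (ext_act g \<alpha>) t m (lo H1 \<union> lo H2)) n) \<Longrightarrow>
      ext_act g (wedge V \<beta>1 \<beta>2) x = ext_act g \<beta>2 (ext_act g \<beta>1 x)"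
    "x \<in> carrier (cx_term (constrained_cx e (ext_act g \<alpha>) t m (up H1 \<union> up H2)) n) \<Longrightarrow>
      ext_act g (wedge V \<beta>1 \<beta>2) x = ext_act g \<beta>2 (ext_act g \<beta>1 x)" for n x
    using keys_simplices by blast+
qed

end

locale setting_morphism = S: hypergraph_setting V e g lo up H1 H2 +
  S': hypergraph_setting V' e g' lo' up' H1' H2'
  for V :: "'v::linorder set" and e :: int and g :: "'v \<Rightarrow> 'v set \<Rightarrow> ('v set \<Rightarrow>\<^sub>0 'r::comm_ring_1)"
    and lo up :: "'v set set \<Rightarrow> 'v set set" and H1 H2 :: "'v set set"
    and V' :: "'w::linorder set" and g' :: "'w \<Rightarrow> 'w set \<Rightarrow> ('w set \<Rightarrow>\<^sub>0 'r)"
    and lo' up' :: "'w set set \<Rightarrow> 'w set set" and H1' H2' :: "'w set set" +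
  fixes \<phi> :: "'v \<Rightarrow> 'w"
  assumes bij: "bij_betw \<phi> V V'"
    and equivariant: "equivariant V g g' \<phi>"
    and maps: "\<And>\<sigma>. \<sigma> \<in> lo H1 \<Longrightarrow> \<phi> ` \<sigma> \<in> lo' H1'" "\<And>\<sigma>. \<sigma> \<in> lo H2 \<Longrightarrow> \<phi> ` \<sigma> \<in> lo' H2'"
      "\<And>\<sigma>. \<sigma> \<in> up H1 \<Longrightarrow> \<phi> ` \<sigma> \<in> up' H1'" "\<And>\<sigma>. \<sigma> \<in> up H2 \<Longrightarrow> \<phi> ` \<sigma> \<in> up' H2'"
begin

lemma inj: "inj_on \<phi> V"
  using bij by (simp add: bij_betw_def)

lemma keys_chain_map:
  assumes "Poly_Mapping.keys c \<subseteq> simplices V"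
  shows "Poly_Mapping.keys (chain_map \<phi> c) \<subseteq> simplices V'"
  unfolding chain_map_def
proof (rule keys_lin_ext)
  fix \<sigma> assume "\<sigma> \<in> Poly_Mapping.keys c"
  then have "\<phi> ` \<sigma> \<in> simplices V'" using assms bij by (force simp: simplices_def bij_betw_def)
  then show "Poly_Mapping.keys (Poly_Mapping.single (\<phi> ` \<sigma>) (of_int (sort_sign \<phi> \<sigma>))) \<subseteq> simplices V'" by simp
qed

lemma chain_map_ext_act:
  assumes "\<xi> \<in> ext_deg V k" "Poly_Mapping.keys c \<subseteq> simplices V"
  shows "chain_map \<phi> (ext_act g \<xi> c) = ext_act g' (ext_map \<phi> \<xi>) (chain_map \<phi> c)"
proof -
  obtain p where p: "p \<in> homogeneous V k" "\<xi> = ext_ideal V +>\<^bsub>tensor_alg V\<^esub> p" using assms(1) by (rule ext_degE)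
  show ?thesis
    using chain_map_tensor_act[OF equivariant S.closed homogeneous_carrier[OF p(1)] assms(2)]
    unfolding p(2) ext_map_class[OF bij] S.ext_act_class[OF assms(2)] S'.ext_act_class[OF keys_chain_map[OF assms(2)]] .
qed

lemma chain_map_hom:
  assumes "\<alpha> \<in> ext_deg V (2 * t + 1)"
  shows "hmv_hom (constrained_cx e (ext_act g \<alpha>) t k) lo up H1 H2
    (constrained_cx e (ext_act g' (ext_map \<phi> \<alpha>)) t k) lo' up' H1' H2' (chain_map \<phi>)"
proof -
  have lin: "linear_on (simplices V) (chain_map \<phi>)" by (simp add: linear_on_def chain_map_linear)
  have gr: "graded_op (k - k) K K' (chain_map \<phi> :: ('v set \<Rightarrow>\<^sub>0 'r) \<Rightarrow> _)"
    if "K \<subseteq> simplices V" "\<And>\<sigma>. \<sigma> \<in> K \<Longrightarrow> \<phi> ` \<sigma> \<in> K'" for K K'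
    using chain_map_graded[OF inj that] by simp
  show ?thesis
    unfolding hmv_hom_def
    by (intro conjI constrained_mv_hom[of "simplices V"] lin gr S.lo_simplices S.up_simplices maps chain_map_ext_act[OF assms])
qed

lemma chain_map_morphism:
  assumes "\<alpha> \<in> ext_deg V (2 * t + 1)"
  shows "hmv_morphism (hmv_object (constrained_cx e (ext_act g \<alpha>) t k) lo up H1 H2)
    (hmv_object (constrained_cx e (ext_act g' (ext_map \<phi> \<alpha>)) t k) lo' up' H1' H2')
    (hmv_induced (constrained_cx e (ext_act g' (ext_map \<phi> \<alpha>)) t k) lo' up' H1' H2' (chain_map \<phi>))"
  by (intro hmv_induced_morphism S.hmv_pair_constrained S'.hmv_pair_constrained chain_map_hom assms ext_map_ext_deg[OF bij])

text \<open>
  Both composites are induced by the map of chains \<open>\<phi>\<^sub># \<circ> \<beta>\<close>, to which equivariance reduces the second one.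
\<close>

lemma chain_map_natural:
  assumes \<alpha>: "\<alpha> \<in> ext_deg V (2 * t + 1)" and \<beta>: "\<beta> \<in> ext_deg V (2 * s)" and k': "k' = k + e * (2 * int s)"
  shows "hmv_eq (hmv_object (constrained_cx e (ext_act g \<alpha>) t k) lo up H1 H2)
    (hmv_comp (hmv_induced (constrained_cx e (ext_act g' (ext_map \<phi> \<alpha>)) t k') lo' up' H1' H2' (chain_map \<phi>))
      (hmv_induced (constrained_cx e (ext_act g \<alpha>) t k') lo up H1 H2 (ext_act g \<beta>)))
    (hmv_comp (hmv_induced (constrained_cx e (ext_act g' (ext_map \<phi> \<alpha>)) t k') lo' up' H1' H2' (ext_act g' (ext_map \<phi> \<beta>)))
      (hmv_induced (constrained_cx e (ext_act g' (ext_map \<phi> \<alpha>)) t k) lo' up' H1' H2' (chain_map \<phi>)))"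
proof -
  note \<alpha>' = ext_map_ext_deg[OF bij \<alpha>] and \<beta>' = ext_map_ext_deg[OF bij \<beta>]
  let ?f = "chain_map \<phi> \<circ> ext_act g \<beta>"
  have f: "hmv_hom (constrained_cx e (ext_act g \<alpha>) t k) lo up H1 H2
      (constrained_cx e (ext_act g' (ext_map \<phi> \<alpha>)) t k') lo' up' H1' H2' ?f"
    using S.act_hom[OF \<alpha> \<beta> k'] chain_map_hom[OF \<alpha>, of k'] unfolding hmv_hom_def by (meson mv_hom_comp)
  have eq: "?f x = ext_act g' (ext_map \<phi> \<beta>) (chain_map \<phi> x)" if "Poly_Mapping.keys x \<subseteq> simplices V" for x
    using chain_map_ext_act[OF \<beta> that] by simp
  show ?thesis
    by (rule hmv_eq_trans[OF hmv_eq_sym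
          [OF hmv_induced_comp[OF S.hmv_pair_constrained[OF \<alpha>] S.hmv_pair_constrained[OF \<alpha>] S'.hmv_pair_constrained[OF \<alpha>'] S.act_hom[OF \<alpha> \<beta> k'] chain_map_hom[OF \<alpha>] f]]
          hmv_induced_comp[OF S.hmv_pair_constrained[OF \<alpha>] S'.hmv_pair_constrained[OF \<alpha>'] S'.hmv_pair_constrained[OF \<alpha>'] chain_map_hom[OF \<alpha>] S'.act_hom[OF \<alpha>' \<beta>' k'] f]])
      (rule o_apply | (rule eq, erule S.keys_simplices))+
qed

end

context hypergraph_setting begin

lemma chain_map_id_induced:
  assumes "\<alpha> \<in> ext_deg V (2 * t + 1)"
  shows "hmv_eq (hmv_object (constrained_cx e (ext_act g \<alpha>) t k) lo up H1 H2)
    (hmv_induced (constrained_cx e (ext_act g \<alpha>) t k) lo up H1 H2 (chain_map id)) hmv_id"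
proof -
  have lin: "linear_on (simplices V) (chain_map id :: ('v set \<Rightarrow>\<^sub>0 'r) \<Rightarrow> _)"
    by (simp add: linear_on_def chain_map_linear)
  have gr: "graded_op (k - k) K K (chain_map id :: ('v set \<Rightarrow>\<^sub>0 'r) \<Rightarrow> _)" if "K \<subseteq> simplices V" for K
    using chain_map_graded[of id V K K] that by simp
  have com: "chain_map id (ext_act g \<alpha> c) = ext_act g \<alpha> (chain_map id c)"
    if "Poly_Mapping.keys c \<subseteq> simplices V" for c
    using that ext_act_closed[OF assms that] by (simp add: chain_map_id)
  have "hmv_hom (constrained_cx e (ext_act g \<alpha>) t k) lo up H1 H2
      (constrained_cx e (ext_act g \<alpha>) t k) lo up H1 H2 (chain_map id)"
    unfolding hmv_hom_def
    by (intro conjI constrained_mv_hom[of "simplices V"] lin gr com lo_simplices up_simplices)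
  then show ?thesis
    by (rule hmv_eq_id[OF hmv_pair_constrained[OF assms]]) (auto intro!: chain_map_id dest: keys_simplices)
qed

end

lemma chain_map_comp_induced:
  assumes \<phi>: "setting_morphism V e g lo up H1 H2 V' g' lo' up' H1' H2' \<phi>"
    and \<psi>: "setting_morphism V' e g' lo' up' H1' H2' V'' g'' lo'' up'' H1'' H2'' \<psi>"
    and \<psi>\<phi>: "setting_morphism V e g lo up H1 H2 V'' g'' lo'' up'' H1'' H2'' (\<psi> \<circ> \<phi>)"
    and \<alpha>: "\<alpha> \<in> ext_deg V (2 * t + 1)"
  shows "hmv_eq (hmv_object (constrained_cx e (ext_act g \<alpha>) t k) lo up H1 H2)
    (hmv_induced (constrained_cx e (ext_act g'' (ext_map (\<psi> \<circ> \<phi>) \<alpha>)) t k) lo'' up'' H1'' H2'' (chain_map (\<psi> \<circ> \<phi>)))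
    (hmv_comp (hmv_induced (constrained_cx e (ext_act g'' (ext_map (\<psi> \<circ> \<phi>) \<alpha>)) t k) lo'' up'' H1'' H2'' (chain_map \<psi>))
      (hmv_induced (constrained_cx e (ext_act g' (ext_map \<phi> \<alpha>)) t k) lo' up' H1' H2' (chain_map \<phi>)))"
proof -
  interpret \<phi>: setting_morphism V e g lo up H1 H2 V' g' lo' up' H1' H2' \<phi> by (rule \<phi>)
  interpret \<psi>: setting_morphism V' e g' lo' up' H1' H2' V'' g'' lo'' up'' H1'' H2'' \<psi> by (rule \<psi>)
  interpret \<psi>\<phi>: setting_morphism V e g lo up H1 H2 V'' g'' lo'' up'' H1'' H2'' "\<psi> \<circ> \<phi>" by (rule \<psi>\<phi>)
  note \<alpha>' = ext_map_ext_deg[OF \<phi>.bij \<alpha>] and \<alpha>'' = ext_map_ext_deg[OF \<psi>\<phi>.bij \<alpha>]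
  have eq: "chain_map (\<psi> \<circ> \<phi>) x = chain_map \<psi> (chain_map \<phi> x)" if "Poly_Mapping.keys x \<subseteq> simplices V" for x
    by (rule chain_map_comp[OF \<phi>.inj _ that]) (use \<phi>.bij \<psi>.inj in \<open>simp add: bij_betw_def\<close>)
  show ?thesis
    by (rule hmv_induced_comp[OF \<phi>.S.hmv_pair_constrained[OF \<alpha>] \<phi>.S'.hmv_pair_constrained[OF \<alpha>'] \<psi>.S'.hmv_pair_constrained[OF \<alpha>''] \<phi>.chain_map_hom[OF \<alpha>]
          \<psi>.chain_map_hom[OF \<alpha>', folded ext_map_comp] \<psi>\<phi>.chain_map_hom[OF \<alpha>]])
      (rule eq, erule \<phi>.S.keys_simplices)+
qed

section \<open>Simplicial complexes and independence hypergraphs\<close>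

lemma simplicial_setting:
  assumes "(2::'r::comm_ring_1) dvd 1" "H1 \<subseteq> simplices V" "H2 \<subseteq> simplices V"
  shows "hypergraph_setting V (-1) (partial_op :: _ \<Rightarrow> _ \<Rightarrow> _ \<Rightarrow>\<^sub>0 'r) simp_core (simp_closure V) H1 H2"
proof -
  interpret anticommuting_action V "-1" "partial_op :: _ \<Rightarrow> _ \<Rightarrow> _ \<Rightarrow>\<^sub>0 'r"
    by (rule partial_op_action[OF assms(1)])
  have core: "closed_under V (-1) (partial_op :: _ \<Rightarrow> _ \<Rightarrow> _ \<Rightarrow>\<^sub>0 'r) (simp_core H)" if "H \<subseteq> simplices V" for H
    by (rule partial_op_closed) (use that in \<open>unfold simp_core_def; blast\<close>)+
  have clos: "closed_under V (-1) (partial_op :: _ \<Rightarrow> _ \<Rightarrow> _ \<Rightarrow>\<^sub>0 'r) (simp_closure V H)" for H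
    by (rule partial_op_closed) (auto simp: simp_closure_def simplices_def intro: finite_subset)
  show ?thesis
    by (unfold_locales; (intro core clos assms)?)
      (use assms in \<open>auto simp: simp_core_def simp_closure_def\<close>)
qed

lemma independence_setting:
  assumes "(2::'r::comm_ring_1) dvd 1" "H1 \<subseteq> simplices V" "H2 \<subseteq> simplices V"
  shows "hypergraph_setting V 1 (d_op :: _ \<Rightarrow> _ \<Rightarrow> _ \<Rightarrow>\<^sub>0 'r) (ind_core V) (ind_closure V) H1 H2"
proof -
  interpret anticommuting_action V 1 "d_op :: _ \<Rightarrow> _ \<Rightarrow> _ \<Rightarrow>\<^sub>0 'r"
    by (rule d_op_action[OF assms(1)])
  have core: "closed_under V 1 (d_op :: _ \<Rightarrow> _ \<Rightarrow> _ \<Rightarrow>\<^sub>0 'r) (ind_core V H)" if "H \<subseteq> simplices V" for H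
    by (rule d_op_closed) (use that in \<open>auto simp: ind_core_def\<close>)
  have clos: "closed_under V 1 (d_op :: _ \<Rightarrow> _ \<Rightarrow> _ \<Rightarrow>\<^sub>0 'r) (ind_closure V H)" for H
    by (rule d_op_closed) (auto simp: ind_closure_def)
  show ?thesis
    by (unfold_locales; (intro core clos assms)?)
      (use assms in \<open>auto simp: ind_core_def ind_closure_def\<close>)
qed

lemma image_simplices:
  assumes "bij_betw \<phi> V V'" "\<sigma> \<in> simplices V" shows "\<phi> ` \<sigma> \<in> simplices V'"
  using assms by (force simp: simplices_def bij_betw_def)

text \<open>
  Every non-empty subset of \<open>\<phi> ` \<sigma>\<close> is the image of one of \<open>\<sigma>\<close>.
\<close>

lemma simp_core_image:
  assumes "\<And>\<sigma>. \<sigma> \<in> H \<Longrightarrow> \<phi> ` \<sigma> \<in> H'" "\<sigma> \<in> simp_core H"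
  shows "\<phi> ` \<sigma> \<in> simp_core H'"
proof -
  have "\<tau> \<in> H'" if "\<tau> \<noteq> {}" "\<tau> \<subseteq> \<phi> ` \<sigma>" for \<tau>
  proof -
    obtain \<rho> where "\<rho> \<subseteq> \<sigma>" "\<tau> = \<phi> ` \<rho>" using \<open>\<tau> \<subseteq> \<phi> ` \<sigma>\<close> by (auto simp: subset_image_iff)
    with assms that show ?thesis by (auto simp: simp_core_def)
  qed
  then show ?thesis using assms by (auto simp: simp_core_def)
qed

lemma simp_closure_image:
  assumes "bij_betw \<phi> V V'" "\<And>\<sigma>. \<sigma> \<in> H \<Longrightarrow> \<phi> ` \<sigma> \<in> H'" "\<sigma> \<in> simp_closure V H"
  shows "\<phi> ` \<sigma> \<in> simp_closure V' H'"
proof -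
  obtain \<rho> where \<rho>: "\<sigma> \<in> simplices V" "\<rho> \<in> H" "\<sigma> \<subseteq> \<rho>"
    using assms(3) by (auto simp: simp_closure_def)
  then show ?thesis
    unfolding simp_closure_def
    by (intro CollectI conjI bexI[of _ "\<phi> ` \<rho>"] image_simplices[OF assms(1)] image_mono assms(2))
qed

lemma ind_closure_image:
  assumes "bij_betw \<phi> V V'" "\<And>\<sigma>. \<sigma> \<in> H \<Longrightarrow> \<phi> ` \<sigma> \<in> H'" "\<sigma> \<in> ind_closure V H"
  shows "\<phi> ` \<sigma> \<in> ind_closure V' H'"
proof -
  obtain \<rho> where \<rho>: "\<sigma> \<in> simplices V" "\<rho> \<in> H" "\<rho> \<subseteq> \<sigma>"
    using assms(3) by (auto simp: ind_closure_def)
  then show ?thesis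
    unfolding ind_closure_def
    by (intro CollectI conjI bexI[of _ "\<phi> ` \<rho>"] image_simplices[OF assms(1)] image_mono assms(2))
qed

text \<open>
  A superset of \<open>\<phi> ` \<sigma>\<close> is the image of a superset of \<open>\<sigma>\<close> because \<open>\<phi>\<close> is onto \<open>V'\<close>.
\<close>

lemma ind_core_image:
  assumes bij: "bij_betw \<phi> V V'" and H: "\<And>\<sigma>. \<sigma> \<in> H \<Longrightarrow> \<phi> ` \<sigma> \<in> H'" "H \<subseteq> simplices V"
    and \<sigma>: "\<sigma> \<in> ind_core V H"
  shows "\<phi> ` \<sigma> \<in> ind_core V' H'"
proof -
  have "\<tau> \<in> H'" if \<tau>: "\<tau> \<in> simplices V'" "\<phi> ` \<sigma> \<subseteq> \<tau>" for \<tau>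
  proof -
    let ?\<rho> = "inv_into V \<phi> ` \<tau>"
    have "\<tau> \<subseteq> \<phi> ` V" using \<tau>(1) bij by (auto simp: simplices_def bij_betw_def)
    then have im: "\<phi> ` ?\<rho> = \<tau>" by (rule image_inv_into_cancel[OF refl])
    have "?\<rho> \<in> simplices V" by (rule image_simplices[OF bij_betw_inv_into[OF bij] \<tau>(1)])
    moreover have "\<sigma> \<subseteq> ?\<rho>"
    proof
      fix v assume v: "v \<in> \<sigma>"
      then have "v \<in> V" using \<sigma> H(2) by (auto simp: ind_core_def simplices_def)
      then have "v = inv_into V \<phi> (\<phi> v)" using bij by (simp add: bij_betw_def)
      then show "v \<in> ?\<rho>" using \<tau>(2) v by blast
    qed
    ultimately have "?\<rho> \<in> H" using \<sigma> by (auto simp: ind_core_def)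
    then show ?thesis using H(1) im by metis
  qed
  then show ?thesis using \<sigma> H(1) by (auto simp: ind_core_def)
qed

lemma simplicial_morphism:
  assumes "(2::'r::comm_ring_1) dvd 1" "H1 \<subseteq> simplices V" "H2 \<subseteq> simplices V"
    "H1' \<subseteq> simplices V'" "H2' \<subseteq> simplices V'" and \<phi>: "vertex_morphism V H1 H2 V' H1' H2' \<phi>"
  shows "setting_morphism V (-1) (partial_op :: _ \<Rightarrow> _ \<Rightarrow> _ \<Rightarrow>\<^sub>0 'r) simp_core (simp_closure V) H1 H2
    V' partial_op simp_core (simp_closure V') H1' H2' \<phi>"
proof -
  have bij: "bij_betw \<phi> V V'" and H: "\<And>\<sigma>. \<sigma> \<in> H1 \<Longrightarrow> \<phi> ` \<sigma> \<in> H1'" "\<And>\<sigma>. \<sigma> \<in> H2 \<Longrightarrow> \<phi> ` \<sigma> \<in> H2'"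
    using \<phi> by (auto simp: vertex_morphism_def)
  interpret S: hypergraph_setting V "-1" "partial_op :: _ \<Rightarrow> _ \<Rightarrow> _ \<Rightarrow>\<^sub>0 'r" simp_core "simp_closure V" H1 H2
    by (rule simplicial_setting[OF assms(1-3)])
  interpret S': hypergraph_setting V' "-1" "partial_op :: _ \<Rightarrow> _ \<Rightarrow> _ \<Rightarrow>\<^sub>0 'r" simp_core "simp_closure V'" H1' H2'
    by (rule simplicial_setting[OF assms(1,4,5)])
  show ?thesis
    by unfold_locales (use bij H simp_core_image simp_closure_image[OF bij] in
      \<open>blast intro: partial_op_equivariant[OF bij_betw_imp_inj_on[OF bij]]\<close>)+
qed

lemma independence_morphism:
  assumes "(2::'r::comm_ring_1) dvd 1" "H1 \<subseteq> simplices V" "H2 \<subseteq> simplices V"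
    "H1' \<subseteq> simplices V'" "H2' \<subseteq> simplices V'" and \<phi>: "vertex_morphism V H1 H2 V' H1' H2' \<phi>"
  shows "setting_morphism V 1 (d_op :: _ \<Rightarrow> _ \<Rightarrow> _ \<Rightarrow>\<^sub>0 'r) (ind_core V) (ind_closure V) H1 H2
    V' d_op (ind_core V') (ind_closure V') H1' H2' \<phi>"
proof -
  have bij: "bij_betw \<phi> V V'" and H: "\<And>\<sigma>. \<sigma> \<in> H1 \<Longrightarrow> \<phi> ` \<sigma> \<in> H1'" "\<And>\<sigma>. \<sigma> \<in> H2 \<Longrightarrow> \<phi> ` \<sigma> \<in> H2'"
    using \<phi> by (auto simp: vertex_morphism_def)
  interpret S: hypergraph_setting V 1 "d_op :: _ \<Rightarrow> _ \<Rightarrow> _ \<Rightarrow>\<^sub>0 'r" "ind_core V" "ind_closure V" H1 H2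
    by (rule independence_setting[OF assms(1-3)])
  interpret S': hypergraph_setting V' 1 "d_op :: _ \<Rightarrow> _ \<Rightarrow> _ \<Rightarrow>\<^sub>0 'r" "ind_core V'" "ind_closure V'" H1' H2'
    by (rule independence_setting[OF assms(1,4,5)])
  show ?thesis
    by unfold_locales (use bij H ind_core_image[OF bij _ assms(2)] ind_core_image[OF bij _ assms(3)] ind_closure_image[OF bij] in
      \<open>blast intro: d_op_equivariant[OF bij_betw_imp_inj_on[OF bij]]\<close>)+
qed

lemma vertex_morphism_comp:
  assumes "vertex_morphism V H1 H2 V' H1' H2' \<phi>" "vertex_morphism V' H1' H2' V'' H1'' H2'' \<psi>"
  shows "vertex_morphism V H1 H2 V'' H1'' H2'' (\<psi> \<circ> \<phi>)"
  using assms bij_betw_trans[of \<phi> V V' \<psi> V''] unfolding vertex_morphism_def image_comp[symmetric] by blast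

lemma cx_eta:
  "chain_cx t \<alpha> m = constrained_cx (-1) (ext_act partial_op \<alpha>) t m"
  "cochain_cx t \<omega> m = constrained_cx 1 (ext_act d_op \<omega>) t m"
  by (simp_all add: fun_eq_iff chain_cx_def cochain_cx_def)

theorem theorem4p5:
  fixes V :: "'v::linorder set" and H1 H2 :: "'v set set"
    and t s s1 s2 :: nat and m :: int
    and \<alpha> \<beta> \<beta>1 \<beta>2 \<omega> \<mu> \<mu>1 \<mu>2 :: "('v list \<Rightarrow>\<^sub>0 'r::idom) set"
  assumes two_invertible: "(2::'r) dvd 1"
    and hypergraphs: "H1 \<subseteq> simplices V" "H2 \<subseteq> simplices V"
    and \<alpha>: "\<alpha> \<in> ext_deg V (2 * t + 1)" and \<omega>: "\<omega> \<in> ext_deg V (2 * t + 1)"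
    and \<beta>: "\<beta> \<in> ext_deg V (2 * s)" "\<beta>1 \<in> ext_deg V (2 * s1)" "\<beta>2 \<in> ext_deg V (2 * s2)"
    and \<mu>: "\<mu> \<in> ext_deg V (2 * s)" "\<mu>1 \<in> ext_deg V (2 * s1)" "\<mu>2 \<in> ext_deg V (2 * s2)"
  shows
    "(
      \<comment> \<open>\<open>\<beta>\<^sub>*\<close> is a morphism\<close>
      hmv_morphism (MV_hom V H1 H2 t \<alpha> m) (MV_hom V H1 H2 t \<alpha> (m - 2 * int s))
        (beta_star V H1 H2 t \<alpha> m s \<beta>) \<and>
      \<comment> \<open>the diagram of \<open>\<beta>1\<close> and \<open>\<beta>2\<close> commutes\<close>
      hmv_morphism (MV_hom V H1 H2 t \<alpha> m) (MV_hom V H1 H2 t \<alpha> (m - 2 * int s1 - 2 * int s2))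
        (beta_star V H1 H2 t \<alpha> m (s1 + s2) (wedge V \<beta>1 \<beta>2)) \<and>
      hmv_eq (MV_hom V H1 H2 t \<alpha> m)
        (beta_star V H1 H2 t \<alpha> m (s1 + s2) (wedge V \<beta>1 \<beta>2))
        (hmv_comp (beta_star V H1 H2 t \<alpha> (m - 2 * int s2) s1 \<beta>1)
                  (beta_star V H1 H2 t \<alpha> m s2 \<beta>2)) \<and>
      hmv_eq (MV_hom V H1 H2 t \<alpha> m)
        (beta_star V H1 H2 t \<alpha> m (s1 + s2) (wedge V \<beta>1 \<beta>2))
        (hmv_comp (beta_star V H1 H2 t \<alpha> (m - 2 * int s1) s2 \<beta>2)
                  (beta_star V H1 H2 t \<alpha> m s1 \<beta>1)) \<and>
      \<comment> \<open>functoriality: induced morphisms of diagrams\<close>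
      (\<forall>(V' :: 'w::linorder set) H1' H2' \<phi>.
        H1' \<subseteq> simplices V' \<longrightarrow> H2' \<subseteq> simplices V' \<longrightarrow>
        vertex_morphism V H1 H2 V' H1' H2' \<phi> \<longrightarrow>
        (let \<alpha>' = ext_map \<phi> \<alpha>; \<beta>1' = ext_map \<phi> \<beta>1; \<beta>2' = ext_map \<phi> \<beta>2 in
          \<alpha>' \<in> ext_deg V' (2 * t + 1) \<and>
          \<beta>1' \<in> ext_deg V' (2 * s1) \<and> \<beta>2' \<in> ext_deg V' (2 * s2) \<and>
          (\<forall>k. hmv_morphism (MV_hom V H1 H2 t \<alpha> k) (MV_hom V' H1' H2' t \<alpha>' k)
                 (phi_hom V' H1' H2' t \<alpha>' k \<phi>)) \<and>
          (\<forall>k. hmv_eq (MV_hom V H1 H2 t \<alpha> k)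
                 (hmv_comp (phi_hom V' H1' H2' t \<alpha>' (k - 2 * int s1) \<phi>)
                           (beta_star V H1 H2 t \<alpha> k s1 \<beta>1))
                 (hmv_comp (beta_star V' H1' H2' t \<alpha>' k s1 \<beta>1')
                           (phi_hom V' H1' H2' t \<alpha>' k \<phi>))) \<and>
          (\<forall>k. hmv_eq (MV_hom V H1 H2 t \<alpha> k)
                 (hmv_comp (phi_hom V' H1' H2' t \<alpha>' (k - 2 * int s2) \<phi>)
                           (beta_star V H1 H2 t \<alpha> k s2 \<beta>2))
                 (hmv_comp (beta_star V' H1' H2' t \<alpha>' k s2 \<beta>2')
                           (phi_hom V' H1' H2' t \<alpha>' k \<phi>))) \<and>
          hmv_eq (MV_hom V H1 H2 t \<alpha> m)
            (hmv_comp (phi_hom V' H1' H2' t \<alpha>' (m - 2 * int s1 - 2 * int s2) \<phi>)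
                      (beta_star V H1 H2 t \<alpha> m (s1 + s2) (wedge V \<beta>1 \<beta>2)))
            (hmv_comp (beta_star V' H1' H2' t \<alpha>' m (s1 + s2) (wedge V' \<beta>1' \<beta>2'))
                      (phi_hom V' H1' H2' t \<alpha>' m \<phi>)))) \<and>
      \<comment> \<open>functoriality: identities\<close>
      (\<forall>\<xi>\<in>{\<alpha>, \<beta>1, \<beta>2}. ext_map id \<xi> = \<xi>) \<and>
      (\<forall>k. hmv_eq (MV_hom V H1 H2 t \<alpha> k) (phi_hom V H1 H2 t \<alpha> k id) hmv_id) \<and>
      \<comment> \<open>functoriality: compositions\<close>
      (\<forall>(V' :: 'w set) H1' H2' \<phi> (V'' :: 'x::linorder set) H1'' H2'' \<psi>.
        H1' \<subseteq> simplices V' \<longrightarrow> H2' \<subseteq> simplices V' \<longrightarrow>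
        H1'' \<subseteq> simplices V'' \<longrightarrow> H2'' \<subseteq> simplices V'' \<longrightarrow>
        vertex_morphism V H1 H2 V' H1' H2' \<phi> \<longrightarrow>
        vertex_morphism V' H1' H2' V'' H1'' H2'' \<psi> \<longrightarrow>
        (let \<alpha>' = ext_map \<phi> \<alpha>; \<alpha>'' = ext_map (\<psi> \<circ> \<phi>) \<alpha> in
          (\<forall>\<xi>\<in>{\<alpha>, \<beta>1, \<beta>2}. ext_map (\<psi> \<circ> \<phi>) \<xi> = ext_map \<psi> (ext_map \<phi> \<xi>)) \<and>
          (\<forall>k. hmv_eq (MV_hom V H1 H2 t \<alpha> k)
                 (phi_hom V'' H1'' H2'' t \<alpha>'' k (\<psi> \<circ> \<phi>))
                 (hmv_comp (phi_hom V'' H1'' H2'' t \<alpha>'' k \<psi>)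
                           (phi_hom V' H1' H2' t \<alpha>' k \<phi>)))))
    ) \<and> (
      \<comment> \<open>\<open>\<mu>\<^sub>*\<close> is a morphism\<close>
      hmv_morphism (MV_cohom V H1 H2 t \<omega> m) (MV_cohom V H1 H2 t \<omega> (m + 2 * int s))
        (mu_star V H1 H2 t \<omega> m s \<mu>) \<and>
      \<comment> \<open>the diagram of \<open>\<mu>1\<close> and \<open>\<mu>2\<close> commutes\<close>
      hmv_morphism (MV_cohom V H1 H2 t \<omega> m) (MV_cohom V H1 H2 t \<omega> (m + 2 * int s1 + 2 * int s2))
        (mu_star V H1 H2 t \<omega> m (s1 + s2) (wedge V \<mu>1 \<mu>2)) \<and>
      hmv_eq (MV_cohom V H1 H2 t \<omega> m)
        (mu_star V H1 H2 t \<omega> m (s1 + s2) (wedge V \<mu>1 \<mu>2))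
        (hmv_comp (mu_star V H1 H2 t \<omega> (m + 2 * int s2) s1 \<mu>1)
                  (mu_star V H1 H2 t \<omega> m s2 \<mu>2)) \<and>
      hmv_eq (MV_cohom V H1 H2 t \<omega> m)
        (mu_star V H1 H2 t \<omega> m (s1 + s2) (wedge V \<mu>1 \<mu>2))
        (hmv_comp (mu_star V H1 H2 t \<omega> (m + 2 * int s1) s2 \<mu>2)
                  (mu_star V H1 H2 t \<omega> m s1 \<mu>1)) \<and>
      \<comment> \<open>functoriality: induced morphisms of diagrams\<close>
      (\<forall>(V' :: 'w::linorder set) H1' H2' \<phi>.
        H1' \<subseteq> simplices V' \<longrightarrow> H2' \<subseteq> simplices V' \<longrightarrow>
        vertex_morphism V H1 H2 V' H1' H2' \<phi> \<longrightarrow>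
        (let \<omega>' = ext_map \<phi> \<omega>; \<mu>1' = ext_map \<phi> \<mu>1; \<mu>2' = ext_map \<phi> \<mu>2 in
          \<omega>' \<in> ext_deg V' (2 * t + 1) \<and>
          \<mu>1' \<in> ext_deg V' (2 * s1) \<and> \<mu>2' \<in> ext_deg V' (2 * s2) \<and>
          (\<forall>k. hmv_morphism (MV_cohom V H1 H2 t \<omega> k) (MV_cohom V' H1' H2' t \<omega>' k)
                 (phi_cohom V' H1' H2' t \<omega>' k \<phi>)) \<and>
          (\<forall>k. hmv_eq (MV_cohom V H1 H2 t \<omega> k)
                 (hmv_comp (phi_cohom V' H1' H2' t \<omega>' (k + 2 * int s1) \<phi>)
                           (mu_star V H1 H2 t \<omega> k s1 \<mu>1))
                 (hmv_comp (mu_star V' H1' H2' t \<omega>' k s1 \<mu>1')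
                           (phi_cohom V' H1' H2' t \<omega>' k \<phi>))) \<and>
          (\<forall>k. hmv_eq (MV_cohom V H1 H2 t \<omega> k)
                 (hmv_comp (phi_cohom V' H1' H2' t \<omega>' (k + 2 * int s2) \<phi>)
                           (mu_star V H1 H2 t \<omega> k s2 \<mu>2))
                 (hmv_comp (mu_star V' H1' H2' t \<omega>' k s2 \<mu>2')
                           (phi_cohom V' H1' H2' t \<omega>' k \<phi>))) \<and>
          hmv_eq (MV_cohom V H1 H2 t \<omega> m)
            (hmv_comp (phi_cohom V' H1' H2' t \<omega>' (m + 2 * int s1 + 2 * int s2) \<phi>)
                      (mu_star V H1 H2 t \<omega> m (s1 + s2) (wedge V \<mu>1 \<mu>2)))
            (hmv_comp (mu_star V' H1' H2' t \<omega>' m (s1 + s2) (wedge V' \<mu>1' \<mu>2'))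
                      (phi_cohom V' H1' H2' t \<omega>' m \<phi>)))) \<and>
      \<comment> \<open>functoriality: identities\<close>
      (\<forall>\<xi>\<in>{\<omega>, \<mu>1, \<mu>2}. ext_map id \<xi> = \<xi>) \<and>
      (\<forall>k. hmv_eq (MV_cohom V H1 H2 t \<omega> k) (phi_cohom V H1 H2 t \<omega> k id) hmv_id) \<and>
      \<comment> \<open>functoriality: compositions\<close>
      (\<forall>(V' :: 'w set) H1' H2' \<phi> (V'' :: 'x::linorder set) H1'' H2'' \<psi>.
        H1' \<subseteq> simplices V' \<longrightarrow> H2' \<subseteq> simplices V' \<longrightarrow>
        H1'' \<subseteq> simplices V'' \<longrightarrow> H2'' \<subseteq> simplices V'' \<longrightarrow>
        vertex_morphism V H1 H2 V' H1' H2' \<phi> \<longrightarrow>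
        vertex_morphism V' H1' H2' V'' H1'' H2'' \<psi> \<longrightarrow>
        (let \<omega>' = ext_map \<phi> \<omega>; \<omega>'' = ext_map (\<psi> \<circ> \<phi>) \<omega> in
          (\<forall>\<xi>\<in>{\<omega>, \<mu>1, \<mu>2}. ext_map (\<psi> \<circ> \<phi>) \<xi> = ext_map \<psi> (ext_map \<phi> \<xi>)) \<and>
          (\<forall>k. hmv_eq (MV_cohom V H1 H2 t \<omega> k)
                 (phi_cohom V'' H1'' H2'' t \<omega>'' k (\<psi> \<circ> \<phi>))
                 (hmv_comp (phi_cohom V'' H1'' H2'' t \<omega>'' k \<psi>)
                           (phi_cohom V' H1' H2' t \<omega>' k \<phi>)))))
    )"
proof -

  interpret S: hypergraph_setting V "-1" "partial_op :: _ \<Rightarrow> _ \<Rightarrow> _ \<Rightarrow>\<^sub>0 'r"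
    simp_core "simp_closure V" H1 H2
    by (rule simplicial_setting[OF two_invertible hypergraphs])

  interpret T: hypergraph_setting V "1" "d_op :: _ \<Rightarrow> _ \<Rightarrow> _ \<Rightarrow>\<^sub>0 'r"
    "ind_core V" "ind_closure V" H1 H2
    by (rule independence_setting[OF two_invertible hypergraphs])

  have w: "wedge V \<beta>1 \<beta>2 \<in> ext_deg V (2 * (s1 + s2))" "wedge V \<mu>1 \<mu>2 \<in> ext_deg V (2 * (s1 + s2))"
    using wedge_ext_deg[OF \<beta>(2,3)] wedge_ext_deg[OF \<mu>(2,3)] by (simp_all add: distrib_left)
  note hom_defs = MV_hom_def beta_star_def phi_hom_def cx_eta
  note cohom_defs = MV_cohom_def mu_star_def phi_cohom_def cx_eta

  have S1: "hmv_morphism (MV_hom V H1 H2 t \<alpha> m) (MV_hom V H1 H2 t \<alpha> (m - 2 * int s))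
      (beta_star V H1 H2 t \<alpha> m s \<beta>)"
    unfolding hom_defs by (rule S.act_morphism[OF \<alpha> \<beta>(1)]) simp
  have S2: "hmv_morphism (MV_hom V H1 H2 t \<alpha> m) (MV_hom V H1 H2 t \<alpha> (m - 2 * int s1 - 2 * int s2))
      (beta_star V H1 H2 t \<alpha> m (s1 + s2) (wedge V \<beta>1 \<beta>2))"
  proof -
    have m: "m - 2 * int s1 - 2 * int s2 = m - 2 * int (s1 + s2)" by simp
    show ?thesis unfolding hom_defs m by (rule S.act_morphism[OF \<alpha> w(1)]) simp
  qed
  have S3: "hmv_eq (MV_hom V H1 H2 t \<alpha> m) (beta_star V H1 H2 t \<alpha> m (s1 + s2) (wedge V \<beta>1 \<beta>2))
      (hmv_comp (beta_star V H1 H2 t \<alpha> (m - 2 * int s2) s1 \<beta>1) (beta_star V H1 H2 t \<alpha> m s2 \<beta>2))"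
  proof -
    have m: "m - 2 * int (s1 + s2) = m - 2 * int s2 - 2 * int s1" by simp
    show ?thesis unfolding hom_defs m by (rule S.act_wedge[OF \<alpha> \<beta>(2,3)]) simp_all
  qed
  have S4: "hmv_eq (MV_hom V H1 H2 t \<alpha> m) (beta_star V H1 H2 t \<alpha> m (s1 + s2) (wedge V \<beta>1 \<beta>2))
      (hmv_comp (beta_star V H1 H2 t \<alpha> (m - 2 * int s1) s2 \<beta>2) (beta_star V H1 H2 t \<alpha> m s1 \<beta>1))"
  proof -
    have m: "m - 2 * int (s1 + s2) = m - 2 * int s1 - 2 * int s2" by simp
    show ?thesis unfolding hom_defs m by (rule S.act_wedge_commute[OF \<alpha> \<beta>(2,3)]) simp_all
  qed
  have S5: "let \<alpha>' = ext_map \<phi> \<alpha>; \<beta>1' = ext_map \<phi> \<beta>1; \<beta>2' = ext_map \<phi> \<beta>2 in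
      \<alpha>' \<in> ext_deg V' (2 * t + 1) \<and> \<beta>1' \<in> ext_deg V' (2 * s1) \<and> \<beta>2' \<in> ext_deg V' (2 * s2) \<and>
      (\<forall>k. hmv_morphism (MV_hom V H1 H2 t \<alpha> k) (MV_hom V' H1' H2' t \<alpha>' k) (phi_hom V' H1' H2' t \<alpha>' k \<phi>)) \<and>
      (\<forall>k. hmv_eq (MV_hom V H1 H2 t \<alpha> k)
        (hmv_comp (phi_hom V' H1' H2' t \<alpha>' (k - 2 * int s1) \<phi>) (beta_star V H1 H2 t \<alpha> k s1 \<beta>1))
        (hmv_comp (beta_star V' H1' H2' t \<alpha>' k s1 \<beta>1') (phi_hom V' H1' H2' t \<alpha>' k \<phi>))) \<and>
      (\<forall>k. hmv_eq (MV_hom V H1 H2 t \<alpha> k)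
        (hmv_comp (phi_hom V' H1' H2' t \<alpha>' (k - 2 * int s2) \<phi>) (beta_star V H1 H2 t \<alpha> k s2 \<beta>2))
        (hmv_comp (beta_star V' H1' H2' t \<alpha>' k s2 \<beta>2') (phi_hom V' H1' H2' t \<alpha>' k \<phi>))) \<and>
      hmv_eq (MV_hom V H1 H2 t \<alpha> m)
        (hmv_comp (phi_hom V' H1' H2' t \<alpha>' (m - 2 * int s1 - 2 * int s2) \<phi>)
          (beta_star V H1 H2 t \<alpha> m (s1 + s2) (wedge V \<beta>1 \<beta>2)))
        (hmv_comp (beta_star V' H1' H2' t \<alpha>' m (s1 + s2) (wedge V' \<beta>1' \<beta>2')) (phi_hom V' H1' H2' t \<alpha>' m \<phi>))"
    if H': "H1' \<subseteq> simplices V'" "H2' \<subseteq> simplices V'" and \<phi>: "vertex_morphism V H1 H2 V' H1' H2' \<phi>"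
    for V' :: "'w set" and H1' H2' \<phi>
  proof -
    interpret \<phi>: setting_morphism V "-1" "partial_op :: _ \<Rightarrow> _ \<Rightarrow> _ \<Rightarrow>\<^sub>0 'r" simp_core "simp_closure V" H1 H2
      V' partial_op simp_core "simp_closure V'" H1' H2' \<phi>
      by (rule simplicial_morphism[OF two_invertible hypergraphs H' \<phi>])
    have m: "m - 2 * int s1 - 2 * int s2 = m - 2 * int (s1 + s2)" by simp
    show ?thesis
      unfolding Let_def hom_defs m ext_map_wedge[OF \<phi>.bij \<beta>(2,3), symmetric]
      by (intro conjI allI ext_map_ext_deg[OF \<phi>.bij] \<alpha> \<beta> \<phi>.chain_map_morphism
          \<phi>.chain_map_natural[OF \<alpha> \<beta>(2)] \<phi>.chain_map_natural[OF \<alpha> \<beta>(3)]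
          \<phi>.chain_map_natural[OF \<alpha> w(1)]) simp_all
  qed
  have S6: "\<forall>\<xi>\<in>{\<alpha>, \<beta>1, \<beta>2}. ext_map id \<xi> = \<xi>"
    using ext_map_id[OF \<alpha>] ext_map_id[OF \<beta>(2)] ext_map_id[OF \<beta>(3)] by simp
  have S7: "hmv_eq (MV_hom V H1 H2 t \<alpha> k) (phi_hom V H1 H2 t \<alpha> k id) hmv_id" for k
    unfolding hom_defs by (rule S.chain_map_id_induced[OF \<alpha>])
  have S8: "let \<alpha>' = ext_map \<phi> \<alpha>; \<alpha>'' = ext_map (\<psi> \<circ> \<phi>) \<alpha> in
      (\<forall>\<xi>\<in>{\<alpha>, \<beta>1, \<beta>2}. ext_map (\<psi> \<circ> \<phi>) \<xi> = ext_map \<psi> (ext_map \<phi> \<xi>)) \<and>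
      (\<forall>k. hmv_eq (MV_hom V H1 H2 t \<alpha> k) (phi_hom V'' H1'' H2'' t \<alpha>'' k (\<psi> \<circ> \<phi>))
        (hmv_comp (phi_hom V'' H1'' H2'' t \<alpha>'' k \<psi>) (phi_hom V' H1' H2' t \<alpha>' k \<phi>)))"
    if "H1' \<subseteq> simplices V'" "H2' \<subseteq> simplices V'" "H1'' \<subseteq> simplices V''" "H2'' \<subseteq> simplices V''"
      "vertex_morphism V H1 H2 V' H1' H2' \<phi>" "vertex_morphism V' H1' H2' V'' H1'' H2'' \<psi>"
    for V' :: "'w set" and H1' H2' \<phi> and V'' :: "'x set" and H1'' H2'' \<psi>
    unfolding Let_def hom_defs
    using chain_map_comp_induced[OF simplicial_morphism[OF two_invertible hypergraphs that(1,2,5)]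
        simplicial_morphism[OF two_invertible that(1-4,6)]
        simplicial_morphism[OF two_invertible hypergraphs that(3,4) vertex_morphism_comp[OF that(5,6)]] \<alpha>]
    by (simp only: ext_map_comp simp_thms ball_simps)

  have T1: "hmv_morphism (MV_cohom V H1 H2 t \<omega> m) (MV_cohom V H1 H2 t \<omega> (m + 2 * int s))
      (mu_star V H1 H2 t \<omega> m s \<mu>)"
    unfolding cohom_defs by (rule T.act_morphism[OF \<omega> \<mu>(1)]) simp
  have T2: "hmv_morphism (MV_cohom V H1 H2 t \<omega> m) (MV_cohom V H1 H2 t \<omega> (m + 2 * int s1 + 2 * int s2))
      (mu_star V H1 H2 t \<omega> m (s1 + s2) (wedge V \<mu>1 \<mu>2))"
  proof -
    have m: "m + 2 * int s1 + 2 * int s2 = m + 2 * int (s1 + s2)" by simp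
    show ?thesis unfolding cohom_defs m by (rule T.act_morphism[OF \<omega> w(2)]) simp
  qed
  have T3: "hmv_eq (MV_cohom V H1 H2 t \<omega> m) (mu_star V H1 H2 t \<omega> m (s1 + s2) (wedge V \<mu>1 \<mu>2))
      (hmv_comp (mu_star V H1 H2 t \<omega> (m + 2 * int s2) s1 \<mu>1) (mu_star V H1 H2 t \<omega> m s2 \<mu>2))"
  proof -
    have m: "m + 2 * int (s1 + s2) = m + 2 * int s2 + 2 * int s1" by simp
    show ?thesis unfolding cohom_defs m by (rule T.act_wedge[OF \<omega> \<mu>(2,3)]) simp_all
  qed
  have T4: "hmv_eq (MV_cohom V H1 H2 t \<omega> m) (mu_star V H1 H2 t \<omega> m (s1 + s2) (wedge V \<mu>1 \<mu>2))
      (hmv_comp (mu_star V H1 H2 t \<omega> (m + 2 * int s1) s2 \<mu>2) (mu_star V H1 H2 t \<omega> m s1 \<mu>1))"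
  proof -
    have m: "m + 2 * int (s1 + s2) = m + 2 * int s1 + 2 * int s2" by simp
    show ?thesis unfolding cohom_defs m by (rule T.act_wedge_commute[OF \<omega> \<mu>(2,3)]) simp_all
  qed
  have T5: "let \<omega>' = ext_map \<phi> \<omega>; \<mu>1' = ext_map \<phi> \<mu>1; \<mu>2' = ext_map \<phi> \<mu>2 in
      \<omega>' \<in> ext_deg V' (2 * t + 1) \<and> \<mu>1' \<in> ext_deg V' (2 * s1) \<and> \<mu>2' \<in> ext_deg V' (2 * s2) \<and>
      (\<forall>k. hmv_morphism (MV_cohom V H1 H2 t \<omega> k) (MV_cohom V' H1' H2' t \<omega>' k) (phi_cohom V' H1' H2' t \<omega>' k \<phi>)) \<and>
      (\<forall>k. hmv_eq (MV_cohom V H1 H2 t \<omega> k)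
        (hmv_comp (phi_cohom V' H1' H2' t \<omega>' (k + 2 * int s1) \<phi>) (mu_star V H1 H2 t \<omega> k s1 \<mu>1))
        (hmv_comp (mu_star V' H1' H2' t \<omega>' k s1 \<mu>1') (phi_cohom V' H1' H2' t \<omega>' k \<phi>))) \<and>
      (\<forall>k. hmv_eq (MV_cohom V H1 H2 t \<omega> k)
        (hmv_comp (phi_cohom V' H1' H2' t \<omega>' (k + 2 * int s2) \<phi>) (mu_star V H1 H2 t \<omega> k s2 \<mu>2))
        (hmv_comp (mu_star V' H1' H2' t \<omega>' k s2 \<mu>2') (phi_cohom V' H1' H2' t \<omega>' k \<phi>))) \<and>
      hmv_eq (MV_cohom V H1 H2 t \<omega> m)
        (hmv_comp (phi_cohom V' H1' H2' t \<omega>' (m + 2 * int s1 + 2 * int s2) \<phi>)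
          (mu_star V H1 H2 t \<omega> m (s1 + s2) (wedge V \<mu>1 \<mu>2)))
        (hmv_comp (mu_star V' H1' H2' t \<omega>' m (s1 + s2) (wedge V' \<mu>1' \<mu>2')) (phi_cohom V' H1' H2' t \<omega>' m \<phi>))"
    if H': "H1' \<subseteq> simplices V'" "H2' \<subseteq> simplices V'" and \<phi>: "vertex_morphism V H1 H2 V' H1' H2' \<phi>"
    for V' :: "'w set" and H1' H2' \<phi>
  proof -
    interpret \<phi>: setting_morphism V "1" "d_op :: _ \<Rightarrow> _ \<Rightarrow> _ \<Rightarrow>\<^sub>0 'r" "ind_core V" "ind_closure V" H1 H2
      V' d_op "ind_core V'" "ind_closure V'" H1' H2' \<phi>
      by (rule independence_morphism[OF two_invertible hypergraphs H' \<phi>])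
    have m: "m + 2 * int s1 + 2 * int s2 = m + 2 * int (s1 + s2)" by simp
    show ?thesis
      unfolding Let_def cohom_defs m ext_map_wedge[OF \<phi>.bij \<mu>(2,3), symmetric]
      by (intro conjI allI ext_map_ext_deg[OF \<phi>.bij] \<omega> \<mu> \<phi>.chain_map_morphism
          \<phi>.chain_map_natural[OF \<omega> \<mu>(2)] \<phi>.chain_map_natural[OF \<omega> \<mu>(3)]
          \<phi>.chain_map_natural[OF \<omega> w(2)]) simp_all
  qed
  have T6: "\<forall>\<xi>\<in>{\<omega>, \<mu>1, \<mu>2}. ext_map id \<xi> = \<xi>"
    using ext_map_id[OF \<omega>] ext_map_id[OF \<mu>(2)] ext_map_id[OF \<mu>(3)] by simp
  have T7: "hmv_eq (MV_cohom V H1 H2 t \<omega> k) (phi_cohom V H1 H2 t \<omega> k id) hmv_id" for k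
    unfolding cohom_defs by (rule T.chain_map_id_induced[OF \<omega>])
  have T8: "let \<omega>' = ext_map \<phi> \<omega>; \<omega>'' = ext_map (\<psi> \<circ> \<phi>) \<omega> in
      (\<forall>\<xi>\<in>{\<omega>, \<mu>1, \<mu>2}. ext_map (\<psi> \<circ> \<phi>) \<xi> = ext_map \<psi> (ext_map \<phi> \<xi>)) \<and>
      (\<forall>k. hmv_eq (MV_cohom V H1 H2 t \<omega> k) (phi_cohom V'' H1'' H2'' t \<omega>'' k (\<psi> \<circ> \<phi>))
        (hmv_comp (phi_cohom V'' H1'' H2'' t \<omega>'' k \<psi>) (phi_cohom V' H1' H2' t \<omega>' k \<phi>)))"
    if "H1' \<subseteq> simplices V'" "H2' \<subseteq> simplices V'" "H1'' \<subseteq> simplices V''" "H2'' \<subseteq> simplices V''"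
      "vertex_morphism V H1 H2 V' H1' H2' \<phi>" "vertex_morphism V' H1' H2' V'' H1'' H2'' \<psi>"
    for V' :: "'w set" and H1' H2' \<phi> and V'' :: "'x set" and H1'' H2'' \<psi>
    unfolding Let_def cohom_defs
    using chain_map_comp_induced[OF independence_morphism[OF two_invertible hypergraphs that(1,2,5)]
        independence_morphism[OF two_invertible that(1-4,6)]
        independence_morphism[OF two_invertible hypergraphs that(3,4) vertex_morphism_comp[OF that(5,6)]] \<omega>]
    by (simp only: ext_map_comp simp_thms ball_simps)

  show ?thesis
    by (intro conjI allI impI S1 S2 S3 S4 S5 S6 S7 S8 T1 T2 T3 T4 T5 T6 T7 T8)
qed

end
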